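(* Let $\lambda$ be a probability measure on $\mathbb{R}$ with finite variance which is not a delta measure. Then $\lambda$ is not freely strongly unimodal.
   Context: Unimodality: a Borel measure $\mu$ on $\mathbb{R}$ is unimodal if there exist $a\in\mathbb{R}$ and a function $f\colon\mathbb{R}\to[0,\infty)$, non-decreasing on $(-\infty,a)$ and non-increasing on $(a,\infty)$, such that $\mu(dx)=\mu(\{a\})\delta_a+f(x)\,dx$. Free strong unimodality: a probability measure $\mu$ on $\mathbb{R}$ is freely strongly unimodal if $\mu\boxplus\nu$ is unimodal for all unimodal probability distributions $\nu$ on $\mathbb{R}$. Free convolution $\boxplus$: let $\mathbb{C}^{\pm}$ be the open upper/lower half-planes. For a probability measure $\mu$ on $\mathbb{R}$ let $G_\mu(z)=\int_{\mathbb{R}}\frac{1}{z-x}\,d\mu(x)$, $z\in\mathbb{C}^+$, be its Cauchy transform. For every $\gamma>0$ there exist $\alpha,\beta,\delta>0$ such that $G_\mu$ is univalent on $\{z\in\mathbb{C}^+: |\mathrm{Re}\,z|<\alpha\,\mathrm{Im}\,z,\ \mathrm{Im}\,z>\beta\}$ and the image of this set under $G_\mu$ contains $\{z\in\mathbb{C}^-: |\mathrm{Re}\,z|<\gamma|\mathrm{Im}\,z|,\ |z|<\delta\}$; on the latter set one has the right inverse $G_\mu^{-1}$ and defines the R-transform $R_\mu(z)=G_\mu^{-1}(z)-\frac1z$. For probability measures $\mu,\nu$ on $\mathbb{R}$, $\mu\boxplus\nu$ is the unique probability measure $\lambda$ on $\mathbb{R}$ with $R_\lambda(z)=R_\mu(z)+R_\nu(z)$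 on the intersection of the domains of the three transforms. *)

theory Defs
  imports "HOL-Probability.Probability"
begin

definition unimodal :: "real measure \<Rightarrow> bool" where
  "unimodal \<mu> \<longleftrightarrow> sets \<mu> = sets borel \<and>
    (\<exists>(a::real) (f::real \<Rightarrow> real).
       (\<forall>x. 0 \<le> f x) \<and> mono_on {..<a} f \<and> antimono_on {a<..} f \<and>
       (\<forall>A \<in> sets borel. emeasure \<mu> A =
          emeasure \<mu> {a} * emeasure (return borel a) A + (\<integral>\<^sup>+x\<in>A. ennreal (f x) \<partial>lborel)))"

definition cauchy_transform :: "real measure \<Rightarrow> complex \<Rightarrow> complex" where
  "cauchy_transform \<mu> z = (LINT x|\<mu>. 1 / (z - complex_of_real x))"

definition upper_truncated_cone :: "real \<Rightarrow> real \<Rightarrow> complex set" where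
  "upper_truncated_cone \<alpha> \<beta> = {z. Im z > 0 \<and> \<bar>Re z\<bar> < \<alpha> * Im z \<and> Im z > \<beta>}"

definition lower_cone_sector :: "real \<Rightarrow> real \<Rightarrow> complex set" where
  "lower_cone_sector \<gamma> \<delta> = {z. Im z < 0 \<and> \<bar>Re z\<bar> < \<gamma> * \<bar>Im z\<bar> \<and> norm z < \<delta>}"

text \<open>
  The Cauchy transform of a probability measure is holomorphic on the upper half-plane,
  so univalence there is just injectivity.
\<close>

definition inversion_parameters ::
    "real measure \<Rightarrow> real \<Rightarrow> real \<Rightarrow> real \<Rightarrow> real \<Rightarrow> bool" where
  "inversion_parameters \<mu> \<gamma> \<alpha> \<beta> \<delta> \<longleftrightarrow>
     \<gamma> > 0 \<and> \<alpha> > 0 \<and> \<beta> > 0 \<and> \<delta> > 0 \<and>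
     inj_on (cauchy_transform \<mu>) (upper_truncated_cone \<alpha> \<beta>) \<and>
     lower_cone_sector \<gamma> \<delta> \<subseteq> cauchy_transform \<mu> ` upper_truncated_cone \<alpha> \<beta>"

text \<open>
  The domain of the R-transform is the union of the sectors obtained from all choices of
  the parameters. The R-transform is well defined on it: for a probability measure, the
  inverses belonging to two choices are holomorphic on their sectors and agree at
  \<open>cauchy_transform \<mu> (\<i> * y)\<close> for all large \<open>y\<close>, hence by the identity theorem on the
  intersection of the two sectors, which is again a sector.
\<close>

definition R_domain :: "real measure \<Rightarrow> complex set" where
  "R_domain \<mu> = {z. \<exists>\<gamma> \<alpha> \<beta> \<delta>. inversion_parameters \<mu> \<gamma> \<alpha> \<beta> \<delta> \<and> z \<in> lower_cone_sector \<gamma> \<delta>}"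

definition R_transform :: "real measure \<Rightarrow> complex \<Rightarrow> complex" where
  "R_transform \<mu> z = (THE r. \<exists>\<gamma> \<alpha> \<beta> \<delta>. inversion_parameters \<mu> \<gamma> \<alpha> \<beta> \<delta> \<and>
     z \<in> lower_cone_sector \<gamma> \<delta> \<and>
     r = inv_into (upper_truncated_cone \<alpha> \<beta>) (cauchy_transform \<mu>) z - 1 / z)"

definition free_convolution :: "real measure \<Rightarrow> real measure \<Rightarrow> real measure"
    (infixl \<open>\<boxplus>\<close> 65) where
  "\<mu> \<boxplus> \<nu> = (THE \<kappa>. real_distribution \<kappa> \<and>
     (\<forall>z \<in> R_domain \<kappa> \<inter> R_domain \<mu> \<inter> R_domain \<nu>.
        R_transform \<kappa> z = R_transform \<mu> z + R_transform \<nu> z))"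

definition freely_strongly_unimodal :: "real measure \<Rightarrow> bool" where
  "freely_strongly_unimodal \<mu> \<longleftrightarrow> real_distribution \<mu> \<and>
     (\<forall>\<nu>. real_distribution \<nu> \<and> unimodal \<nu> \<longrightarrow> unimodal (\<mu> \<boxplus> \<nu>))"

end

theory Submission
  imports Defs "HOL-Complex_Analysis.Complex_Analysis" "HOL-Real_Asymp.Real_Asymp"
begin

text \<open>
  Let \<open>\<sigma>\<^sup>2 > 0\<close> be the variance of \<open>\<Lambda>\<close>. Convolving a measure on a large scale \<open>n\<close> with \<open>\<Lambda>\<close> acts,
  after rescaling and centering, as free Brownian motion for the small time \<open>\<sigma>\<^sup>2/n\<^sup>2\<close>: a Cauchy
  transform \<open>G\<close> becomes \<open>G - (\<sigma>\<^sup>2/n\<^sup>2) G G'\<close> up to \<open>o(1/n\<^sup>2)\<close>. Hence it suffices to find a unimodal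
  density \<open>f = - Im G / \<pi>\<close> with a critical inflection point \<open>0\<close> left of its mode such that
  \<open>Im (G\<^sup>2)''(0) < 0\<close>: the perturbed density decreases at \<open>0\<close>, but still takes a larger value at \<open>2\<close>
  than at \<open>1\<close>. A mixture of two Cauchy distributions has this property, and for it \<open>Im (1/G(z) - z)\<close>
  is bounded below by a positive constant. At scale \<open>n\<close> this bound grows with \<open>n\<close>, which turns the
  subordination equations into small perturbations of the identity on a half-plane. All functions
  then extend holomorphically across the real axis, so the convolution has an explicit density,
  identified by the Poisson formula.
\<close>

subsection \<open>The Cauchy transform\<close>

text \<open>The perturbation has size 1/n^2 only, so at a point of nonzero slope it could not
  reverse the sign of f'. At a zero of f' where f' keeps its sign, the perturbation alone decides,
  while f is still unimodal. The coefficient comes from the second moment: for centered M, 1/G_M(w)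
  = w - var/w + o(1/w) in cones; at scale n the relevant w is close to n/G, so the argument of G is
  shifted by about (var/n^2) G. Without a third moment the remainder carries no rate, hence limits
  by dominated convergence throughout. The points 1 and 2 are fixed in the rescaled variable, so the
  strict inequality between the unperturbed values there survives the limit.
  \<open>free_convolution\<close> is a definite description: it says nothing until a measure with
  the right R-transform is exhibited and shown to be the only one. A general existence theory of
  subordination functions is avoided, because 1 / \<open>base_G\<close> stays so high in the upper
  half-plane that the transform of \<Lambda> enters only far from the real axis.\<close>

lemma (in real_distribution) integrable_bounded_complex:
  fixes f :: "real \<Rightarrow> complex"
  assumes "f \<in> borel_measurable borel" "\<And>x. norm (f x) \<le> B"
  shows "integrable M f"
  by (rule integrable_const_bound[where B=B]) (use assms in auto)

lemma Im_le_norm_diff_of_real: "Im z \<le> norm (z - complex_of_real x)"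
  using abs_Im_le_cmod[of "z - complex_of_real x"] by simp

lemma diff_of_real_nonzero: "Im z > 0 \<Longrightarrow> z - complex_of_real x \<noteq> 0"
  using Im_le_norm_diff_of_real[of z x] by fastforce

lemma norm_inverse_diff_of_real_le:
  assumes "Im z > 0"
  shows "norm (1 / (z - complex_of_real x)) \<le> 1 / Im z"
  using Im_le_norm_diff_of_real[of z x] assms
  by (simp add: norm_divide divide_simps)

lemma (in real_distribution) integrable_cauchy_kernel:
  assumes "Im z > 0"
  shows "integrable M (\<lambda>x. 1 / (z - complex_of_real x))"
  by (rule integrable_bounded_complex[OF _ norm_inverse_diff_of_real_le[OF assms]]) measurable

lemma (in real_distribution) norm_cauchy_transform_le:
  assumes "Im z > 0"
  shows "norm (cauchy_transform M z) \<le> 1 / Im z"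
proof -
  have "norm (cauchy_transform M z) \<le> (LINT x|M. 1 / Im z)"
    unfolding cauchy_transform_def
    by (rule Bochner_Integration.integral_norm_bound_integral)
       (use integrable_cauchy_kernel[OF assms] norm_inverse_diff_of_real_le[OF assms] in auto)
  then show ?thesis using prob_space by simp
qed

text \<open>Differentiation under the integral by hand: the error of the difference quotient of the
  kernel is h / ((z + h - x) (z - x)^2), at most 2 |h| / y^3 uniformly in x once |h| < y /
  2.\<close>

lemma (in real_distribution) cauchy_transform_has_derivative:
  assumes z: "Im z > 0"
  shows "(cauchy_transform M has_field_derivative
            (LINT x|M. - 1 / (z - complex_of_real x)\<^sup>2)) (at z)"
proof -
  define y where "y = Im z"
  have y: "y > 0" using z by (simp add: y_def)
  define D where "D = (LINT x|M. - 1 / (z - complex_of_real x)\<^sup>2)"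
  have nle: "y \<le> norm (z - complex_of_real x)" for x
    using Im_le_norm_diff_of_real[of z x] by (simp add: y_def)
  have intD: "integrable M (\<lambda>x. - 1 / (z - complex_of_real x)\<^sup>2)"
  proof (rule integrable_bounded_complex)
    show "norm (- 1 / (z - complex_of_real x)\<^sup>2) \<le> 1 / y\<^sup>2" for x
      using power_mono[OF nle[of x], of 2] y
      by (simp add: norm_divide norm_power divide_simps)
  qed measurable
  have key: "norm ((cauchy_transform M (z + h) - cauchy_transform M z) / h - D) \<le> norm h * (2 / y ^ 3)"
    if h: "h \<noteq> 0" "norm h < y / 2" for h
  proof -
    have Imh: "Im (z + h) \<ge> y / 2"
      using h abs_Im_le_cmod[of h] by (simp add: y_def)
    hence pos: "Im (z + h) > 0" using y by linarith
    have i1: "integrable M (\<lambda>x. 1 / (z + h - complex_of_real x))"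
      by (rule integrable_cauchy_kernel[OF pos])
    have i2: "integrable M (\<lambda>x. 1 / (z - complex_of_real x))"
      by (rule integrable_cauchy_kernel[OF z])
    have "(cauchy_transform M (z + h) - cauchy_transform M z) / h - D
       = (LINT x|M. (1 / (z + h - complex_of_real x) - 1 / (z - complex_of_real x)) / h
            - (- 1 / (z - complex_of_real x)\<^sup>2))"
      unfolding cauchy_transform_def D_def using i1 i2 intD by simp
    also have "norm \<dots> \<le> (LINT x|M. norm h * (2 / y ^ 3))"
    proof (rule Bochner_Integration.integral_norm_bound_integral)
      show "integrable M (\<lambda>x. (1 / (z + h - complex_of_real x) - 1 / (z - complex_of_real x)) / h
            - (- 1 / (z - complex_of_real x)\<^sup>2))"
        using i1 i2 intD by simp
      fix x
      have nz: "z - complex_of_real x \<noteq> 0" "z + h - complex_of_real x \<noteq> 0"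
        using diff_of_real_nonzero[OF z] diff_of_real_nonzero[OF pos] by auto
      have "(1 / (z + h - complex_of_real x) - 1 / (z - complex_of_real x)) / h
            - (- 1 / (z - complex_of_real x)\<^sup>2)
          = h / ((z + h - complex_of_real x) * (z - complex_of_real x)\<^sup>2)"
        using nz h(1) by (simp add: divide_simps) (simp add: algebra_simps power2_eq_square)
      also have "norm \<dots> = norm h / (norm (z + h - complex_of_real x) * (norm (z - complex_of_real x))\<^sup>2)"
        by (simp add: norm_divide norm_mult norm_power)
      also have "\<dots> \<le> norm h / (y / 2 * y\<^sup>2)"
        using Im_le_norm_diff_of_real[of "z+h" x] Imh nle[of x] y
        by (intro divide_left_mono mult_mono power_mono) (auto intro!: mult_pos_pos nz)
      finally show "norm ((1 / (z + h - complex_of_real x) - 1 / (z - complex_of_real x)) / h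
            - (- 1 / (z - complex_of_real x)\<^sup>2)) \<le> norm h * (2 / y ^ 3)"
        using y by (simp add: power2_eq_square power3_eq_cube field_simps)
    qed auto
    finally show ?thesis using prob_space by simp
  qed
  have "((\<lambda>h. (cauchy_transform M (z + h) - cauchy_transform M z) / h - D) \<longlongrightarrow> 0) (at 0)"
  proof (rule Lim_null_comparison)
    show "\<forall>\<^sub>F h in at 0. norm ((cauchy_transform M (z + h) - cauchy_transform M z) / h - D) \<le> norm h * (2 / y ^ 3)"
      unfolding eventually_at
    proof (intro exI[of _ "y / 2"] conjI ballI impI)
      show "y / 2 > 0" using y by simp
    qed (rule key, auto)
    show "((\<lambda>h. norm (h::complex) * (2 / y ^ 3)) \<longlongrightarrow> 0) (at 0)"
      by (intro tendsto_mult_left_zero tendsto_norm_zero tendsto_ident_at)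
  qed
  then show ?thesis unfolding DERIV_def D_def[symmetric] using LIM_zero_iff by blast
qed

lemma (in real_distribution) cauchy_transform_holomorphic:
  "cauchy_transform M holomorphic_on {z. Im z > 0}"
  by (rule holomorphic_onI)
     (use cauchy_transform_has_derivative field_differentiable_at_within field_differentiable_def in blast)

lemma Im_cauchy_kernel:
  "Im (1 / (z - complex_of_real x)) = - (Im z / (norm (z - complex_of_real x))\<^sup>2)"
  by (simp add: Im_divide cmod_power2)

lemma (in real_distribution) Im_cauchy_transform:
  assumes "Im z > 0"
  shows "Im (cauchy_transform M z) = - (LINT x|M. Im z / (norm (z - complex_of_real x))\<^sup>2)"
    and "integrable M (\<lambda>x. Im z / (norm (z - complex_of_real x))\<^sup>2)"
proof -
  note i = integrable_cauchy_kernel[OF assms]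
  show int: "integrable M (\<lambda>x. Im z / (norm (z - complex_of_real x))\<^sup>2)"
    using Bochner_Integration.integrable_minus[OF integrable_Im[OF i]] unfolding Im_cauchy_kernel by simp
  show "Im (cauchy_transform M z) = - (LINT x|M. Im z / (norm (z - complex_of_real x))\<^sup>2)"
    unfolding cauchy_transform_def integral_Im[OF i, symmetric] Im_cauchy_kernel by simp
qed

lemma (in real_distribution) Im_cauchy_transform_neg:
  assumes "Im z > 0"
  shows "Im (cauchy_transform M z) < 0"
proof -
  note I = Im_cauchy_transform[OF assms]
  have nz: "(norm (z - complex_of_real x))\<^sup>2 > 0" for x
    using diff_of_real_nonzero[OF assms, of x] by simp
  have "0 < (LINT x|M. Im z / (norm (z - complex_of_real x))\<^sup>2)"
  proof (rule integral_less_AE_space[of "\<lambda>x. 0", simplified])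
    show "emeasure M UNIV \<noteq> 0"
      using emeasure_space_1 by (simp)
  qed (use I assms nz in auto)
  then show ?thesis using I by simp
qed

lemma (in real_distribution) cauchy_transform_nonzero:
  "Im z > 0 \<Longrightarrow> cauchy_transform M z \<noteq> 0"
  using Im_cauchy_transform_neg by force

text \<open>Inside a cone |w|, and with it |x|, is controlled by |w - x|, which gives a bound
  uniform in x. The other bound is small for fixed x and large Im w. The minimum of both is ready
  for dominated convergence.\<close>

lemma norm_ratio_cone_le:
  assumes "Im w > 0" "\<bar>Re w\<bar> \<le> k * Im w"
  shows "norm (complex_of_real x / (w - complex_of_real x)) \<le> min (k + 2) (\<bar>x\<bar> / Im w)"
proof -
  have p: "norm (w - complex_of_real x) > 0"
    using diff_of_real_nonzero[OF assms(1), of x] by simp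
  have 1: "Im w \<le> norm (w - complex_of_real x)" by (rule Im_le_norm_diff_of_real)
  have k: "k \<ge> 0" using assms by (smt (verit) mult_neg_pos)
  have "norm (complex_of_real x) \<le> norm (w - complex_of_real x) + norm w"
    using norm_triangle_ineq4[of "w - complex_of_real x" w] by simp
  also have "norm w \<le> (k + 1) * Im w"
    using cmod_le[of w] assms by (simp add: algebra_simps)
  also have "\<dots> \<le> (k + 1) * norm (w - complex_of_real x)"
    using 1 k by (intro mult_left_mono) auto
  finally have "\<bar>x\<bar> \<le> (k + 2) * norm (w - complex_of_real x)" by (simp add: algebra_simps)
  hence "norm (complex_of_real x / (w - complex_of_real x)) \<le> k + 2"
    using p by (simp add: norm_divide divide_simps)
  moreover have "norm (complex_of_real x / (w - complex_of_real x)) \<le> \<bar>x\<bar> / Im w"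
    using 1 p assms by (simp add: norm_divide frac_le)
  ultimately show ?thesis by simp
qed

text \<open>Used with f = 1 for the first-order behaviour of a Cauchy transform and with f(x) = x^2
  for the second-order one, where it stands in for a third moment.\<close>

lemma integral_min_tendsto_0:
  fixes f :: "real \<Rightarrow> real"
  assumes "integrable M f" "sets M = sets borel" "k \<ge> 0" "\<And>x. f x \<ge> 0"
  shows "((\<lambda>y. LINT x|M. f x * min k (\<bar>x\<bar> / y)) \<longlongrightarrow> 0) at_top"
proof -
  have [measurable]: "f \<in> borel_measurable M" using assms by auto
  have [measurable]: "(\<lambda>x. x) \<in> borel_measurable M"
    using assms(2) sets_eq_imp_space_eq[OF assms(2)] by (simp add: measurable_def)
  have "((\<lambda>y. LINT x|M. f x * min k (\<bar>x\<bar> / y)) \<longlongrightarrow> (LINT x|M. (0::real))) at_top"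
  proof (rule integral_dominated_convergence_at_top)
    show "integrable M (\<lambda>x. f x * k)" using assms by simp
    show "AE x in M. ((\<lambda>y. f x * min k (\<bar>x\<bar> / y)) \<longlongrightarrow> 0) at_top"
    proof (rule AE_I2)
 fix x :: real
      have "((\<lambda>y. \<bar>x\<bar> / y) \<longlongrightarrow> 0) at_top"
        unfolding divide_inverse by (intro tendsto_mult_right_zero tendsto_inverse_0_at_top filterlim_ident)
      hence "((\<lambda>y. f x * min k (\<bar>x\<bar> / y)) \<longlongrightarrow> f x * min k 0) at_top"
        by (intro tendsto_intros)
      thus "((\<lambda>y. f x * min k (\<bar>x\<bar> / y)) \<longlongrightarrow> 0) at_top" using assms by simp
    qed
    show "\<forall>\<^sub>F y in at_top. AE x in M. norm (f x * min k (\<bar>x\<bar> / y)) \<le> f x * k"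
      using eventually_gt_at_top[of 0]
    proof eventually_elim
      case (elim y)
      show ?case
      proof (rule AE_I2)
        fix x
        have "0 \<le> min k (\<bar>x\<bar> / y)" using assms elim by simp
        thus "norm (f x * min k (\<bar>x\<bar> / y)) \<le> f x * k" using assms(4)[of x]
          by (simp add: abs_mult mult_left_mono)
      qed
    qed
  qed auto
  then show ?thesis by simp
qed

text \<open>The integrand is w / (w - x) - 1 = x / (w - x). The error is a function of Im w alone,
  so the limit is uniform over the cone.\<close>

lemma (in real_distribution) cauchy_transform_cone_bound:
  obtains e where "(e \<longlongrightarrow> 0) at_top"
    "\<And>w. Im w > 0 \<Longrightarrow> \<bar>Re w\<bar> \<le> k * Im w \<Longrightarrow> norm (w * cauchy_transform M w - 1) \<le> e (Im w)"
proof -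
  define e where "e = (\<lambda>y. LINT x|M. 1 * min (\<bar>k\<bar> + 2) (\<bar>x\<bar> / y))"
  show ?thesis
  proof (rule that)
    show "(e \<longlongrightarrow> 0) at_top" unfolding e_def
      by (rule integral_min_tendsto_0) auto
    fix w assume w: "Im w > 0" "\<bar>Re w\<bar> \<le> k * Im w"
    have w': "\<bar>Re w\<bar> \<le> \<bar>k\<bar> * Im w" using w by (smt (verit) mult_right_mono)
    have i: "integrable M (\<lambda>x. complex_of_real x / (w - complex_of_real x))"
      by (rule integrable_bounded_complex[where B="\<bar>k\<bar> + 2"])
         (use norm_ratio_cone_le[OF w(1) w'] in \<open>auto\<close>)
    have ib: "integrable M (\<lambda>x. 1 * min (\<bar>k\<bar> + 2) (\<bar>x\<bar> / Im w))"
      by (rule integrable_const_bound[where B="\<bar>k\<bar> + 2"]) (use w in \<open>auto\<close>)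
    have "w * cauchy_transform M w - 1 = (LINT x|M. w * (1 / (w - complex_of_real x)) - 1)"
      unfolding cauchy_transform_def using integrable_cauchy_kernel[OF w(1)] prob_space
      by (subst Bochner_Integration.integral_diff) (auto simp del: times_divide_eq_right)
    also have "\<dots> = (LINT x|M. complex_of_real x / (w - complex_of_real x))"
      by (rule Bochner_Integration.integral_cong)
         (use diff_of_real_nonzero[OF w(1)] in \<open>auto simp: field_simps\<close>)
    also have "norm \<dots> \<le> e (Im w)" unfolding e_def
      by (rule Bochner_Integration.integral_norm_bound_integral) (use i ib norm_ratio_cone_le[OF w(1) w'] in auto)
    finally show "norm (w * cauchy_transform M w - 1) \<le> e (Im w)" .
  qed
qed

subsection \<open>Uniqueness of the measure\<close>

lemma has_integral_inverse_1_plus_square: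
  "integrable lborel (\<lambda>u::real. 1 / (1 + u\<^sup>2))" "(LBINT u::real. 1 / (1 + u\<^sup>2)) = pi"
  using integrable_inverse_1_plus_square LBINT_inverse_1_plus_square
  by (simp_all add: set_integrable_def interval_lebesgue_integral_def set_lebesgue_integral_def divide_inverse)

lemma cauchy_density_integral:
  assumes "\<epsilon> > 0"
  shows "integrable lborel (\<lambda>t. \<epsilon> / ((t - x)\<^sup>2 + \<epsilon>\<^sup>2))" "(LBINT t. \<epsilon> / ((t - x)\<^sup>2 + \<epsilon>\<^sup>2)) = pi"
proof -
  have e: "\<epsilon> / ((x + \<epsilon> * u - x)\<^sup>2 + \<epsilon>\<^sup>2) = (1 / \<epsilon>) * (1 / (1 + u\<^sup>2))" for u
  proof -
    have "(x + \<epsilon> * u - x)\<^sup>2 + \<epsilon>\<^sup>2 = \<epsilon>\<^sup>2 * (1 + u\<^sup>2)" by (simp add: power_mult_distrib algebra_simps)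
    thus ?thesis using assms by (simp add: power2_eq_square)
  qed
  show "integrable lborel (\<lambda>t. \<epsilon> / ((t - x)\<^sup>2 + \<epsilon>\<^sup>2))"
    using lborel_integrable_real_affine_iff[of \<epsilon> "\<lambda>t. \<epsilon> / ((t - x)\<^sup>2 + \<epsilon>\<^sup>2)" x] assms
    unfolding e using integrable_mult_right[OF has_integral_inverse_1_plus_square(1), of "1 / \<epsilon>"]
    by blast
  show "(LBINT t. \<epsilon> / ((t - x)\<^sup>2 + \<epsilon>\<^sup>2)) = pi"
    using lborel_integral_real_affine[of \<epsilon> "\<lambda>t. \<epsilon> / ((t - x)\<^sup>2 + \<epsilon>\<^sup>2)" x] assms
    unfolding e integral_mult_right_zero by (simp add: has_integral_inverse_1_plus_square(2))
qed

lemma cmod_cauchy_kernel_sq: "(norm (Complex t \<epsilon> - complex_of_real x))\<^sup>2 = (t - x)\<^sup>2 + \<epsilon>\<^sup>2"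
  by (simp add: cmod_power2)

text \<open>At height \<epsilon>, - Im G is \<pi> times the density of M convolved with a Cauchy law
  of scale \<epsilon>. By Fubini its Fourier transform factors.\<close>

lemma (in real_distribution) char_times_cauchy:
  assumes \<epsilon>: "\<epsilon> > 0"
  shows "(LBINT t. iexp (s * t) * complex_of_real (- Im (cauchy_transform M (Complex t \<epsilon>))))
         = char M s * (LBINT u. iexp (s * \<epsilon> * u) * complex_of_real (1 / (1 + u\<^sup>2)))"
proof -
  interpret P: pair_sigma_finite M lborel
    by (intro pair_sigma_finite.intro sigma_finite_measure_axioms lborel.sigma_finite_measure_axioms)
  define f where "f = (\<lambda>x t. iexp (s * t) * complex_of_real (\<epsilon> / ((t - x)\<^sup>2 + \<epsilon>\<^sup>2)))"
  have nf: "norm (f x t) = \<epsilon> / ((t - x)\<^sup>2 + \<epsilon>\<^sup>2)" for x t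
    using \<epsilon> unfolding f_def norm_mult norm_of_real norm_exp_i_times by simp
  have [measurable]: "case_prod f \<in> borel_measurable (M \<Otimes>\<^sub>M lborel)"
    unfolding f_def by measurable
  have [measurable]: "f x \<in> borel_measurable lborel" for x
    unfolding f_def by measurable
  have intx: "integrable lborel (f x)" for x
    by (rule Bochner_Integration.integrable_bound[OF cauchy_density_integral(1)[OF \<epsilon>, of x]])
       (use \<epsilon> in \<open>auto simp: nf\<close>)
  have int: "integrable (M \<Otimes>\<^sub>M lborel) (case_prod f)"
    by (rule P.Fubini_integrable) (auto simp: nf cauchy_density_integral(2)[OF \<epsilon>] intx)
  have affine: "(LBINT t. f x t) = iexp (s * x) * (LBINT u. iexp (s * \<epsilon> * u) * complex_of_real (1 / (1 + u\<^sup>2)))" for x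
  proof -
    have "f x (x + \<epsilon> * u) = (iexp (s * x) / of_real \<epsilon>) * (iexp (s * \<epsilon> * u) * complex_of_real (1 / (1 + u\<^sup>2)))" for u
    proof -
      have "(x + \<epsilon> * u - x)\<^sup>2 + \<epsilon>\<^sup>2 = \<epsilon> * (\<epsilon> * (1 + u\<^sup>2))" by (simp add: power2_eq_square algebra_simps)
      hence A: "\<epsilon> / ((x + \<epsilon> * u - x)\<^sup>2 + \<epsilon>\<^sup>2) = (1 / \<epsilon>) * (1 / (1 + u\<^sup>2))" using \<epsilon> by simp
      have B: "iexp (s * (x + \<epsilon> * u)) = iexp (s * x) * iexp (s * \<epsilon> * u)"
        by (simp add: exp_add[symmetric] algebra_simps)
      show ?thesis unfolding f_def A B of_real_mult[of "1 / \<epsilon>"] by simp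
    qed
    hence "(LBINT t. f x t) = \<epsilon> *\<^sub>R (LBINT u. (iexp (s * x) / of_real \<epsilon>) * (iexp (s * \<epsilon> * u) * complex_of_real (1 / (1 + u\<^sup>2))))"
      using lborel_integral_real_affine[of \<epsilon> "f x" x] \<epsilon> by simp
    also have "\<dots> = \<epsilon> *\<^sub>R ((iexp (s * x) / of_real \<epsilon>) * (LBINT u. iexp (s * \<epsilon> * u) * complex_of_real (1 / (1 + u\<^sup>2))))"
      by (subst integral_mult_right_zero) rule
    finally show ?thesis using \<epsilon> by (simp add: scaleR_conv_of_real)
  qed
  have "(LBINT t. iexp (s * t) * complex_of_real (- Im (cauchy_transform M (Complex t \<epsilon>)))) = (LBINT t. (LINT x|M. f x t))"
  proof (rule Bochner_Integration.integral_cong[OF refl])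
    fix t
    have "- Im (cauchy_transform M (Complex t \<epsilon>)) = (LINT x|M. \<epsilon> / ((t - x)\<^sup>2 + \<epsilon>\<^sup>2))"
      using Im_cauchy_transform(1)[of "Complex t \<epsilon>"] \<epsilon> by (simp add: cmod_cauchy_kernel_sq)
    thus "iexp (s * t) * complex_of_real (- Im (cauchy_transform M (Complex t \<epsilon>))) = (LINT x|M. f x t)"
      unfolding f_def by (simp only: integral_mult_right_zero integral_complex_of_real)
  qed
  also have "\<dots> = (LINT x|M. (LBINT t. f x t))"
    using P.Fubini_integral[OF int] .
  also have "\<dots> = char M s * (LBINT u. iexp (s * \<epsilon> * u) * complex_of_real (1 / (1 + u\<^sup>2)))"
    unfolding affine char_def by (subst integral_mult_left_zero) rule
  finally show ?thesis .
qed

text \<open>Continuity at 0 replaces the evaluation of the Cauchy characteristic function: the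
  integral tends to \<pi> as \<epsilon> tends to 0.\<close>

lemma cauchy_char_nonzero:
  fixes s :: real
  obtains \<epsilon> where "\<epsilon> > 0" "(LBINT u. iexp (s * \<epsilon> * u) * complex_of_real (1 / (1 + u\<^sup>2))) \<noteq> 0"
proof -
  have "(\<lambda>n. LBINT u. iexp (s * (1 / real (Suc n)) * u) * complex_of_real (1 / (1 + u\<^sup>2)))
        \<longlonglongrightarrow> (LBINT u. complex_of_real (1 / (1 + u\<^sup>2)))"
  proof (rule integral_dominated_convergence)
    show "integrable lborel (\<lambda>u::real. 1 / (1 + u\<^sup>2))" by (rule has_integral_inverse_1_plus_square)
    show "AE u in lborel. (\<lambda>n. iexp (s * (1 / real (Suc n)) * u) * complex_of_real (1 / (1 + u\<^sup>2)))
            \<longlonglongrightarrow> complex_of_real (1 / (1 + u\<^sup>2))"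
    proof (rule AE_I2)
      fix u :: real
      have "(\<lambda>n. iexp (s * (1 / real (Suc n)) * u) * complex_of_real (1 / (1 + u\<^sup>2)))
            \<longlonglongrightarrow> iexp (s * 0 * u) * complex_of_real (1 / (1 + u\<^sup>2))"
        by (intro tendsto_intros LIMSEQ_Suc[OF lim_1_over_n])
      thus "(\<lambda>n. iexp (s * (1 / real (Suc n)) * u) * complex_of_real (1 / (1 + u\<^sup>2)))
            \<longlonglongrightarrow> complex_of_real (1 / (1 + u\<^sup>2))" by simp
    qed
    show "AE u in lborel. norm (iexp (s * (1 / real (Suc n)) * u) * complex_of_real (1 / (1 + u\<^sup>2))) \<le> 1 / (1 + u\<^sup>2)" for n
      unfolding norm_mult norm_of_real norm_exp_i_times by simp
  qed auto
  moreover have "(LBINT u. complex_of_real (1 / (1 + u\<^sup>2))) = complex_of_real pi"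
    by (simp only: integral_complex_of_real has_integral_inverse_1_plus_square)
  ultimately have "(\<lambda>n. LBINT u. iexp (s * (1 / real (Suc n)) * u) * complex_of_real (1 / (1 + u\<^sup>2)))
        \<longlonglongrightarrow> complex_of_real pi" by simp
  hence "\<forall>\<^sub>F n in sequentially. (LBINT u. iexp (s * (1 / real (Suc n)) * u) * complex_of_real (1 / (1 + u\<^sup>2))) \<noteq> 0"
    by (rule tendsto_imp_eventually_ne) simp
  then obtain n where "(LBINT u. iexp (s * (1 / real (Suc n)) * u) * complex_of_real (1 / (1 + u\<^sup>2))) \<noteq> 0"
    using eventually_happens by fastforce
  then show ?thesis by (intro that[of "1 / real (Suc n)"]) auto
qed

text \<open>For each s a suitable horizontal line suffices: there the nonzero Cauchy factor can be
  divided out, which leaves the characteristic function at s.\<close>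

lemma cauchy_transform_eqI:
  assumes \<mu>: "real_distribution \<mu>" and \<kappa>: "real_distribution \<kappa>"
    and eq: "\<And>z. Im z > 0 \<Longrightarrow> cauchy_transform \<mu> z = cauchy_transform \<kappa> z"
  shows "\<mu> = \<kappa>"
proof (rule Levy_uniqueness[OF \<mu> \<kappa>], rule ext)
  fix s
  obtain \<epsilon> where \<epsilon>: "\<epsilon> > 0" "(LBINT u. iexp (s * \<epsilon> * u) * complex_of_real (1 / (1 + u\<^sup>2))) \<noteq> 0"
    using cauchy_char_nonzero by blast
  have "cauchy_transform \<mu> (Complex t \<epsilon>) = cauchy_transform \<kappa> (Complex t \<epsilon>)" for t
    using eq \<epsilon> by simp
  then show "char \<mu> s = char \<kappa> s"
    using real_distribution.char_times_cauchy[OF \<mu> \<epsilon>(1), of s]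
          real_distribution.char_times_cauchy[OF \<kappa> \<epsilon>(1), of s] \<epsilon>(2) by simp
qed

subsection \<open>Perturbations of the identity\<close>

lemma inj_on_id_plus_contraction:
  fixes e :: "complex \<Rightarrow> complex"
  assumes "\<And>x y. x \<in> S \<Longrightarrow> y \<in> S \<Longrightarrow> norm (e x - e y) \<le> 1/2 * norm (x - y)"
  shows "inj_on (\<lambda>w. w + e w) S"
proof (rule inj_onI)
  fix x y assume xy: "x \<in> S" "y \<in> S" and eq: "x + e x = y + e y"
  have "x - y = - (e x - e y)" using eq by (simp add: algebra_simps)
  hence "norm (x - y) \<le> 1/2 * norm (x - y)" using assms[OF xy] by (metis norm_minus_cancel)
  thus "x = y" by simp
qed

lemma id_plus_contraction_hits_center:
  fixes e :: "complex \<Rightarrow> complex"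
  assumes lip: "\<And>x y. x \<in> cball v r \<Longrightarrow> y \<in> cball v r \<Longrightarrow> norm (e x - e y) \<le> 1/2 * norm (x - y)"
    and small: "\<And>x. x \<in> cball v r \<Longrightarrow> norm (e x) \<le> r" and "r \<ge> 0"
  obtains w where "w \<in> cball v r" "w + e w = v"
proof -
  have "\<exists>!w\<in>cball v r. v - e w = w"
  proof (rule Banach_fix[OF compact_imp_complete[OF compact_cball]])
    show "cball v r \<noteq> {}" using \<open>r \<ge> 0\<close> by auto
    show "(\<lambda>w. v - e w) ` cball v r \<subseteq> cball v r"
      using small by (auto simp: dist_norm)
    show "dist (v - e x) (v - e y) \<le> 1/2 * dist x y" if "x \<in> cball v r" "y \<in> cball v r" for x y
      using lip[of x y] that by (simp add: dist_norm norm_minus_commute)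
  qed auto
  then obtain w where "w \<in> cball v r" "v - e w = w" by auto
  then show ?thesis by (intro that[of w]) (auto simp: algebra_simps)
qed

lemma norm_deriv_le_on_cball:
  assumes f: "f holomorphic_on S" and S: "open S" "cball w r \<subseteq> S" and "r > 0"
    and B: "\<And>x. x \<in> cball w r \<Longrightarrow> norm (f x) \<le> B"
  shows "norm (deriv f w) \<le> B / r"
proof -
  have "norm ((deriv ^^ 1) f w) \<le> fact 1 * B / r ^ 1"
  proof (rule Cauchy_inequality)
    show "f holomorphic_on ball w r" using f S holomorphic_on_subset ball_subset_cball by blast
    show "continuous_on (cball w r) f"
      using f S holomorphic_on_imp_continuous_on continuous_on_subset by blast
    show "norm (f x) \<le> B" if "norm (w - x) = r" for x
      using B that by (auto simp: dist_norm)
  qed fact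
  then show ?thesis by simp
qed

lemma contraction_of_deriv_bound:
  fixes e :: "complex \<Rightarrow> complex"
  assumes "convex S" "open S" "e holomorphic_on S" "\<And>x. x \<in> S \<Longrightarrow> norm (deriv e x) \<le> b"
    and "x \<in> S" "y \<in> S"
  shows "norm (e x - e y) \<le> b * norm (x - y)"
  by (rule field_differentiable_bound[of S e "deriv e"])
     (use assms in \<open>auto intro: holomorphic_derivI\<close>)

subsection \<open>Inverting the Cauchy transform\<close>

lemma upper_truncated_cone_open_convex:
  "open (upper_truncated_cone \<alpha> \<beta>)" "convex (upper_truncated_cone \<alpha> \<beta>)"
proof -
  have eq: "upper_truncated_cone \<alpha> \<beta> = {z. Im z > 0} \<inter> {z. Re z - \<alpha> * Im z < 0}
      \<inter> {z. - Re z - \<alpha> * Im z < 0} \<inter> {z. Im z > \<beta>}"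
    by (auto simp: upper_truncated_cone_def abs_less_iff)
  show "open (upper_truncated_cone \<alpha> \<beta>)"
    unfolding eq by (intro open_Int open_Collect_less continuous_intros)
  have l1: "{z. Re z - \<alpha> * Im z < 0} = {z. inner (Complex 1 (-\<alpha>)) z < 0}"
    and l2: "{z. - Re z - \<alpha> * Im z < 0} = {z. inner (Complex (-1) (-\<alpha>)) z < 0}"
    by (auto simp: inner_complex_def)
  show "convex (upper_truncated_cone \<alpha> \<beta>)"
    unfolding eq l1 l2
    by (intro convex_Int convex_halfspace_lt convex_halfspace_Im_gt)
qed

lemma lower_cone_sector_open_convex:
  "open (lower_cone_sector \<gamma> \<delta>)" "convex (lower_cone_sector \<gamma> \<delta>)"
proof -
  have eq: "lower_cone_sector \<gamma> \<delta> = {z. Im z < 0} \<inter> {z. Re z + \<gamma> * Im z < 0}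
      \<inter> {z. - Re z + \<gamma> * Im z < 0} \<inter> ball 0 \<delta>"
    by (auto simp: lower_cone_sector_def abs_less_iff)
  show "open (lower_cone_sector \<gamma> \<delta>)"
    unfolding eq by (intro open_Int open_Collect_less continuous_intros open_ball)
  have l1: "{z. Re z + \<gamma> * Im z < 0} = {z. inner (Complex 1 \<gamma>) z < 0}"
    and l2: "{z. - Re z + \<gamma> * Im z < 0} = {z. inner (Complex (-1) \<gamma>) z < 0}"
    by (auto simp: inner_complex_def)
  show "convex (lower_cone_sector \<gamma> \<delta>)"
    unfolding eq l1 l2
    by (intro convex_Int convex_halfspace_lt convex_halfspace_Im_lt convex_ball)
qed

lemma lower_cone_sector_mono:
  "\<gamma> \<le> \<gamma>' \<Longrightarrow> \<delta> \<le> \<delta>' \<Longrightarrow> lower_cone_sector \<gamma> \<delta> \<subseteq> lower_cone_sector \<gamma>' \<delta>'"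
  by (auto simp: lower_cone_sector_def intro: less_le_trans mult_right_mono)

text \<open>With E(w) = 1/G(w) - w the equation G(w) = z reads w + E(w) = 1/z, and high in a cone E
  is small relative to w, so a contraction argument inverts G. E is estimated on the cone of
  aperture 2, injectivity is claimed on aperture 1 at twice the height, and the sector has slope
  1/4: each loss leaves room for discs of radius Im / 4. Slope and aperture are the same for every
  measure, so finitely many measures share a sector.\<close>

lemma (in real_distribution) inversion_parameters_exist:
  obtains \<beta> \<delta> where "inversion_parameters M (1/4) 1 \<beta> \<delta>"
proof -
  obtain e where e0: "(e \<longlongrightarrow> 0) at_top" and
    e: "\<And>w. Im w > 0 \<Longrightarrow> \<bar>Re w\<bar> \<le> 2 * Im w \<Longrightarrow> norm (w * cauchy_transform M w - 1) \<le> e (Im w)"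
    using cauchy_transform_cone_bound[of 2] by blast
  have "\<forall>\<^sub>F y in at_top. e y < 1/100"
    using order_tendstoD(2)[OF e0, of "1/100"] by simp
  then obtain b0 where b0: "\<And>y. y \<ge> b0 \<Longrightarrow> e y < 1/100"
    by (auto simp: eventually_at_top_linorder)
  define b where "b = max b0 1"
  have b: "b > 0" "\<And>y. y \<ge> b \<Longrightarrow> e y < 1/100" using b0 by (auto simp: b_def)
  define E where "E = (\<lambda>w. 1 / cauchy_transform M w - w)"
  have Ehol: "E holomorphic_on {z. Im z > 0}"
    unfolding E_def by (intro holomorphic_intros cauchy_transform_holomorphic) (auto simp: cauchy_transform_nonzero)
  have Eb: "norm (E w) \<le> norm w / 99" if "Im w \<ge> b" "\<bar>Re w\<bar> \<le> 2 * Im w" for w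
  proof -
    define G where "G = cauchy_transform M w"
    have pos: "Im w > 0" using that b by linarith
    have 1: "norm (w * G - 1) \<le> 1/100"
      using e[OF pos that(2)] b(2)[OF that(1)] by (simp add: G_def)
    have "norm (w * G) \<ge> 99/100"
      using norm_triangle_ineq2[of 1 "1 - w * G"] 1 by (simp add: norm_minus_commute)
    hence 2: "99/100 \<le> norm w * norm G" by (simp add: norm_mult)
    have G0: "G \<noteq> 0" using cauchy_transform_nonzero[OF pos] by (simp add: G_def)
    have "norm (E w) = norm (w * G - 1) / norm G"
      using G0 by (simp add: E_def G_def[symmetric] divide_simps norm_divide[symmetric] norm_minus_commute)
    also have "\<dots> \<le> (1/100) / norm G" using 1 by (intro divide_right_mono) auto
    also have "\<dots> \<le> norm w / 99" using 2 G0 by (simp add: divide_simps)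
    finally show ?thesis .
  qed
  define \<beta> where "\<beta> = 2 * b"
  define \<delta> where "\<delta> = 1 / (2 * \<beta>)"
  define C where "C = upper_truncated_cone 1 \<beta>"
  have ball: "Im w' \<ge> 3/4 * Im w" "\<bar>Re w'\<bar> \<le> \<bar>Re w\<bar> + Im w / 4" "norm w' \<le> norm w + Im w / 4"
    if "w' \<in> cball w (Im w / 4)" for w w'
    using that abs_Im_le_cmod[of "w - w'"] abs_Re_le_cmod[of "w - w'"] norm_triangle_ineq4[of w "w - w'"]
    by (auto simp: dist_norm)
  \<comment> \<open>The bound on E grows linearly in w, so the disc for Cauchy's estimate must grow
    with Im w too; the quotient is 1/11.\<close>
  have dE: "norm (deriv E w) \<le> 1/2" if "w \<in> C" for w
  proof -
    have w: "Im w > 2 * b" "\<bar>Re w\<bar> < Im w" "Im w > 0"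
      using that b by (auto simp: C_def upper_truncated_cone_def \<beta>_def)
    have "norm (deriv E w) \<le> (9/4 * Im w / 99) / (Im w / 4)"
    proof (rule norm_deriv_le_on_cball[OF Ehol])
      show "cball w (Im w / 4) \<subseteq> {z. Im z > 0}" using ball w by fastforce
      show "norm (E x) \<le> 9/4 * Im w / 99" if x: "x \<in> cball w (Im w / 4)" for x
      proof -
        have "norm w \<le> 2 * Im w" using cmod_le[of w] w by simp
        hence "norm x \<le> 9/4 * Im w" using ball(3)[OF x] by simp
        moreover have "norm (E x) \<le> norm x / 99"
          using ball(1,2)[OF x] w b by (intro Eb) auto
        ultimately show ?thesis by simp
      qed
    qed (use w in \<open>auto simp: open_halfspace_Im_gt\<close>)
    also have "\<dots> \<le> 1/2" using w by simp
    finally show ?thesis .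
  qed
  have CS: "C \<subseteq> {z. Im z > 0}" by (auto simp: C_def upper_truncated_cone_def)
  have lip: "norm (E x - E y) \<le> 1/2 * norm (x - y)" if "x \<in> C" "y \<in> C" for x y
    using contraction_of_deriv_bound[OF _ _ holomorphic_on_subset[OF Ehol CS] dE that]
      upper_truncated_cone_open_convex by (simp add: C_def)
  have inj: "inj_on (cauchy_transform M) C"
  proof (rule inj_onI)
    fix x y assume "x \<in> C" "y \<in> C" "cauchy_transform M x = cauchy_transform M y"
    thus "x = y" using inj_on_id_plus_contraction[of C E, OF lip]
      by (auto simp: E_def inj_on_def)
  qed
  have "lower_cone_sector (1/4) \<delta> \<subseteq> cauchy_transform M ` C"
  proof
    fix z assume "z \<in> lower_cone_sector (1/4) \<delta>"
    hence z: "Im z < 0" "\<bar>Re z\<bar> < 1/4 * \<bar>Im z\<bar>" "norm z < \<delta>"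
      by (auto simp: lower_cone_sector_def)
    define v where "v = 1 / z"
    have nz: "norm z > 0" using z by auto
    have Imv: "Im v = \<bar>Im z\<bar> / (norm z)\<^sup>2" and Rev: "\<bar>Re v\<bar> = \<bar>Re z\<bar> / (norm z)\<^sup>2"
      using z by (simp_all add: v_def Im_divide Re_divide cmod_power2 abs_divide)
    have v1: "\<bar>Re v\<bar> \<le> 1/4 * Im v" unfolding Imv Rev using z nz
      by (simp add: divide_simps)
    have v2: "Im v > 0" unfolding Imv using z nz by (intro divide_pos_pos) auto
    have "1 / \<delta> < norm v" using z nz by (simp add: v_def norm_divide frac_less2)
    moreover have vn: "norm v \<le> 5/4 * Im v" using cmod_le[of v] v1 v2 by simp
    ultimately have v3: "2 * \<beta> < 5/4 * Im v" by (simp add: \<delta>_def)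
    have sub: "cball v (Im v / 4) \<subseteq> C"
    proof
      fix w assume "w \<in> cball v (Im v / 4)"
      from ball(1,2)[OF this] v1 v2 v3 b show "w \<in> C"
        by (auto simp: C_def upper_truncated_cone_def \<beta>_def)
    qed
    obtain w where w: "w \<in> cball v (Im v / 4)" "w + E w = v"
    proof (rule id_plus_contraction_hits_center[of v "Im v / 4" E])
      show "norm (E x) \<le> Im v / 4" if x: "x \<in> cball v (Im v / 4)" for x
      proof -
        have "norm (E x) \<le> norm x / 99"
          using ball(1,2)[OF x] v1 v2 v3 b by (intro Eb) (auto simp: \<beta>_def)
        thus ?thesis using ball(3)[OF x] vn v2 by simp
      qed
      show "norm (E x - E y) \<le> 1/2 * norm (x - y)"
        if "x \<in> cball v (Im v / 4)" "y \<in> cball v (Im v / 4)" for x y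
        using that sub by (intro lip) auto
    qed (use v2 in auto)
    have wC: "w \<in> C" using w sub by auto
    hence "cauchy_transform M w = z"
      using w(2) CS cauchy_transform_nonzero[of w] nz by (auto simp: E_def v_def divide_simps)
    thus "z \<in> cauchy_transform M ` C" using wC by auto
  qed
  hence "inversion_parameters M (1/4) 1 \<beta> \<delta>"
    using inj b by (simp add: inversion_parameters_def C_def \<beta>_def \<delta>_def)
  then show ?thesis by (rule that)
qed

lemma (in real_distribution) inversion_holomorphic:
  assumes "inversion_parameters M \<gamma> \<alpha> \<beta> \<delta>"
  shows "inv_into (upper_truncated_cone \<alpha> \<beta>) (cauchy_transform M) holomorphic_on lower_cone_sector \<gamma> \<delta>"
proof -
  let ?C = "upper_truncated_cone \<alpha> \<beta>"
  have inj: "inj_on (cauchy_transform M) ?C"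
    and sub: "lower_cone_sector \<gamma> \<delta> \<subseteq> cauchy_transform M ` ?C"
    using assms by (auto simp: inversion_parameters_def)
  have "cauchy_transform M holomorphic_on ?C"
    by (rule holomorphic_on_subset[OF cauchy_transform_holomorphic]) (auto simp: upper_truncated_cone_def)
  then obtain g where g: "g holomorphic_on cauchy_transform M ` ?C"
      "\<And>z. z \<in> ?C \<Longrightarrow> g (cauchy_transform M z) = z"
    using holomorphic_has_inverse[OF _ upper_truncated_cone_open_convex(1) inj] by metis
  have "inv_into ?C (cauchy_transform M) holomorphic_on cauchy_transform M ` ?C"
    by (rule holomorphic_transform[OF g(1)]) (use g(2) inj in auto)
  then show ?thesis using sub by (rule holomorphic_on_subset)
qed

text \<open>As iy G(iy) tends to 1, G(iy) is asymptotic to -i/y and approaches 0 along the axis of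
  every lower sector.\<close>

lemma (in real_distribution) cauchy_transform_imaginary_axis:
  assumes "\<gamma> > 0" "\<delta> > 0"
  shows "\<forall>\<^sub>F y in at_top. cauchy_transform M (\<i> * complex_of_real y) \<in> lower_cone_sector \<gamma> \<delta>"
proof -
  obtain e where e0: "(e \<longlongrightarrow> 0) at_top" and
    e: "\<And>w. Im w > 0 \<Longrightarrow> \<bar>Re w\<bar> \<le> 0 * Im w \<Longrightarrow> norm (w * cauchy_transform M w - 1) \<le> e (Im w)"
    using cauchy_transform_cone_bound[of 0] by blast
  define r where "r = min (1/2) (\<gamma> / 4)"
  have r: "r > 0" "r \<le> 1/2" "r \<le> \<gamma> / 4" using assms by (auto simp: r_def)
  have "\<forall>\<^sub>F y in at_top. e y < r" using order_tendstoD(2)[OF e0 r(1)] .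
  moreover have "\<forall>\<^sub>F y in at_top. y > 1 / \<delta>" by (rule eventually_gt_at_top)
  ultimately show ?thesis
    using eventually_gt_at_top[of 0]
  proof eventually_elim
    case (elim y)
    define \<eta> where "\<eta> = (\<i> * complex_of_real y) * cauchy_transform M (\<i> * complex_of_real y) - 1"
    have \<eta>: "norm \<eta> < r" using e[of "\<i> * complex_of_real y"] elim by (simp add: \<eta>_def)
    have eta_ri: "\<bar>Re \<eta>\<bar> < r" "\<bar>Im \<eta>\<bar> < r"
      using \<eta> abs_Re_le_cmod[of \<eta>] abs_Im_le_cmod[of \<eta>] by linarith+
    have G: "cauchy_transform M (\<i> * complex_of_real y) = Complex (Im \<eta> / y) (- (1 + Re \<eta>) / y)"
      using elim by (intro complex_eqI) (auto simp: \<eta>_def)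
    have "1 / y < \<delta>" using elim assms by (simp add: field_simps)
    hence "norm (cauchy_transform M (\<i> * complex_of_real y)) < \<delta>"
      using norm_cauchy_transform_le[of "\<i> * complex_of_real y"] elim by simp
    moreover have *: "\<bar>Im \<eta>\<bar> < \<gamma> * \<bar>1 + Re \<eta>\<bar>"
    proof -
      have "\<bar>Im \<eta>\<bar> < \<gamma> / 4" using eta_ri r by linarith
      also have "\<dots> \<le> \<gamma> * (1/2)" using assms by simp
      also have "\<dots> \<le> \<gamma> * \<bar>1 + Re \<eta>\<bar>" using eta_ri r assms by (intro mult_left_mono) auto
      finally show ?thesis .
    qed
    hence "\<bar>Im \<eta> / y\<bar> < \<gamma> * \<bar>- (1 + Re \<eta>) / y\<bar>"
      using divide_strict_right_mono[OF * elim(3)] elim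
      by (simp only: abs_divide abs_minus_cancel times_divide_eq_right abs_of_pos)
    moreover have "- (1 + Re \<eta>) / y < 0" using eta_ri r elim by (simp add: divide_simps)
    ultimately show ?case unfolding lower_cone_sector_def mem_Collect_eq G by simp
  qed
qed

text \<open>The limit 0 of the curve y -> G(iy) lies outside the open sector, so an accumulation
  point of zeros has to be found elsewhere. The tail of the curve is connected, and it is no single
  point because it comes arbitrarily close to 0 and never reaches it; hence each of its points is a
  limit point.\<close>

lemma (in real_distribution) identity_on_sector:
  assumes "\<gamma> > 0" "\<delta> > 0" and f: "f holomorphic_on lower_cone_sector \<gamma> \<delta>"
    and ev: "\<forall>\<^sub>F y in at_top. f (cauchy_transform M (\<i> * complex_of_real y)) = 0"
    and z: "z \<in> lower_cone_sector \<gamma> \<delta>"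
  shows "f z = 0"
proof -
  define G where "G = (\<lambda>y. cauchy_transform M (\<i> * complex_of_real y))"
  have "\<forall>\<^sub>F y in at_top. G y \<in> lower_cone_sector \<gamma> \<delta> \<and> f (G y) = 0 \<and> y > 0"
    using cauchy_transform_imaginary_axis[OF assms(1,2)] ev eventually_gt_at_top[of 0]
    unfolding G_def by eventually_elim auto
  then obtain Y where Y: "\<And>y. y \<ge> Y \<Longrightarrow> G y \<in> lower_cone_sector \<gamma> \<delta> \<and> f (G y) = 0 \<and> y > 0"
    unfolding eventually_at_top_linorder by auto
  define U where "U = G ` {Y..}"
  have cont: "continuous_on {Y..} G"
    unfolding G_def
    by (rule continuous_on_compose2[OF holomorphic_on_imp_continuous_on[OF cauchy_transform_holomorphic]])
       (use Y in \<open>auto intro!: continuous_intros\<close>)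
  have "connected U" unfolding U_def by (intro connected_continuous_image cont) simp
  moreover have "\<nexists>x. U = {x}"
  proof
    assume "\<exists>x. U = {x}"
    then obtain x where x: "U = {x}" ..
    have "x \<noteq> 0"
    proof -
      have "G Y = x" using x by (auto simp: U_def)
      thus ?thesis using Y[of Y] cauchy_transform_nonzero[of "\<i> * complex_of_real Y"] by (auto simp: G_def)
    qed
    have "\<forall>\<^sub>F y in at_top. G y \<in> lower_cone_sector 1 (norm x)"
      unfolding G_def by (rule cauchy_transform_imaginary_axis) (use \<open>x \<noteq> 0\<close> in auto)
    then obtain y where "y \<ge> Y" "G y \<in> lower_cone_sector 1 (norm x)"
      by (metis eventually_at_top_linorder linorder_linear)
    moreover have "G y = x" using x \<open>y \<ge> Y\<close> by (auto simp: U_def)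
    ultimately show False by (auto simp: lower_cone_sector_def)
  qed
  moreover have GU: "G Y \<in> U" by (auto simp: U_def)
  ultimately have lim: "G Y islimpt U" using connected_imp_perfect by blast
  show ?thesis
    by (rule analytic_continuation[OF f lower_cone_sector_open_convex(1) _ _ _ lim _ z])
       (use Y lower_cone_sector_open_convex(2) in \<open>auto simp: U_def convex_connected\<close>)
qed

lemma inv_into_cauchy_transform:
  assumes "inversion_parameters M \<gamma> \<alpha> \<beta> \<delta>" "w \<in> upper_truncated_cone \<alpha> \<beta>"
  shows "inv_into (upper_truncated_cone \<alpha> \<beta>) (cauchy_transform M) (cauchy_transform M w) = w"
  using assms by (auto simp: inversion_parameters_def)

lemma eventually_near_imaginary_axis_in_cone:
  assumes "\<alpha> > 0"
  shows "\<forall>\<^sub>F y in at_top. \<forall>w. norm (w - \<i> * complex_of_real y) \<le> B \<longrightarrow> w \<in> upper_truncated_cone \<alpha> \<beta>"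
  using eventually_gt_at_top[of "\<bar>\<beta>\<bar> + B + B / \<alpha>"] eventually_gt_at_top[of "\<bar>\<beta>\<bar> + B"]
proof eventually_elim
  case (elim y)
  show ?case
  proof (intro allI impI)
    fix w assume "norm (w - \<i> * complex_of_real y) \<le> B"
    hence *: "\<bar>Re w\<bar> \<le> B" "\<bar>Im w - y\<bar> \<le> B"
      using abs_Re_le_cmod[of "w - \<i> * complex_of_real y"] abs_Im_le_cmod[of "w - \<i> * complex_of_real y"] by auto
    have "B = \<alpha> * (B / \<alpha>)" using assms by simp
    also have "\<dots> < \<alpha> * Im w" using * elim assms by (intro mult_strict_left_mono) linarith+
    finally show "w \<in> upper_truncated_cone \<alpha> \<beta>"
      using * elim by (auto simp: upper_truncated_cone_def)
  qed
qed

lemma (in real_distribution) eventually_inversion_imaginary_axis: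
  assumes P: "inversion_parameters M \<gamma> \<alpha> \<beta> \<delta>"
  shows "\<forall>\<^sub>F y in at_top. inv_into (upper_truncated_cone \<alpha> \<beta>) (cauchy_transform M)
           (cauchy_transform M (\<i> * complex_of_real y)) = \<i> * complex_of_real y"
proof -
  have "\<alpha> > 0" using P by (simp add: inversion_parameters_def)
  from eventually_near_imaginary_axis_in_cone[OF this, of 0 \<beta>] show ?thesis
    by eventually_elim (simp add: inv_into_cauchy_transform[OF P])
qed

text \<open>Resolves the definite description for any admissible parameters: two inverses are
  compared on the smaller of their sectors, where both send G(iy) back to iy for large y.\<close>

lemma (in real_distribution) R_transform_eq:
  assumes P: "inversion_parameters M \<gamma> \<alpha> \<beta> \<delta>" and z: "z \<in> lower_cone_sector \<gamma> \<delta>"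
  shows "R_transform M z = inv_into (upper_truncated_cone \<alpha> \<beta>) (cauchy_transform M) z - 1 / z"
  unfolding R_transform_def
proof (rule the_equality)
  show "\<exists>\<gamma>' \<alpha>' \<beta>' \<delta>'. inversion_parameters M \<gamma>' \<alpha>' \<beta>' \<delta>' \<and> z \<in> lower_cone_sector \<gamma>' \<delta>' \<and>
      inv_into (upper_truncated_cone \<alpha> \<beta>) (cauchy_transform M) z - 1 / z
      = inv_into (upper_truncated_cone \<alpha>' \<beta>') (cauchy_transform M) z - 1 / z"
    using assms by blast
next
  fix r assume "\<exists>\<gamma>' \<alpha>' \<beta>' \<delta>'. inversion_parameters M \<gamma>' \<alpha>' \<beta>' \<delta>' \<and> z \<in> lower_cone_sector \<gamma>' \<delta>' \<and>
      r = inv_into (upper_truncated_cone \<alpha>' \<beta>') (cauchy_transform M) z - 1 / z"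
  then obtain \<gamma>' \<alpha>' \<beta>' \<delta>' where P': "inversion_parameters M \<gamma>' \<alpha>' \<beta>' \<delta>'"
    and z': "z \<in> lower_cone_sector \<gamma>' \<delta>'"
    and r: "r = inv_into (upper_truncated_cone \<alpha>' \<beta>') (cauchy_transform M) z - 1 / z" by blast
  let ?h = "inv_into (upper_truncated_cone \<alpha> \<beta>) (cauchy_transform M)"
  let ?h' = "inv_into (upper_truncated_cone \<alpha>' \<beta>') (cauchy_transform M)"
  let ?S = "lower_cone_sector (min \<gamma> \<gamma>') (min \<delta> \<delta>')"
  have "?h z - ?h' z = 0"
  proof (rule identity_on_sector[of "min \<gamma> \<gamma>'" "min \<delta> \<delta>'" "\<lambda>z. ?h z - ?h' z"])
    show "(\<lambda>z. ?h z - ?h' z) holomorphic_on ?S"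
      by (intro holomorphic_intros holomorphic_on_subset[OF inversion_holomorphic[OF P]]
            holomorphic_on_subset[OF inversion_holomorphic[OF P']] lower_cone_sector_mono) auto
    show "\<forall>\<^sub>F y in at_top. ?h (cauchy_transform M (\<i> * complex_of_real y))
            - ?h' (cauchy_transform M (\<i> * complex_of_real y)) = 0"
      using eventually_inversion_imaginary_axis[OF P] eventually_inversion_imaginary_axis[OF P']
      by eventually_elim simp
    show "z \<in> ?S" using z z' by (auto simp: lower_cone_sector_def min_def)
  qed (use P P' in \<open>auto simp: inversion_parameters_def\<close>)
  then show "r = ?h z - 1 / z" using r by simp
qed

subsection \<open>Identifying the free convolution\<close>

text \<open>
  Subordination on the imaginary axis identifies the free convolution: by the identity theorem on
  a sector, \<open>R\<^sub>\<kappa> = R\<^sub>\<mu> + R\<^sub>\<nu>\<close> only has to be checked along the curve \<open>y \<mapsto> G\<^sub>\<kappa>(iy)\<close>.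
\<close>

lemma free_convolution_eqI:
  assumes \<mu>: "real_distribution \<mu>" and \<nu>: "real_distribution \<nu>" and \<kappa>: "real_distribution \<kappa>"
    and sub: "\<forall>\<^sub>F y in at_top.
      cauchy_transform \<mu> (\<omega>\<^sub>1 y) = cauchy_transform \<kappa> (\<i> * complex_of_real y) \<and>
      cauchy_transform \<nu> (\<omega>\<^sub>2 y) = cauchy_transform \<kappa> (\<i> * complex_of_real y) \<and>
      \<omega>\<^sub>1 y + \<omega>\<^sub>2 y = \<i> * complex_of_real y + 1 / cauchy_transform \<kappa> (\<i> * complex_of_real y) \<and>
      norm (\<omega>\<^sub>1 y - \<i> * complex_of_real y) \<le> B \<and> norm (\<omega>\<^sub>2 y - \<i> * complex_of_real y) \<le> B"
  shows "\<mu> \<boxplus> \<nu> = \<kappa>"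
  unfolding free_convolution_def
proof (rule the_equality)
  interpret \<mu>: real_distribution \<mu> by fact
  interpret \<nu>: real_distribution \<nu> by fact
  interpret \<kappa>: real_distribution \<kappa> by fact
  let ?inv = "\<lambda>\<rho> \<alpha> \<beta>. inv_into (upper_truncated_cone \<alpha> \<beta>) (cauchy_transform \<rho>)"
  show R: "real_distribution \<kappa> \<and>
    (\<forall>z \<in> R_domain \<kappa> \<inter> R_domain \<mu> \<inter> R_domain \<nu>. R_transform \<kappa> z = R_transform \<mu> z + R_transform \<nu> z)"
  proof (intro conjI ballI \<kappa>)
    fix z assume z: "z \<in> R_domain \<kappa> \<inter> R_domain \<mu> \<inter> R_domain \<nu>"
    obtain g a b d where P: "inversion_parameters \<kappa> g a b d" and zs: "z \<in> lower_cone_sector g d"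
      using z by (auto simp: R_domain_def)
    obtain g1 a1 b1 d1 where P1: "inversion_parameters \<mu> g1 a1 b1 d1" and zs1: "z \<in> lower_cone_sector g1 d1"
      using z by (auto simp: R_domain_def)
    obtain g2 a2 b2 d2 where P2: "inversion_parameters \<nu> g2 a2 b2 d2" and zs2: "z \<in> lower_cone_sector g2 d2"
      using z by (auto simp: R_domain_def)
    define G where "G = min g (min g1 g2)"
    define D where "D = min d (min d1 d2)"
    let ?f = "\<lambda>z. ?inv \<kappa> a b z - ?inv \<mu> a1 b1 z - ?inv \<nu> a2 b2 z + 1 / z"
    have "?f z = 0"
    proof (rule \<kappa>.identity_on_sector[of G D ?f])
      show "?f holomorphic_on lower_cone_sector G D"
      proof (intro holomorphic_intros)
        show "?inv \<kappa> a b holomorphic_on lower_cone_sector G D"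
          by (rule holomorphic_on_subset[OF \<kappa>.inversion_holomorphic[OF P]])
             (intro lower_cone_sector_mono; simp add: G_def D_def)
        show "?inv \<mu> a1 b1 holomorphic_on lower_cone_sector G D"
          by (rule holomorphic_on_subset[OF \<mu>.inversion_holomorphic[OF P1]])
             (intro lower_cone_sector_mono; simp add: G_def D_def)
        show "?inv \<nu> a2 b2 holomorphic_on lower_cone_sector G D"
          by (rule holomorphic_on_subset[OF \<nu>.inversion_holomorphic[OF P2]])
             (intro lower_cone_sector_mono; simp add: G_def D_def)
      qed (auto simp: lower_cone_sector_def)
      \<comment> \<open>The displacement bound B puts \<omega>1 and \<omega>2 into the truncated
        cones for large y, so \<open>inv_into\<close> recovers exactly these two values from the
        common transform value, and their sum is prescribed.\<close>
      have "a1 > 0" "a2 > 0" using P1 P2 by (auto simp: inversion_parameters_def)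
      note cone = eventually_near_imaginary_axis_in_cone[OF \<open>a1 > 0\<close>, of B b1]
        eventually_near_imaginary_axis_in_cone[OF \<open>a2 > 0\<close>, of B b2]
      show "\<forall>\<^sub>F y in at_top. ?f (cauchy_transform \<kappa> (\<i> * complex_of_real y)) = 0"
        using sub cone \<kappa>.eventually_inversion_imaginary_axis[OF P] eventually_gt_at_top[of 0]
      proof eventually_elim
        case (elim y)
        have "\<omega>\<^sub>1 y \<in> upper_truncated_cone a1 b1" "\<omega>\<^sub>2 y \<in> upper_truncated_cone a2 b2"
          using elim by auto
        hence "?inv \<mu> a1 b1 (cauchy_transform \<mu> (\<omega>\<^sub>1 y)) = \<omega>\<^sub>1 y"
          "?inv \<nu> a2 b2 (cauchy_transform \<nu> (\<omega>\<^sub>2 y)) = \<omega>\<^sub>2 y"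
          using inv_into_cauchy_transform[OF P1] inv_into_cauchy_transform[OF P2] by auto
        thus ?case using elim by (simp add: algebra_simps)
      qed
    qed (use P P1 P2 zs zs1 zs2 in \<open>auto simp: inversion_parameters_def G_def D_def lower_cone_sector_def min_def\<close>)
    then show "R_transform \<kappa> z = R_transform \<mu> z + R_transform \<nu> z"
      unfolding \<kappa>.R_transform_eq[OF P zs] \<mu>.R_transform_eq[OF P1 zs1] \<nu>.R_transform_eq[OF P2 zs2]
      by (simp add: algebra_simps)
  qed
  \<comment> \<open>Uniqueness: a competitor has the same R-transform on a common sector, hence the
    same inverse there, hence the same transform far up the imaginary axis and, by continuation, on
    the whole half-plane.\<close>
  fix \<rho> assume \<rho>: "real_distribution \<rho> \<and>
    (\<forall>z \<in> R_domain \<rho> \<inter> R_domain \<mu> \<inter> R_domain \<nu>. R_transform \<rho> z = R_transform \<mu> z + R_transform \<nu> z)"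
  interpret \<rho>: real_distribution \<rho> using \<rho> by simp
  obtain b d where P: "inversion_parameters \<kappa> (1/4) 1 b d" by (rule \<kappa>.inversion_parameters_exist)
  obtain b1 d1 where P1: "inversion_parameters \<mu> (1/4) 1 b1 d1" by (rule \<mu>.inversion_parameters_exist)
  obtain b2 d2 where P2: "inversion_parameters \<nu> (1/4) 1 b2 d2" by (rule \<nu>.inversion_parameters_exist)
  obtain b3 d3 where P3: "inversion_parameters \<rho> (1/4) 1 b3 d3" by (rule \<rho>.inversion_parameters_exist)
  define D where "D = min (min d d1) (min d2 d3)"
  have D: "D > 0" "D \<le> d" "D \<le> d1" "D \<le> d2" "D \<le> d3"
    using P P1 P2 P3 by (auto simp: D_def inversion_parameters_def)
  have eq: "?inv \<kappa> 1 b z = ?inv \<rho> 1 b3 z" if "z \<in> lower_cone_sector (1/4) D" for z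
  proof -
    have zs: "z \<in> lower_cone_sector (1/4) d" "z \<in> lower_cone_sector (1/4) d1"
      "z \<in> lower_cone_sector (1/4) d2" "z \<in> lower_cone_sector (1/4) d3"
      using that D by (auto simp: lower_cone_sector_def)
    hence "z \<in> R_domain \<kappa>" "z \<in> R_domain \<mu>" "z \<in> R_domain \<nu>" "z \<in> R_domain \<rho>"
      using P P1 P2 P3 unfolding R_domain_def by blast+
    hence "R_transform \<rho> z = R_transform \<kappa> z" using R \<rho> by auto
    thus ?thesis using \<kappa>.R_transform_eq[OF P zs(1)] \<rho>.R_transform_eq[OF P3 zs(4)] by simp
  qed
  have "\<forall>\<^sub>F y in at_top. cauchy_transform \<rho> (\<i> * complex_of_real y) = cauchy_transform \<kappa> (\<i> * complex_of_real y)"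
    using \<kappa>.cauchy_transform_imaginary_axis[OF _ D(1), of "1/4", simplified]
      \<kappa>.eventually_inversion_imaginary_axis[OF P]
  proof eventually_elim
    case (elim y)
    let ?z = "cauchy_transform \<kappa> (\<i> * complex_of_real y)"
    have "?z \<in> lower_cone_sector (1/4) d3" using elim(1) D by (auto simp: lower_cone_sector_def)
    hence "?z \<in> cauchy_transform \<rho> ` upper_truncated_cone 1 b3"
      using P3 by (auto simp: inversion_parameters_def)
    hence "cauchy_transform \<rho> (?inv \<rho> 1 b3 ?z) = ?z" by (rule f_inv_into_f)
    thus ?case using eq[of ?z] elim by simp
  qed
  then obtain Y where Y: "\<And>y. y \<ge> Y \<Longrightarrow>
      cauchy_transform \<rho> (\<i> * complex_of_real y) = cauchy_transform \<kappa> (\<i> * complex_of_real y)"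
    by (auto simp: eventually_at_top_linorder)
  define Y' where "Y' = max Y 1"
  define U where "U = (\<lambda>y. \<i> * complex_of_real y) ` {Y'..}"
  have "\<i> * complex_of_real Y' \<in> U" by (auto simp: U_def)
  moreover have "U \<noteq> {x}" for x
  proof
    assume "U = {x}"
    moreover have "\<i> * complex_of_real Y' \<in> U" "\<i> * complex_of_real (Y' + 1) \<in> U"
      unfolding U_def by (intro imageI; simp)+
    ultimately show False by auto
  qed
  moreover have "connected U" unfolding U_def
    by (intro connected_continuous_image continuous_intros) simp
  ultimately have lim: "\<i> * complex_of_real Y' islimpt U" using connected_imp_perfect by blast
  show "\<rho> = \<kappa>"
  proof (rule cauchy_transform_eqI)
    fix z assume z: "Im z > 0"
    have "cauchy_transform \<rho> z - cauchy_transform \<kappa> z = 0"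
    proof (rule analytic_continuation[of "\<lambda>z. cauchy_transform \<rho> z - cauchy_transform \<kappa> z", OF _ _ _ _ _ lim])
      show "(\<lambda>z. cauchy_transform \<rho> z - cauchy_transform \<kappa> z) holomorphic_on {z. Im z > 0}"
        by (intro holomorphic_intros \<rho>.cauchy_transform_holomorphic \<kappa>.cauchy_transform_holomorphic)
    qed (use z Y in \<open>auto simp: U_def Y'_def open_halfspace_Im_gt convex_halfspace_Im_gt intro!: convex_connected\<close>)
    then show "cauchy_transform \<rho> z = cauchy_transform \<kappa> z" by simp
  qed (rule \<rho>.real_distribution_axioms \<kappa>)+
qed

subsection \<open>Measures with a holomorphic boundary density\<close>

lemma integrable_of_quadratic_decay:
  fixes f :: "real \<Rightarrow> 'a::euclidean_space"
  assumes cont: "continuous_on UNIV f" and dec: "\<And>x. \<bar>x\<bar> \<ge> R \<Longrightarrow> norm (f x) \<le> C / x\<^sup>2"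
  shows "integrable lborel f"
proof -
  define r where "r = max \<bar>R\<bar> 1"
  have "compact (f ` {-r..r})"
    by (intro compact_continuous_image continuous_on_subset[OF cont]) auto
  then obtain B where B: "\<And>x. x \<in> {-r..r} \<Longrightarrow> norm (f x) \<le> B"
    using compact_imp_bounded bounded_iff by (metis imageI)
  define K where "K = \<bar>B\<bar> * (1 + r\<^sup>2) + 2 * \<bar>C\<bar>"
  have bd: "norm (f x) \<le> K * (1 / (1 + x\<^sup>2))" for x
  proof -
    have p: "1 + x\<^sup>2 > 0" by (simp add: add_pos_nonneg)
    have "norm (f x) * (1 + x\<^sup>2) \<le> K"
    proof (cases "\<bar>x\<bar> \<le> r")
      case True
      hence "norm (f x) \<le> \<bar>B\<bar>" using B[of x] abs_ge_self[of B] by (simp add: abs_le_iff)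
      moreover have "x\<^sup>2 \<le> r\<^sup>2" using True by (simp add: abs_le_square_iff[symmetric] r_def)
      ultimately have "norm (f x) * (1 + x\<^sup>2) \<le> \<bar>B\<bar> * (1 + r\<^sup>2)" by (intro mult_mono) auto
      thus ?thesis by (simp add: K_def)
    next
      case False
      hence x1: "x\<^sup>2 \<ge> 1" and xR: "\<bar>x\<bar> \<ge> R"
        using power_mono[of 1 "\<bar>x\<bar>" 2] by (auto simp: r_def)
      have "norm (f x) * (1 + x\<^sup>2) \<le> (\<bar>C\<bar> / x\<^sup>2) * (2 * x\<^sup>2)"
        using x1 by (intro mult_mono order_trans[OF dec[OF xR] divide_right_mono[OF abs_ge_self]]) auto
      also have "\<dots> = 2 * \<bar>C\<bar>" using x1 by auto
      also have "\<dots> \<le> K" by (simp add: K_def)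
      finally show ?thesis .
    qed
    thus ?thesis using p by (simp add: field_simps)
  qed
  show ?thesis
  proof (rule Bochner_Integration.integrable_bound)
    show "integrable lborel (\<lambda>x. K * (1 / (1 + x\<^sup>2)))"
      by (rule integrable_mult_right[OF has_integral_inverse_1_plus_square(1)])
    show "f \<in> borel_measurable lborel"
      using borel_measurable_continuous_onI[OF cont] by simp
    show "AE x in lborel. norm (f x) \<le> norm (K * (1 / (1 + x\<^sup>2)))"
    proof (rule AE_I2)
      fix x show "norm (f x) \<le> norm (K * (1 / (1 + x\<^sup>2)))"
        using bd[of x] by (metis abs_ge_self order_trans real_norm_def)
    qed
  qed
qed

lemma continuous_on_real_line:
  assumes "f holomorphic_on {w. Im w > - \<eta>}" "\<eta> > 0"
  shows "continuous_on UNIV (\<lambda>x. f (complex_of_real x))"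
  by (rule continuous_on_compose2[OF holomorphic_on_imp_continuous_on[OF assms(1)]])
     (use assms(2) in \<open>auto intro!: continuous_intros\<close>)

text \<open>Cauchy's theorem by way of a primitive \<Phi> on the half-plane: the integral over
  [-n, n] is \<Phi>(n) - \<Phi>(-n), and this difference is estimated along a detour through the
  upper half-plane.\<close>

lemma lborel_integral_real_line_eq_0:
  assumes \<eta>: "\<eta> > 0" and f: "f holomorphic_on {w. Im w > - \<eta>}"
    and dec: "\<And>w. Im w \<ge> 0 \<Longrightarrow> norm w \<ge> R \<Longrightarrow> norm (f w) \<le> C / (norm w)\<^sup>2"
  shows "integrable lborel (\<lambda>x. f (complex_of_real x))" "(LBINT x. f (complex_of_real x)) = 0"
proof -
  have cont: "continuous_on UNIV (\<lambda>x. f (complex_of_real x))"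
    by (rule continuous_on_real_line[OF f \<eta>])
  show int: "integrable lborel (\<lambda>x. f (complex_of_real x))"
    by (rule integrable_of_quadratic_decay[OF cont]) (use dec[of "complex_of_real _"] in auto)
  have conv: "convex {w. Im w > - \<eta>}" "open {w. Im w > - \<eta>}"
    by (auto simp: convex_halfspace_Im_gt open_halfspace_Im_gt)
  obtain \<Phi> where \<Phi>': "\<And>x. x \<in> {w. Im w > - \<eta>} \<Longrightarrow> (\<Phi> has_field_derivative f x) (at x within {w. Im w > - \<eta>})"
    using holomorphic_convex_primitive'[OF conv f] by blast
  have \<Phi>: "(\<Phi> has_field_derivative f x) (at x)" if "Im x > - \<eta>" for x
    using \<Phi>'[of x] at_within_open[of x, OF _ conv(2)] that by simp
  have FTC: "(LBINT x. indicator {-real n..real n} x *\<^sub>R f (complex_of_real x))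
      = \<Phi> (of_nat n) - \<Phi> (- of_nat n)" for n
  proof -
    have "((\<lambda>x. \<Phi> (complex_of_real x)) has_vector_derivative f (complex_of_real x)) (at x within {-real n..real n})" for x
    proof -
      have "(\<Phi> \<circ> complex_of_real has_vector_derivative (1 * f (complex_of_real x))) (at x within {-real n..real n})"
      proof (rule field_vector_diff_chain_within)
        show "(complex_of_real has_vector_derivative 1) (at x within {-real n..real n})"
          using bounded_linear.has_vector_derivative[OF bounded_linear_of_real[where 'a=complex]
              has_vector_derivative_id[of "at x within {-real n..real n}"]] by simp
        show "(\<Phi> has_field_derivative f (complex_of_real x)) (at (complex_of_real x) within complex_of_real ` {- real n..real n})"
          by (rule has_field_derivative_at_within[OF \<Phi>]) (use \<eta> in simp)
      qed
      thus ?thesis by (simp add: o_def)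
    qed
    from integral_FTC_Icc[OF _ this continuous_on_subset[OF cont subset_UNIV]]
    show ?thesis by simp
  qed
  \<comment> \<open>The detour goes from -n to n over the corner in, two sides of a triangle instead
    of a semicircle. On each side |w|^2 >= n^2 / 2, since (1-t)^2 + t^2 >= 1/2, and the length is at
    most 2n.\<close>
  have arc: "norm (\<Phi> (\<i> * of_nat n) - \<Phi> a) \<le> 4 * \<bar>C\<bar> / real n"
    if n: "real n \<ge> 2 * \<bar>R\<bar>" "n > 0" and a: "a = of_nat n \<or> a = - of_nat n" for n a
  proof -
    let ?S = "closed_segment a (\<i> * of_nat n)"
    have S: "Im w \<ge> 0 \<and> (norm w)\<^sup>2 \<ge> (real n)\<^sup>2 / 2" if w: "w \<in> ?S" for w
    proof -
      obtain t where t: "0 \<le> t" "t \<le> 1" "w = (1 - t) *\<^sub>R a + t *\<^sub>R (\<i> * of_nat n)"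
        using w unfolding in_segment by blast
      have "Re w = (1 - t) * real n \<or> Re w = - ((1 - t) * real n)"
        using a unfolding t(3) by auto
      hence Rw: "(Re w)\<^sup>2 = (1 - t)\<^sup>2 * (real n)\<^sup>2"
        by (metis power2_minus power_mult_distrib)
      have Iw: "Im w = t * real n" using a unfolding t(3) by auto
      have "(norm w)\<^sup>2 = ((1 - t)\<^sup>2 + t\<^sup>2) * (real n)\<^sup>2"
        unfolding cmod_power2 Rw Iw by (simp add: power_mult_distrib distrib_right)
      moreover have "(1 - t)\<^sup>2 + t\<^sup>2 \<ge> 1 / 2"
      proof -
        have "(1 - t)\<^sup>2 + t\<^sup>2 - 1 / 2 = 2 * (t - 1 / 2)\<^sup>2" by (simp add: power2_eq_square algebra_simps)
        thus ?thesis using zero_le_power2[of "t - 1/2"] by linarith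
      qed
      ultimately have "(norm w)\<^sup>2 \<ge> (real n)\<^sup>2 / 2" using mult_right_mono[of "1/2" "(1 - t)\<^sup>2 + t\<^sup>2" "(real n)\<^sup>2"] by simp
      moreover have "Im w \<ge> 0" using t(1) Iw by simp
      ultimately show ?thesis by simp
    qed
    have "norm (\<Phi> (\<i> * of_nat n) - \<Phi> a) \<le> (2 * \<bar>C\<bar> / (real n)\<^sup>2) * norm (\<i> * of_nat n - a)"
    proof (rule field_differentiable_bound[of ?S \<Phi> f])
      fix w assume w: "w \<in> ?S"
      show "(\<Phi> has_field_derivative f w) (at w within ?S)"
        using \<Phi>[of w] S[OF w] \<eta> by (auto intro: has_field_derivative_at_within)
      have pos: "(norm w)\<^sup>2 > 0" using S[OF w] n by (smt (verit) half_gt_zero_iff of_nat_0_less_iff zero_less_power)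
      have "R\<^sup>2 \<le> (real n)\<^sup>2 / 4"
        using power_mono[OF n(1), of 2] by (simp add: power_mult_distrib)
      also have "\<dots> \<le> (norm w)\<^sup>2" using S[OF w] zero_le_power2[of "real n"] by linarith
      finally have "norm w \<ge> R" by (rule power2_le_imp_le) auto
      hence "norm (f w) \<le> C / (norm w)\<^sup>2" using dec S[OF w] by auto
      also have "\<dots> \<le> \<bar>C\<bar> / ((real n)\<^sup>2 / 2)"
        using S[OF w] n pos by (intro frac_le) auto
      finally show "norm (f w) \<le> 2 * \<bar>C\<bar> / (real n)\<^sup>2" by (simp add: mult.commute)
    qed auto
    also have "\<dots> \<le> (2 * \<bar>C\<bar> / (real n)\<^sup>2) * (2 * real n)"
      using a norm_triangle_ineq4[of "\<i> * of_nat n" a]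
      by (intro mult_left_mono) (auto simp: norm_mult)
    finally show ?thesis using n by (simp add: power2_eq_square)
  qed
  have lim0: "(\<lambda>n. \<Phi> (of_nat n) - \<Phi> (- of_nat n)) \<longlonglongrightarrow> 0"
  proof (rule Lim_null_comparison)
    show "\<forall>\<^sub>F n in sequentially. norm (\<Phi> (of_nat n) - \<Phi> (- of_nat n)) \<le> 8 * \<bar>C\<bar> / real n"
      using eventually_ge_at_top[of "Suc (nat \<lceil>2 * \<bar>R\<bar>\<rceil>)"]
    proof eventually_elim
      case (elim n)
      hence n: "real n \<ge> 2 * \<bar>R\<bar>" "n > 0" by linarith+
      have "norm (\<Phi> (of_nat n) - \<Phi> (- of_nat n))
          = norm ((\<Phi> (\<i> * of_nat n) - \<Phi> (- of_nat n)) - (\<Phi> (\<i> * of_nat n) - \<Phi> (of_nat n)))" by simp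
      also have "\<dots> \<le> 4 * \<bar>C\<bar> / real n + 4 * \<bar>C\<bar> / real n"
        by (rule order_trans[OF norm_triangle_ineq4 add_mono]) (use arc[OF n] in auto)
      finally show ?case by simp
    qed
    show "(\<lambda>n. 8 * \<bar>C\<bar> / real n) \<longlonglongrightarrow> 0"
      by (rule lim_const_over_n)
  qed
  have "(\<lambda>n. LBINT x. indicator {-real n..real n} x *\<^sub>R f (complex_of_real x))
       \<longlonglongrightarrow> (LBINT x. f (complex_of_real x))"
  proof (rule integral_dominated_convergence)
    show "integrable lborel (\<lambda>x. norm (f (complex_of_real x)))" using int by simp
    show "AE x in lborel. (\<lambda>n. indicator {-real n..real n} x *\<^sub>R f (complex_of_real x)) \<longlonglongrightarrow> f (complex_of_real x)"
    proof (rule AE_I2, rule tendsto_eventually)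
      fix x :: real
      show "\<forall>\<^sub>F n in sequentially. indicator {-real n..real n} x *\<^sub>R f (complex_of_real x) = f (complex_of_real x)"
        using eventually_ge_at_top[of "nat \<lceil>\<bar>x\<bar>\<rceil>"]
      proof eventually_elim
        case (elim n)
        hence "\<bar>x\<bar> \<le> real n" by linarith
        thus ?case by (auto simp: indicator_def)
      qed
    qed
  qed (use borel_measurable_integrable[OF int] in \<open>auto simp: indicator_def\<close>)
  hence "(\<lambda>n. \<Phi> (of_nat n) - \<Phi> (- of_nat n)) \<longlonglongrightarrow> (LBINT x. f (complex_of_real x))"
    unfolding FTC .
  then show "(LBINT x. f (complex_of_real x)) = 0" using lim0 LIMSEQ_unique by blast
qed

text \<open>Apply the vanishing of the integral to (H(w) - H(z)) / ((w - z) (w - cnj z)). Its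
  singularity at z is removable, and on the real line the denominator is the real number |x - z|^2,
  so imaginary parts give the Poisson formula. The pole at \<open>cnj z\<close> is why the
  half-plane is cut down to Im w > - min \<eta> y.\<close>

lemma poisson_formula_half_plane:
  assumes \<eta>: "\<eta> > 0" and H: "H holomorphic_on {w. Im w > - \<eta>}"
    and dec: "\<And>w. Im w \<ge> 0 \<Longrightarrow> norm w \<ge> R \<Longrightarrow> norm (H w - 1 / w) \<le> C / (norm w)\<^sup>2"
    and z: "Im z > 0"
  shows "integrable lborel (\<lambda>x. Im (H (complex_of_real x)) * (Im z / (norm (z - complex_of_real x))\<^sup>2))"
    and "(LBINT x. Im (H (complex_of_real x)) * (Im z / (norm (z - complex_of_real x))\<^sup>2)) = pi * Im (H z)"
proof -
  define y where "y = Im z"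
  define f where "f = (\<lambda>w. (if w = z then deriv H z else (H w - H z) / (w - z)) / (w - cnj z))"
  define R' where "R' = max (max \<bar>R\<bar> 1) (2 * norm z)"
  define C' where "C' = 4 * (1 + \<bar>C\<bar> + norm (H z))"
  have q: "(norm (z - complex_of_real x))\<^sup>2 = (x - Re z)\<^sup>2 + y\<^sup>2" for x
    by (simp add: y_def cmod_power2 power2_commute)
  have fx: "Im (f (complex_of_real x)) = (Im (H (complex_of_real x)) - Im (H z)) / (norm (z - complex_of_real x))\<^sup>2" for x
  proof -
    have "complex_of_real x \<noteq> z" using z by auto
    hence "f (complex_of_real x) = (H (complex_of_real x) - H z) / ((complex_of_real x - z) * (complex_of_real x - cnj z))"
      by (simp add: f_def)
    also have "(complex_of_real x - z) * (complex_of_real x - cnj z) = complex_of_real ((norm (complex_of_real x - z))\<^sup>2)"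
      unfolding complex_norm_square by simp
    finally show ?thesis by (simp add: norm_minus_commute flip: of_real_power)
  qed
  have hol: "f holomorphic_on {w. Im w > - min \<eta> y}"
    unfolding f_def
  proof (intro holomorphic_on_divide pole_lemma_open)
    show "H holomorphic_on {w. Im w > - min \<eta> y}"
      by (rule holomorphic_on_subset[OF H]) auto
  qed (use z in \<open>auto intro!: holomorphic_intros simp: y_def open_halfspace_Im_gt\<close>)
  have bound: "norm (f w) \<le> C' / (norm w)\<^sup>2" if w: "Im w \<ge> 0" "norm w \<ge> R'" for w
  proof -
    have w1: "norm w \<ge> 1" "norm w \<ge> R" "norm w \<ge> 2 * norm z" using w by (auto simp: R'_def)
    have wz: "w \<noteq> z" using w1 by auto
    have d: "norm (w - z) \<ge> norm w / 2" "norm (w - cnj z) \<ge> norm w / 2"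
      using norm_triangle_ineq2[of w z] norm_triangle_ineq2[of w "cnj z"] w1 by auto
    have "norm (H w) \<le> norm (H w - 1 / w) + norm (1 / w)" by (metis add.commute norm_triangle_sub)
    also have "norm (H w - 1 / w) \<le> \<bar>C\<bar> / (norm w)\<^sup>2"
      by (rule order_trans[OF dec divide_right_mono]) (use w w1 in auto)
    also have "\<bar>C\<bar> / (norm w)\<^sup>2 \<le> \<bar>C\<bar> / 1" 
      using power_mono[OF w1(1), of 2] by (intro divide_left_mono) auto
    also have "norm (1 / w) \<le> 1" using w1 by (simp add: norm_divide divide_simps)
    finally have Hw: "norm (H w - H z) \<le> 1 + \<bar>C\<bar> + norm (H z)"
      using norm_triangle_ineq4[of "H w" "H z"] by simp
    have "norm (f w) = norm (H w - H z) / (norm (w - z) * norm (w - cnj z))"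
      using wz by (simp add: f_def norm_divide norm_mult)
    also have "\<dots> \<le> (1 + \<bar>C\<bar> + norm (H z)) / (norm w / 2 * (norm w / 2))"
      using Hw d w1 by (intro frac_le mult_mono mult_pos_pos) auto
    also have "\<dots> = C' / (norm w)\<^sup>2" by (simp add: C'_def power2_eq_square)
    finally show ?thesis .
  qed
  have "min \<eta> y > 0" using \<eta> z by (simp add: y_def)
  note f0 = lborel_integral_real_line_eq_0[OF this hol bound]
  have int1: "integrable lborel (\<lambda>x. (Im (H (complex_of_real x)) - Im (H z)) / (norm (z - complex_of_real x))\<^sup>2)"
    and val1: "(LBINT x. (Im (H (complex_of_real x)) - Im (H z)) / (norm (z - complex_of_real x))\<^sup>2) = 0"
    using integrable_Im[OF f0(1)] integral_Im[OF f0(1)] f0(2) by (simp_all add: fx)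
  have yp: "y > 0" using z by (simp add: y_def)
  have int2: "integrable lborel (\<lambda>x. y / (norm (z - complex_of_real x))\<^sup>2)"
    and val2: "(LBINT x. y / (norm (z - complex_of_real x))\<^sup>2) = pi"
    using cauchy_density_integral[OF yp, of "Re z"] by (simp_all add: q)
  have eq: "Im (H (complex_of_real x)) * (Im z / (norm (z - complex_of_real x))\<^sup>2) =
      y * ((Im (H (complex_of_real x)) - Im (H z)) / (norm (z - complex_of_real x))\<^sup>2)
      + Im (H z) * (y / (norm (z - complex_of_real x))\<^sup>2)" for x
    by (simp add: y_def diff_divide_distrib algebra_simps)
  show "integrable lborel (\<lambda>x. Im (H (complex_of_real x)) * (Im z / (norm (z - complex_of_real x))\<^sup>2))"
    unfolding eq using int1 int2 by (intro Bochner_Integration.integrable_add integrable_mult_right)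
  have "(LBINT x. Im (H (complex_of_real x)) * (Im z / (norm (z - complex_of_real x))\<^sup>2))
     = y * (LBINT x. (Im (H (complex_of_real x)) - Im (H z)) / (norm (z - complex_of_real x))\<^sup>2)
       + Im (H z) * (LBINT x. y / (norm (z - complex_of_real x))\<^sup>2)"
    unfolding eq integral_mult_right_zero[symmetric]
    by (rule Bochner_Integration.integral_add) (intro integrable_mult_right int1 int2)+
  then show "(LBINT x. Im (H (complex_of_real x)) * (Im z / (norm (z - complex_of_real x))\<^sup>2)) = pi * Im (H z)"
    unfolding val1 val2 by simp
qed

lemma holomorphic_Im_0_constant:
  assumes f: "f holomorphic_on S" and S: "open S" "connected S" and Im: "\<And>z. z \<in> S \<Longrightarrow> Im (f z) = 0"
  obtains c where "\<And>z. z \<in> S \<Longrightarrow> f z = c"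
proof (cases "S = {}")
  case False
  have "f constant_on S"
  proof (rule ccontr)
    assume "\<not> f constant_on S"
    hence "open (f ` S)" by (intro open_mapping_thm[OF f S]) (use S in auto)
    then obtain z e where z: "z \<in> S" "e > 0" "ball (f z) e \<subseteq> f ` S"
      using False open_contains_ball by (metis ex_in_conv image_eqI)
    have "f z + \<i> * complex_of_real (e / 2) \<in> ball (f z) e"
      using z(2) by (simp add: dist_norm norm_mult)
    then obtain w where "w \<in> S" "f z + \<i> * complex_of_real (e / 2) = f w" using z(3) by auto
    hence "Im (f w) = Im (f z) + e / 2" by (metis Im_i_times Re_complex_of_real plus_complex.sel(2))
    thus False using Im \<open>w \<in> S\<close> z by simp
  qed
  then show ?thesis using that by (auto simp: constant_on_def)
qed (use that in auto)

text \<open>The Poisson formula matches the imaginary parts of H and of the Cauchy transform of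
  \<kappa>. Their difference is then constant, and the decay along the imaginary axis makes the
  constant 0.\<close>

theorem cauchy_transform_of_boundary_density:
  fixes H :: "complex \<Rightarrow> complex"
  defines "\<kappa> \<equiv> density lborel (\<lambda>x. ennreal (- Im (H (complex_of_real x)) / pi))"
  assumes \<eta>: "\<eta> > 0" and H: "H holomorphic_on {w. Im w > - \<eta>}"
    and dec: "\<And>w. Im w \<ge> 0 \<Longrightarrow> norm w \<ge> R \<Longrightarrow> norm (H w - 1 / w) \<le> C / (norm w)\<^sup>2"
    and neg: "\<And>x. Im (H (complex_of_real x)) \<le> 0"
  shows "real_distribution \<kappa>" and "\<And>z. Im z > 0 \<Longrightarrow> cauchy_transform \<kappa> z = H z"
proof -
  define p where "p = (\<lambda>x. - Im (H (complex_of_real x)) / pi)"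
  have p0: "p x \<ge> 0" for x using neg[of x] by (simp add: p_def divide_nonpos_pos)
  have \<kappa>: "\<kappa> = density lborel (\<lambda>x. ennreal (p x))" by (simp add: \<kappa>_def p_def)
  have pc: "continuous_on UNIV p"
    unfolding p_def by (intro continuous_intros continuous_on_real_line[OF H \<eta>]) auto
  have [measurable]: "p \<in> borel_measurable borel" by (rule borel_measurable_continuous_onI[OF pc])
  have pint: "integrable lborel p"
  proof (rule integrable_of_quadratic_decay[OF pc])
    fix x assume x: "\<bar>x\<bar> \<ge> R"
    have "\<bar>Im (H (complex_of_real x))\<bar> = \<bar>Im (H (complex_of_real x) - 1 / complex_of_real x)\<bar>"
      by (simp flip: of_real_divide[of 1, simplified])
    also have "\<dots> \<le> C / x\<^sup>2"
      using dec[of "complex_of_real x"] x abs_Im_le_cmod order_trans by fastforce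
    finally have "\<bar>Im (H (complex_of_real x))\<bar> / pi \<le> C / x\<^sup>2 / pi" by (intro divide_right_mono) auto
    thus "norm (p x) \<le> (C / pi) / x\<^sup>2" by (simp add: p_def abs_divide mult.commute)
  qed
  have poisson: "(LBINT x. p x * (Im z / (norm (z - complex_of_real x))\<^sup>2)) = - Im (H z)" if "Im z > 0" for z
  proof -
    have "(LBINT x. p x * (Im z / (norm (z - complex_of_real x))\<^sup>2))
      = (LBINT x. (- 1 / pi) * (Im (H (complex_of_real x)) * (Im z / (norm (z - complex_of_real x))\<^sup>2)))"
      by (simp add: p_def)
    also have "\<dots> = (- 1 / pi) * (pi * Im (H z))"
      by (subst integral_mult_right_zero)
         (rule arg_cong[OF poisson_formula_half_plane(2)[OF \<eta> H dec that]])
    finally show ?thesis by simp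
  qed
  have mass: "(LBINT x. p x) = 1"
  proof -
    \<comment> \<open>The mass is the limit of y times the Poisson integral at iy: the weight y^2 /
      (y^2 + x^2) is at most 1 and tends to 1. By the formula the same quantity is - y Im H(iy),
      which tends to 1 because H(w) is close to 1/w.\<close>
    have "((\<lambda>y. LBINT x. y * (p x * (y / (norm (\<i> * complex_of_real y - complex_of_real x))\<^sup>2))) \<longlongrightarrow> (LBINT x. p x)) at_top"
    proof (rule integral_dominated_convergence_at_top[OF _ _ pint])
      have k: "y * (p x * (y / (norm (\<i> * complex_of_real y - complex_of_real x))\<^sup>2)) = p x * (y\<^sup>2 / (y\<^sup>2 + x\<^sup>2))" for x y
      proof -
        have n: "(norm (\<i> * complex_of_real y - complex_of_real x))\<^sup>2 = y\<^sup>2 + x\<^sup>2"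
          by (simp add: cmod_power2)
        show ?thesis unfolding n by (simp add: power2_eq_square)
      qed
      show "AE x in lborel. ((\<lambda>y. y * (p x * (y / (norm (\<i> * complex_of_real y - complex_of_real x))\<^sup>2))) \<longlongrightarrow> p x) at_top"
      proof (rule AE_I2)
        fix x :: real
        have "((\<lambda>y. y\<^sup>2 / (y\<^sup>2 + x\<^sup>2)) \<longlongrightarrow> 1) at_top" by real_asymp
        from tendsto_mult[OF tendsto_const[of "p x"] this]
        show "((\<lambda>y. y * (p x * (y / (norm (\<i> * complex_of_real y - complex_of_real x))\<^sup>2))) \<longlongrightarrow> p x) at_top"
          unfolding k by simp
      qed
      show "\<forall>\<^sub>F y in at_top. AE x in lborel. norm (y * (p x * (y / (norm (\<i> * complex_of_real y - complex_of_real x))\<^sup>2))) \<le> p x"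
        unfolding k
      proof (intro always_eventually allI AE_I2)
        fix y x :: real
        have "y\<^sup>2 / (y\<^sup>2 + x\<^sup>2) \<le> 1"
          by (rule divide_le_eq_1[THEN iffD2]) (use zero_le_power2[of x] zero_le_power2[of y] in linarith)
        moreover have "y\<^sup>2 / (y\<^sup>2 + x\<^sup>2) \<ge> 0" by simp
        ultimately have "\<bar>p x\<bar> * \<bar>y\<^sup>2 / (y\<^sup>2 + x\<^sup>2)\<bar> \<le> \<bar>p x\<bar>" by (intro mult_left_le) auto
        thus "norm (p x * (y\<^sup>2 / (y\<^sup>2 + x\<^sup>2))) \<le> p x"
          using p0[of x] by (simp only: real_norm_def abs_mult abs_of_nonneg[OF p0])
      qed
    qed auto
    moreover have "((\<lambda>y. LBINT x. y * (p x * (y / (norm (\<i> * complex_of_real y - complex_of_real x))\<^sup>2))) \<longlongrightarrow> 1) at_top"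
    proof (rule LIM_zero_cancel, rule Lim_null_comparison)
      show "\<forall>\<^sub>F y in at_top. norm ((LBINT x. y * (p x * (y / (norm (\<i> * complex_of_real y - complex_of_real x))\<^sup>2))) - 1) \<le> C / y"
        using eventually_gt_at_top[of "\<bar>R\<bar>"]
      proof eventually_elim
        case (elim y)
        let ?z = "\<i> * complex_of_real y"
        have y: "y > 0" "y \<ge> R" using elim by auto
        have "(LBINT x. y * (p x * (y / (norm (?z - complex_of_real x))\<^sup>2))) = y * (- Im (H ?z))"
          using poisson[of ?z] y by (simp del: times_divide_eq_right)
        also have "\<dots> - 1 = Re (?z * (H ?z - 1 / ?z))" using y by (simp add: algebra_simps)
        finally have "norm ((LBINT x. y * (p x * (y / (norm (?z - complex_of_real x))\<^sup>2))) - 1) \<le> norm (?z * (H ?z - 1 / ?z))"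
          using abs_Re_le_cmod by (simp only: real_norm_def)
        also have "\<dots> \<le> y * (C / y\<^sup>2)"
          using dec[of ?z] y unfolding norm_mult by (intro mult_mono) (auto simp: norm_mult)
        finally show ?case using y by (simp add: power2_eq_square)
      qed
      show "((\<lambda>y. C / y) \<longlongrightarrow> 0) at_top"
        unfolding divide_inverse by (intro tendsto_mult_right_zero tendsto_inverse_0_at_top filterlim_ident)
    qed
    ultimately show ?thesis using tendsto_unique trivial_limit_at_top_linorder by blast
  qed
  have "emeasure \<kappa> UNIV = (\<integral>\<^sup>+x. ennreal (p x) \<partial>lborel)"
    unfolding \<kappa> by (subst emeasure_density) (auto simp: space_borel)
  also have "\<dots> = 1" using nn_integral_eq_integral[OF pint] p0 mass by simp
  finally have "prob_space \<kappa>" by (intro prob_spaceI) (simp add: \<kappa>)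
  then show rd: "real_distribution \<kappa>" unfolding real_distribution_def real_distribution_axioms_def by (simp add: \<kappa>)
  interpret \<kappa>: real_distribution \<kappa> by (rule rd)
  have Im: "Im (cauchy_transform \<kappa> z) = Im (H z)" if z: "Im z > 0" for z
  proof -
    have "Im (cauchy_transform \<kappa> z) = - (LINT x|\<kappa>. Im z / (norm (z - complex_of_real x))\<^sup>2)"
      by (rule \<kappa>.Im_cauchy_transform(1)[OF z])
    also have "(LINT x|\<kappa>. Im z / (norm (z - complex_of_real x))\<^sup>2) = (LBINT x. p x *\<^sub>R (Im z / (norm (z - complex_of_real x))\<^sup>2))"
      unfolding \<kappa> by (rule integral_density) (use p0 in auto)
    finally show ?thesis using poisson[OF z] by simp
  qed
  define D where "D = (\<lambda>z. cauchy_transform \<kappa> z - H z)"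
  obtain c where c: "\<And>z. z \<in> {z. Im z > 0} \<Longrightarrow> D z = c"
  proof (rule holomorphic_Im_0_constant[of D])
    show "D holomorphic_on {z. Im z > 0}" unfolding D_def
      by (intro holomorphic_intros \<kappa>.cauchy_transform_holomorphic holomorphic_on_subset[OF H]) (use \<eta> in auto)
  qed (use Im in \<open>auto simp: D_def open_halfspace_Im_gt convex_halfspace_Im_gt intro!: convex_connected\<close>)
  have "((\<lambda>y. D (\<i> * complex_of_real y)) \<longlongrightarrow> 0) at_top"
  proof (rule Lim_null_comparison)
    show "\<forall>\<^sub>F y in at_top. norm (D (\<i> * complex_of_real y)) \<le> 1 / y + (1 / y + C / y\<^sup>2)"
      using eventually_gt_at_top[of "\<bar>R\<bar>"]
    proof eventually_elim
      case (elim y)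
      let ?z = "\<i> * complex_of_real y"
      have y: "y > 0" "y \<ge> R" using elim by auto
      have "norm (H ?z) \<le> norm (1 / ?z) + norm (H ?z - 1 / ?z)" by (metis norm_triangle_sub)
      also have "\<dots> \<le> 1 / y + C / y\<^sup>2" using dec[of ?z] y by (intro add_mono) (auto simp: norm_divide norm_mult)
      finally have "norm (H ?z) \<le> 1 / y + C / y\<^sup>2" .
      moreover have "norm (cauchy_transform \<kappa> ?z) \<le> 1 / y" using \<kappa>.norm_cauchy_transform_le[of ?z] y by simp
      ultimately show ?case unfolding D_def by (rule order_trans[OF norm_triangle_ineq4 add_mono, rotated])
    qed
    show "((\<lambda>y. 1 / y + (1 / y + C / y\<^sup>2)) \<longlongrightarrow> 0) at_top" by real_asymp
  qed
  moreover have "((\<lambda>y. D (\<i> * complex_of_real y)) \<longlongrightarrow> c) at_top"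
    by (rule tendsto_eventually, rule eventually_mono[OF eventually_gt_at_top[of 0]]) (use c in auto)
  ultimately have "c = 0" using tendsto_unique trivial_limit_at_top_linorder by blast
  then show "cauchy_transform \<kappa> z = H z" if "Im z > 0" for z
    using c[of z] that by (simp add: D_def)
qed

subsection \<open>Centered distributions of finite variance\<close>

lemma (in real_distribution) integrable_times_bounded_complex:
  fixes f :: "real \<Rightarrow> real" and k :: "real \<Rightarrow> complex"
  assumes "integrable M f" and [measurable]: "k \<in> borel_measurable borel" and k: "\<And>x. norm (k x) \<le> B"
  shows "integrable M (\<lambda>x. complex_of_real (f x) * k x)"
proof (rule Bochner_Integration.integrable_bound)
  show "integrable M (\<lambda>x. f x * B)" using assms(1) by simp
  have [measurable]: "f \<in> borel_measurable M" using assms(1) by auto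
  show "(\<lambda>x. complex_of_real (f x) * k x) \<in> borel_measurable M" by measurable
  show "AE x in M. norm (complex_of_real (f x) * k x) \<le> norm (f x * B)"
  proof (rule AE_I2)
    fix x
    have "norm (k x) \<le> \<bar>B\<bar>" using k[of x] by linarith
    thus "norm (complex_of_real (f x) * k x) \<le> norm (f x * B)"
      by (simp add: norm_mult abs_mult mult_left_mono)
  qed
qed

text \<open>The shape of |K - b|^2 when |K|^2 is itself a multiple of - Im K, as for the Cauchy
  kernel.\<close>

lemma (in real_distribution) integral_real_linear:
  fixes K :: "real \<Rightarrow> complex"
  assumes K: "integrable M K"
  shows "(LINT x|M. a * (- Im (K x)) - 2 * Re (K x * b) + c)
    = a * (- Im (LINT x|M. K x)) - 2 * Re ((LINT x|M. K x) * b) + c"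
proof -
  have "(LINT x|M. a * (- Im (K x)) - 2 * Re (K x * b) + c)
      = (LINT x|M. (2 * Im b - a) * Im (K x) - 2 * Re b * Re (K x) + c)"
    by (simp add: algebra_simps)
  also have "\<dots> = (2 * Im b - a) * Im (LINT x|M. K x) - 2 * Re b * Re (LINT x|M. K x) + c"
    using K prob_space by simp
  finally show ?thesis by (simp add: algebra_simps)
qed

locale centered_finite_variance = real_distribution M for M +
  assumes square_integrable: "integrable M (\<lambda>x. x\<^sup>2)"
    and mean_0: "(LINT x|M. x) = 0"
begin

definition var :: real where "var = (LINT x|M. x\<^sup>2)"

text \<open>Nevanlinna theory represents this function as the Cauchy transform of a measure of mass
  \<open>var\<close>. Its two consequences, the bound var / Im w and the asymptotics var / w, are
  obtained directly below.\<close>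

definition defect :: "complex \<Rightarrow> complex" where
  "defect w = w - 1 / cauchy_transform M w"

lemma var_nonneg: "var \<ge> 0"
  by (simp add: var_def)

lemma integrable_id: "integrable M (\<lambda>x. x)"
  by (rule square_integrable_imp_integrable[OF _ square_integrable]) simp

lemma defect_holomorphic: "defect holomorphic_on {w. Im w > 0}"
  unfolding defect_def
  by (intro holomorphic_intros cauchy_transform_holomorphic) (auto simp: cauchy_transform_nonzero)

lemma cauchy_transform_first_order:
  assumes w: "Im w > 0"
  shows "w * cauchy_transform M w - 1 = (LINT x|M. complex_of_real x * (1 / (w - complex_of_real x)))"
    and "integrable M (\<lambda>x. complex_of_real x * (1 / (w - complex_of_real x)))"
proof -
  note i = integrable_cauchy_kernel[OF w]
  show ix: "integrable M (\<lambda>x. complex_of_real x * (1 / (w - complex_of_real x)))"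
    by (rule integrable_times_bounded_complex[OF integrable_id _ norm_inverse_diff_of_real_le[OF w]]) measurable
  have "(LINT x|M. complex_of_real x * (1 / (w - complex_of_real x)))
      = (LINT x|M. w * (1 / (w - complex_of_real x)) - 1)"
    by (rule Bochner_Integration.integral_cong)
       (use diff_of_real_nonzero[OF w] in \<open>auto simp: field_simps\<close>)
  also have "\<dots> = w * cauchy_transform M w - 1"
    unfolding cauchy_transform_def using i prob_space
    by (subst Bochner_Integration.integral_diff) (auto simp del: times_divide_eq_right)
  finally show "w * cauchy_transform M w - 1 = (LINT x|M. complex_of_real x * (1 / (w - complex_of_real x)))" ..
qed

text \<open>
  With \<open>u = w - 1 / G(w)\<close> one has \<open>u G = \<integral> x (1/(w - x) - G) d\<mu>\<close>, and
  \<open>\<integral> |1/(w - x) - G|\<^sup>2 d\<mu> = - |G|\<^sup>2 Im u / Im w\<close>; weighted AM-GM then gives a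
  self-improving inequality for \<open>|u|\<close>.
\<close>

lemma norm_defect_le:
  assumes w: "Im w > 0"
  shows "norm (defect w) \<le> var / Im w"
proof -
  define G where "G = cauchy_transform M w"
  define y where "y = Im w"
  define u where "u = defect w"
  define k where "k = (\<lambda>x. 1 / (w - complex_of_real x) - G)"
  have y: "y > 0" using w by (simp add: y_def)
  have G0: "G \<noteq> 0" using cauchy_transform_nonzero[OF w] by (simp add: G_def)
  have uG: "u * G = w * G - 1" using G0 by (simp add: u_def defect_def G_def[symmetric] left_diff_distrib)
  note i = integrable_cauchy_kernel[OF w]
  have kb: "norm (k x) \<le> 1 / y + norm G" for x
    unfolding k_def using norm_inverse_diff_of_real_le[OF w, of x]
    by (intro order_trans[OF norm_triangle_ineq4]) (simp add: y_def)
  have km: "k \<in> borel_measurable borel" unfolding k_def by measurable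
  have ixk: "integrable M (\<lambda>x. complex_of_real x * k x)"
    by (rule integrable_times_bounded_complex[OF integrable_id km kb])
  have xk: "(LINT x|M. complex_of_real x * k x) = u * G"
  proof -
    have "(LINT x|M. complex_of_real x * k x)
        = (LINT x|M. complex_of_real x * (1 / (w - complex_of_real x)) - G * complex_of_real x)"
      by (rule Bochner_Integration.integral_cong) (auto simp: k_def algebra_simps)
    also have "\<dots> = (w * G - 1) - G * complex_of_real (LINT x|M. x)"
      unfolding G_def cauchy_transform_first_order(1)[OF w] integral_complex_of_real[symmetric]
        integral_mult_right_zero[symmetric]
      by (rule Bochner_Integration.integral_diff)
         (use cauchy_transform_first_order(2)[OF w] integrable_id in auto)
    finally show ?thesis using mean_0 uG by simp
  qed
  have ik2: "integrable M (\<lambda>x. (norm (k x))\<^sup>2)"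
    by (rule integrable_const_bound[where B="(1 / y + norm G)\<^sup>2"])
       (use kb km in \<open>auto intro!: power_mono\<close>)
  have Ik: "(LINT x|M. (norm (k x))\<^sup>2) = - Im G / y - (norm G)\<^sup>2"
  proof -
    have e: "(norm (k x))\<^sup>2 = (1 / y) * (- Im (1 / (w - complex_of_real x)))
        - 2 * Re (1 / (w - complex_of_real x) * cnj G) + (norm G)\<^sup>2" for x
    proof -
      have n1: "(norm (1 / (w - complex_of_real x)))\<^sup>2 = (1 / y) * (- Im (1 / (w - complex_of_real x)))"
        using y unfolding Im_cauchy_kernel by (simp add: norm_divide power_divide y_def)
      have n2: "(norm (a - b))\<^sup>2 = (norm a)\<^sup>2 - 2 * Re (a * cnj b) + (norm b)\<^sup>2" for a b :: complex
        unfolding cmod_power2 by (simp add: power2_eq_square algebra_simps)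
      show ?thesis by (simp only: k_def n2 n1)
    qed
    have "(LINT x|M. (norm (k x))\<^sup>2) = (1 / y) * (- Im G) - 2 * Re (G * cnj G) + (norm G)\<^sup>2"
      unfolding e G_def cauchy_transform_def by (rule integral_real_linear[OF i])
    moreover have "Re (G * cnj G) = (norm G)\<^sup>2" unfolding cmod_power2 by (simp add: power2_eq_square)
    ultimately show ?thesis by simp
  qed
  have B: "(LINT x|M. (norm (k x))\<^sup>2) \<le> (norm G)\<^sup>2 * norm u / y"
  proof -
    have "1 / G = w - u" by (simp add: u_def defect_def G_def)
    hence "- Im G / (norm G)\<^sup>2 = y - Im u"
      by (metis Im_complex_div_eq_0 Im_divide cmod_power2 minus_complex.sel(2) mult_1 mult_zero_left one_complex.sel diff_0 y_def)
    hence "- Im G = (y - Im u) * (norm G)\<^sup>2" using G0 by (simp add: field_simps)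
    hence "- Im G / y - (norm G)\<^sup>2 = (norm G)\<^sup>2 * (- Im u) / y" using y by (simp add: field_simps)
    also have "\<dots> \<le> (norm G)\<^sup>2 * norm u / y"
      using y abs_Im_le_cmod[of u] by (intro divide_right_mono mult_left_mono) auto
    finally show ?thesis using Ik by simp
  qed
  \<comment> \<open>This weight turns the two halves of AM-GM into |G| var / y and |G| |u|; exactly
    half of the left-hand side is then absorbed.\<close>
  define t where "t = norm G / y"
  have t: "t > 0" using y G0 by (simp add: t_def)
  have "norm (u * G) \<le> (LINT x|M. (t * x\<^sup>2 + (norm (k x))\<^sup>2 / t) / 2)"
    unfolding xk[symmetric]
  proof (rule Bochner_Integration.integral_norm_bound_integral[OF ixk])
    show "integrable M (\<lambda>x. (t * x\<^sup>2 + (norm (k x))\<^sup>2 / t) / 2)"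
      using square_integrable ik2 by simp
    fix x
    have "0 \<le> (t * \<bar>x\<bar> - norm (k x))\<^sup>2 / t" using t by simp
    also have "\<dots> = t * x\<^sup>2 + (norm (k x))\<^sup>2 / t - 2 * (\<bar>x\<bar> * norm (k x))"
      using t by (simp add: power2_eq_square field_simps)
    finally show "norm (complex_of_real x * k x) \<le> (t * x\<^sup>2 + (norm (k x))\<^sup>2 / t) / 2"
      by (simp add: norm_mult)
  qed
  also have "\<dots> = (t * var + (LINT x|M. (norm (k x))\<^sup>2) / t) / 2"
    using square_integrable ik2 by (simp add: var_def)
  also have "\<dots> \<le> (t * var + ((norm G)\<^sup>2 * norm u / y) / t) / 2"
    using B t by (intro divide_right_mono add_left_mono) auto
  also have "((norm G)\<^sup>2 * norm u / y) / t = norm G * norm u"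
    using y G0 by (simp add: t_def power2_eq_square)
  finally have "norm u * norm G \<le> (norm G * (var / y) + norm G * norm u) / 2"
    by (simp add: norm_mult t_def)
  hence "norm G * norm u \<le> norm G * (var / y)" by (simp add: mult.commute)
  hence "norm u \<le> var / y" by (rule mult_left_le_imp_le) (use G0 in simp)
  thus ?thesis by (simp add: u_def y_def)
qed

text \<open>Under the integral, w^2 x / (w - x) = w x + x^2 + x^2 (x / (w - x)): the mean removes
  the first term, the second gives \<open>var\<close>, the third is dominated by a multiple of x^2.
  Dividing w^2 (w G - 1) by w G, which tends to 1, gives w \<open>defect\<close> w. The filter is
  arbitrary so that \<omega> may depend on n and \<zeta> jointly.\<close>

lemma tendsto_times_defect:
  assumes lim: "filterlim (\<lambda>p. Im (\<omega> p)) at_top F" and cone: "\<forall>\<^sub>F p in F. \<bar>Re (\<omega> p)\<bar> \<le> k * Im (\<omega> p)"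
  shows "((\<lambda>p. \<omega> p * defect (\<omega> p)) \<longlongrightarrow> complex_of_real var) F"
proof -
  obtain e1 where e1: "(e1 \<longlongrightarrow> 0) at_top" and
    e1': "\<And>w. Im w > 0 \<Longrightarrow> \<bar>Re w\<bar> \<le> k * Im w \<Longrightarrow> norm (w * cauchy_transform M w - 1) \<le> e1 (Im w)"
    using cauchy_transform_cone_bound by blast
  define e2 where "e2 = (\<lambda>y. LINT x|M. x\<^sup>2 * min (\<bar>k\<bar> + 2) (\<bar>x\<bar> / y))"
  have e2: "(e2 \<longlongrightarrow> 0) at_top"
    unfolding e2_def by (rule integral_min_tendsto_0[OF square_integrable]) auto
  have e2': "norm (w * (w * (w * cauchy_transform M w - 1)) - complex_of_real var) \<le> e2 (Im w)"
    if w: "Im w > 0" "\<bar>Re w\<bar> \<le> k * Im w" for w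
  proof -
    have w': "\<bar>Re w\<bar> \<le> \<bar>k\<bar> * Im w" using w by (smt (verit) mult_right_mono)
    note nz = diff_of_real_nonzero[OF w(1)]
    have nb: "norm (complex_of_real x / (w - complex_of_real x)) \<le> \<bar>k\<bar> + 2" for x
      using norm_ratio_cone_le[OF w(1) w', of x] by simp
    have i3: "integrable M (\<lambda>x. complex_of_real (x\<^sup>2) * (complex_of_real x / (w - complex_of_real x)))"
      by (rule integrable_times_bounded_complex[OF square_integrable _ nb]) measurable
    have i2: "integrable M (\<lambda>x. complex_of_real (x\<^sup>2))"
      by (rule integrable_of_real[OF square_integrable])
    have "w * (w * (w * cauchy_transform M w - 1))
        = (LINT x|M. w * (w * (complex_of_real x * (1 / (w - complex_of_real x)))))"
      unfolding cauchy_transform_first_order(1)[OF w(1)] by (simp only: integral_mult_right_zero)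
    also have "\<dots> = (LINT x|M. w * complex_of_real x + complex_of_real (x\<^sup>2)
          + complex_of_real (x\<^sup>2) * (complex_of_real x / (w - complex_of_real x)))"
      by (rule Bochner_Integration.integral_cong)
         (use nz in \<open>auto simp: divide_simps, auto simp: algebra_simps power2_eq_square\<close>)
    also have "\<dots> = w * complex_of_real (LINT x|M. x) + complex_of_real var
          + (LINT x|M. complex_of_real (x\<^sup>2) * (complex_of_real x / (w - complex_of_real x)))"
      using i2 i3 integrable_id unfolding var_def integral_complex_of_real[symmetric] integral_mult_right_zero[symmetric]
      by (subst Bochner_Integration.integral_add, simp, simp)+ simp
    finally have "w * (w * (w * cauchy_transform M w - 1)) - complex_of_real var
       = (LINT x|M. complex_of_real (x\<^sup>2) * (complex_of_real x / (w - complex_of_real x)))"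
      using mean_0 by simp
    also have "norm \<dots> \<le> e2 (Im w)" unfolding e2_def
    proof (rule Bochner_Integration.integral_norm_bound_integral[OF i3])
      show "integrable M (\<lambda>x. x\<^sup>2 * min (\<bar>k\<bar> + 2) (\<bar>x\<bar> / Im w))"
      proof (rule Bochner_Integration.integrable_bound)
        show "integrable M (\<lambda>x. x\<^sup>2 * (\<bar>k\<bar> + 2))" using square_integrable by simp
        show "AE x in M. norm (x\<^sup>2 * min (\<bar>k\<bar> + 2) (\<bar>x\<bar> / Im w)) \<le> norm (x\<^sup>2 * (\<bar>k\<bar> + 2))"
          using w by (intro AE_I2) (simp add: abs_mult mult_left_mono)
      qed auto
      show "norm (complex_of_real (x\<^sup>2) * (complex_of_real x / (w - complex_of_real x))) \<le> x\<^sup>2 * min (\<bar>k\<bar> + 2) (\<bar>x\<bar> / Im w)" for x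
        unfolding norm_mult norm_of_real using norm_ratio_cone_le[OF w(1) w', of x]
        by (intro mult_mono) auto
    qed
    finally show ?thesis .
  qed
  have pos: "\<forall>\<^sub>F p in F. Im (\<omega> p) > 0" using lim by (rule filterlim_at_top_dense[THEN iffD1, rule_format])
  have "((\<lambda>p. \<omega> p * cauchy_transform M (\<omega> p) - 1) \<longlongrightarrow> 0) F"
  proof (rule Lim_null_comparison)
    show "\<forall>\<^sub>F p in F. norm (\<omega> p * cauchy_transform M (\<omega> p) - 1) \<le> e1 (Im (\<omega> p))"
      using pos cone by eventually_elim (rule e1')
    show "((\<lambda>p. e1 (Im (\<omega> p))) \<longlongrightarrow> 0) F" by (rule filterlim_compose[OF e1 lim])
  qed
  hence l1: "((\<lambda>p. \<omega> p * cauchy_transform M (\<omega> p)) \<longlongrightarrow> 1) F" by (rule LIM_zero_cancel)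
  have "((\<lambda>p. \<omega> p * (\<omega> p * (\<omega> p * cauchy_transform M (\<omega> p) - 1)) - complex_of_real var) \<longlongrightarrow> 0) F"
  proof (rule Lim_null_comparison)
    show "\<forall>\<^sub>F p in F. norm (\<omega> p * (\<omega> p * (\<omega> p * cauchy_transform M (\<omega> p) - 1)) - complex_of_real var) \<le> e2 (Im (\<omega> p))"
      using pos cone by eventually_elim (rule e2')
    show "((\<lambda>p. e2 (Im (\<omega> p))) \<longlongrightarrow> 0) F" by (rule filterlim_compose[OF e2 lim])
  qed
  hence l2: "((\<lambda>p. \<omega> p * (\<omega> p * (\<omega> p * cauchy_transform M (\<omega> p) - 1))) \<longlongrightarrow> complex_of_real var) F"
    by (rule LIM_zero_cancel)
  have "((\<lambda>p. \<omega> p * (\<omega> p * (\<omega> p * cauchy_transform M (\<omega> p) - 1)) / (\<omega> p * cauchy_transform M (\<omega> p)))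
      \<longlongrightarrow> complex_of_real var / 1) F"
    by (rule tendsto_divide[OF l2 l1]) simp
  moreover have "\<forall>\<^sub>F p in F. \<omega> p * (\<omega> p * (\<omega> p * cauchy_transform M (\<omega> p) - 1)) / (\<omega> p * cauchy_transform M (\<omega> p))
      = \<omega> p * defect (\<omega> p)"
    using pos
  proof eventually_elim
    case (elim p)
    have "cauchy_transform M (\<omega> p) \<noteq> 0" "\<omega> p \<noteq> 0" using cauchy_transform_nonzero[OF elim] elim by auto
    thus ?case by (simp add: defect_def field_simps)
  qed
  ultimately show ?thesis using tendsto_cong by fastforce
qed

end

subsection \<open>A unimodal mixture of two Cauchy distributions\<close>

text \<open>
  The parameters solve \<open>f'(0) = f''(0) = 0\<close> for the mixture density \<open>f\<close>, with \<open>Im (G\<^sup>2)''(0)\<close> and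
  \<open>f'''(0)\<close> of opposite signs; they were found by a search over rational mixtures.
\<close>

definition base_G :: "complex \<Rightarrow> complex" where
  "base_G s = (121/126) / (s - Complex (-11) (-55)) + (5/126) / (s - Complex 13 (-13))"

text \<open>The reciprocal of \<open>base_G\<close> in partial fractions. If q1, q2 are the poles of
  \<open>base_G\<close> and p is its zero, the constant is p - q1 - q2 and the residue (p - q1) (p -
  q2). In this form the lower bound on Im \<open>base_F\<close> can be read off.\<close>

definition base_F :: "complex \<Rightarrow> complex" where
  "base_F s = s + Complex (211/21) (160/3) + Complex (19965/441) (-4840/63) / (s - Complex (253/21) (-44/3))"

lemma base_nonzero:
  assumes "Im s > -13"
  shows "s - Complex (-11) (-55) \<noteq> 0" "s - Complex 13 (-13) \<noteq> 0" "s - Complex (253/21) (-44/3) \<noteq> 0"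
  using assms by (auto simp: complex_eq_iff)

lemma base_G_holomorphic: "base_G holomorphic_on {s. Im s > -13}"
  unfolding base_G_def by (intro holomorphic_intros) (use base_nonzero in auto)

lemma base_F_holomorphic: "base_F holomorphic_on {s. Im s > -13}"
  unfolding base_F_def by (intro holomorphic_intros) (use base_nonzero in auto)

lemma base_G_times_base_F:
  assumes "Im s > -13"
  shows "base_G s * base_F s = 1"
proof -
  define q1 where "q1 = Complex (-11) (-55)"
  define q2 where "q2 = Complex 13 (-13)"
  define p where "p = Complex (253/21) (-44/3)"
  have nz: "s - q1 \<noteq> 0" "s - q2 \<noteq> 0" "s - p \<noteq> 0"
    using base_nonzero[OF assms] by (auto simp: q1_def q2_def p_def)
  have p: "p = (121/126) * q2 + (5/126) * q1"
    by (simp add: p_def q1_def q2_def complex_eq_iff)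
  have a: "Complex (211/21) (160/3) = p - q1 - q2"
    by (simp add: p_def q1_def q2_def complex_eq_iff)
  have c: "Complex (19965/441) (-4840/63) = (p - q1) * (p - q2)"
    by (simp add: p_def q1_def q2_def complex_eq_iff)
  have "base_G s = ((121/126) * (s - q2) + (5/126) * (s - q1)) / ((s - q1) * (s - q2))"
    unfolding base_G_def q1_def[symmetric] q2_def[symmetric] by (rule add_frac_eq[OF nz(1,2)])
  also have "(121/126) * (s - q2) + (5/126) * (s - q1) = s - p"
    unfolding p by (simp add: field_simps)
  finally have "base_G s = (s - p) / ((s - q1) * (s - q2))" .
  moreover have "base_F s = (s - q1) * (s - q2) / (s - p)"
  proof -
    have "(s + (p - q1 - q2)) * (s - p) + (p - q1) * (p - q2) = (s - q1) * (s - q2)"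
      by (simp add: algebra_simps)
    thus ?thesis unfolding base_F_def a c p_def[symmetric]
      by (subst add_divide_eq_iff[OF nz(3)]) simp
  qed
  ultimately show ?thesis using nz by simp
qed

lemma base_G_nonzero: "Im s > -13 \<Longrightarrow> base_G s \<noteq> 0"
  using base_G_times_base_F by fastforce

lemma base_F_eq: "Im s > -13 \<Longrightarrow> base_F s = 1 / base_G s"
  using base_G_times_base_F[of s] base_G_nonzero[of s] by (simp add: field_simps)

lemma base_G_eq: "Im s > -13 \<Longrightarrow> base_G s = 1 / base_F s"
  by (simp add: base_F_eq)

text \<open>The constant term raises the imaginary part by 160/3. The fraction has norm below 10, as
  its pole at height -44/3 is at least 38/3 away. The numbers 40 and 100 are rounded.\<close>

lemma
  assumes "Im s > -2"
  shows Im_base_F_ge: "Im (base_F s) \<ge> 40" and norm_base_F_minus_id_le: "norm (base_F s - s) \<le> 100"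
proof -
  define r where "r = Complex (19965/441) (-4840/63) / (s - Complex (253/21) (-44/3))"
  have "norm (Complex (19965/441) (-4840/63)) \<le> 19965/441 + 4840/63"
    using cmod_le[of "Complex (19965/441) (-4840/63)"] by simp
  moreover have "norm (s - Complex (253/21) (-44/3)) \<ge> 38/3"
    using abs_Im_le_cmod[of "s - Complex (253/21) (-44/3)"] assms by simp
  ultimately have r: "norm r \<le> (19965/441 + 4840/63) / (38/3)"
    unfolding r_def norm_divide by (intro frac_le) auto
  have F: "base_F s = s + Complex (211/21) (160/3) + r" by (simp add: base_F_def r_def)
  show "Im (base_F s) \<ge> 40" using abs_Im_le_cmod[of r] r assms by (simp add: F)
  have "norm (base_F s - s) \<le> norm (Complex (211/21) (160/3)) + norm r"
    unfolding F by (metis add.assoc add_diff_cancel_left' norm_triangle_ineq)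
  also have "norm (Complex (211/21) (160/3)) \<le> 211/21 + 160/3"
    using cmod_le[of "Complex (211/21) (160/3)"] by simp
  finally show "norm (base_F s - s) \<le> 100" using r by simp
qed

lemma Im_base_G_neg:
  assumes "Im s > -2"
  shows "Im (base_G s) < 0"
proof -
  have pos: "Im (base_F s) > 0" using Im_base_F_ge[OF assms] by simp
  have "base_G s = 1 / base_F s" using base_G_eq[of s] assms by simp
  hence "Im (base_G s) = - Im (base_F s) / ((Re (base_F s))\<^sup>2 + (Im (base_F s))\<^sup>2)"
    by (simp add: Im_divide)
  thus ?thesis using pos by (simp add: divide_neg_pos sum_power2_gt_zero_iff)
qed

lemma base_G_decay:
  assumes "Im s > -2" "norm s \<ge> 200"
  shows "norm (base_G s - 1 / s) \<le> 200 / (norm s)\<^sup>2"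
proof -
  have d: "norm (base_F s - s) \<le> 100" by (rule norm_base_F_minus_id_le[OF assms(1)])
  hence F: "norm (base_F s) \<ge> norm s / 2"
    using norm_triangle_ineq2[of s "s - base_F s"] assms by (simp add: norm_minus_commute)
  have nz: "base_F s \<noteq> 0" "s \<noteq> 0" using F assms by auto
  have "base_G s - 1 / s = (s - base_F s) / (s * base_F s)"
  proof -
    have "base_G s = 1 / base_F s" using base_G_eq[of s] assms by simp
    thus ?thesis using diff_frac_eq[OF nz, of 1 1] by (simp add: mult.commute)
  qed
  also have "norm \<dots> \<le> 100 / (norm s * (norm s / 2))"
    unfolding norm_divide norm_mult using d F assms
    by (intro frac_le mult_left_mono mult_pos_pos) (auto simp: norm_minus_commute)
  finally show ?thesis by (simp add: power2_eq_square)
qed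

lemma Im_base_G_real:
  "- Im (base_G (complex_of_real x)) = (5/126) * (1331 / ((x + 11)\<^sup>2 + 55\<^sup>2) + 13 / ((x - 13)\<^sup>2 + 13\<^sup>2))"
proof -
  have h: "(121/126 :: complex) = complex_of_real (121/126)" "(5/126 :: complex) = complex_of_real (5/126)"
    by simp_all
  define A where "A = (x + 11)\<^sup>2 + (55::real)\<^sup>2"
  define B where "B = (x - 13)\<^sup>2 + (13::real)\<^sup>2"
  have A: "(x - - 11)\<^sup>2 + (0 - - 55)\<^sup>2 = A" and B: "(x - 13)\<^sup>2 + (0 - - 13)\<^sup>2 = B"
    by (simp_all add: A_def B_def)
  show ?thesis
    unfolding base_G_def h A_def[symmetric] B_def[symmetric]
    by (simp only: Im_divide Re_complex_of_real Im_complex_of_real plus_complex.sel minus_complex.sel complex.sel A B)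
       (simp add: algebra_simps)
qed

definition base_density :: "real \<Rightarrow> real" where
  "base_density x = - Im (base_G (complex_of_real x)) / pi"

text \<open>What remains of the numerator of f' after a factor -x^2 and positive constants are taken
  out; the factor x^2 is the condition f'(0) = f''(0) = 0.\<close>

definition base_cubic :: "real \<Rightarrow> real" where
  "base_cubic x = 56 * x^3 - 2257 * x\<^sup>2 + 46618 * x - 122694"

lemma cauchy_density_derivative:
  fixes c s b x :: real
  assumes "b \<noteq> 0"
  shows "((\<lambda>x. c / ((x - s)\<^sup>2 + b\<^sup>2)) has_real_derivative
           - (c * (2 * (x - s))) / ((x - s)\<^sup>2 + b\<^sup>2)\<^sup>2) (at x)"
proof -
  have "(x - s)\<^sup>2 + b\<^sup>2 > 0" using assms by (simp add: add_nonneg_pos)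
  have "((\<lambda>x. c / ((x - s)\<^sup>2 + b\<^sup>2)) has_real_derivative
     (0 * ((x - s)\<^sup>2 + b\<^sup>2) - c * (2 * (x - s))) / (((x - s)\<^sup>2 + b\<^sup>2) * ((x - s)\<^sup>2 + b\<^sup>2))) (at x)"
    by (rule DERIV_divide) (use \<open>(x - s)\<^sup>2 + b\<^sup>2 > 0\<close> in \<open>auto intro!: derivative_eq_intros\<close>)
  thus ?thesis by (simp add: power2_eq_square[of "_ + _"])
qed

lemma base_density_derivative:
  obtains k where "k x > 0" "(base_density has_real_derivative - (k x * x\<^sup>2 * base_cubic x)) (at x)"
proof -
  define Q1 where "Q1 = (x + 11)\<^sup>2 + (55::real)\<^sup>2"
  define Q2 where "Q2 = (x - 13)\<^sup>2 + (13::real)\<^sup>2"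
  have Q: "Q1 > 0" "Q2 > 0" by (simp_all add: Q1_def Q2_def add_nonneg_pos)
  have "(base_density has_real_derivative
      (5/126) * (- (1331 * (2 * (x + 11))) / Q1\<^sup>2 + - (13 * (2 * (x - 13))) / Q2\<^sup>2) / pi) (at x)"
    using DERIV_cdivide[OF DERIV_cmult[OF DERIV_add[OF cauchy_density_derivative[of 55 1331 "-11" x]
        cauchy_density_derivative[of 13 13 13 x]]], of "5/126" pi]
    unfolding base_density_def[abs_def] Im_base_G_real Q1_def Q2_def diff_minus_eq_add by simp
  also have "(5/126) * (- (1331 * (2 * (x + 11))) / Q1\<^sup>2 + - (13 * (2 * (x - 13))) / Q2\<^sup>2) / pi
      = - (240 / (126 * pi * Q1\<^sup>2 * Q2\<^sup>2) * x\<^sup>2 * base_cubic x)"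
  proof -
    have num: "- (1331 * (2 * (x + 11))) * Q2\<^sup>2 + - (13 * (2 * (x - 13))) * Q1\<^sup>2 = - (48 * (x\<^sup>2 * base_cubic x))"
    proof -
      have Q': "Q1 = x\<^sup>2 + 22 * x + 3146" "Q2 = x\<^sup>2 - 26 * x + 338"
        by (simp_all add: Q1_def Q2_def power2_eq_square algebra_simps)
      show ?thesis
        unfolding Q' base_cubic_def by algebra
    qed
    have "- (1331 * (2 * (x + 11))) / Q1\<^sup>2 + - (13 * (2 * (x - 13))) / Q2\<^sup>2
        = (- (1331 * (2 * (x + 11))) * Q2\<^sup>2 + - (13 * (2 * (x - 13))) * Q1\<^sup>2) / (Q1\<^sup>2 * Q2\<^sup>2)"
      by (rule add_frac_eq) (use Q in auto)
    also have "\<dots> = - (48 * (x\<^sup>2 * base_cubic x)) / (Q1\<^sup>2 * Q2\<^sup>2)" unfolding num ..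
    finally have eq: "- (1331 * (2 * (x + 11))) / Q1\<^sup>2 + - (13 * (2 * (x - 13))) / Q2\<^sup>2
        = - (48 * (x\<^sup>2 * base_cubic x)) / (Q1\<^sup>2 * Q2\<^sup>2)" .
    show ?thesis unfolding eq by (simp add: mult.commute mult.left_commute)
  qed
  finally show ?thesis using Q
    by (intro that[of "\<lambda>x. 240 / (126 * pi * Q1\<^sup>2 * Q2\<^sup>2)"]) auto
qed

lemma base_cubic_strict_mono:
  assumes "x < y"
  shows "base_cubic x < base_cubic y"
proof (rule DERIV_pos_imp_increasing[OF assms])
  fix t
  have "(base_cubic has_real_derivative (168 * t\<^sup>2 - 4514 * t + 46618)) (at t)"
    unfolding base_cubic_def[abs_def] by (auto intro!: derivative_eq_intros)
  moreover have "168 * t\<^sup>2 - 4514 * t + 46618 = 168 * (t - 2257/168)\<^sup>2 + (46618 - 2257\<^sup>2/168)"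
    by (simp add: power2_eq_square algebra_simps)
  hence "168 * t\<^sup>2 - 4514 * t + 46618 > 0"
    by (simp add: add_nonneg_pos)
  ultimately show "\<exists>D. (base_cubic has_real_derivative D) (at t) \<and> 0 < D" by blast
qed

text \<open>As x^2 does not change sign, the only sign change of f' is at the root of the increasing
  cubic, which lies between 2 and 10; so f passes through its critical point 0 without losing
  monotonicity.\<close>

lemma base_density_modal:
  obtains a where "a > 2" "mono_on {..a} base_density" "antimono_on {a..} base_density"
    "base_density 1 < base_density 2"
proof -
  have "\<exists>a. 2 \<le> a \<and> a \<le> 10 \<and> base_cubic a = 0"
    by (rule IVT) (auto simp: base_cubic_def intro!: continuous_intros)
  then obtain a where a: "2 \<le> a" "base_cubic a = 0" by blast
  have a2: "a > 2" using a by (cases "a = 2") (auto simp: base_cubic_def)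
  have up: "base_density x \<le> base_density y" if "x \<le> y" "y \<le> a" for x y
  proof (rule DERIV_nonneg_imp_nondecreasing[OF that(1)])
    fix t assume t: "x \<le> t" "t \<le> y"
    obtain k where k: "k t > 0" "(base_density has_real_derivative - (k t * t\<^sup>2 * base_cubic t)) (at t)"
      by (rule base_density_derivative)
    have "base_cubic t \<le> 0" using base_cubic_strict_mono[of t a] a t that by (cases "t = a") auto
    hence "- (k t * t\<^sup>2 * base_cubic t) \<ge> 0" using k by (simp add: mult_nonneg_nonpos)
    thus "\<exists>D. (base_density has_real_derivative D) (at t) \<and> 0 \<le> D" using k by blast
  qed
  have down: "base_density y \<le> base_density x" if "x \<le> y" "a \<le> x" for x y
  proof (rule DERIV_nonpos_imp_nonincreasing[OF that(1)])
    fix t assume t: "x \<le> t" "t \<le> y"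
    obtain k where k: "k t > 0" "(base_density has_real_derivative - (k t * t\<^sup>2 * base_cubic t)) (at t)"
      by (rule base_density_derivative)
    have "base_cubic t \<ge> 0" using base_cubic_strict_mono[of a t] a t that by (cases "t = a") auto
    hence "- (k t * t\<^sup>2 * base_cubic t) \<le> 0" using k by simp
    thus "\<exists>D. (base_density has_real_derivative D) (at t) \<and> D \<le> 0" using k by blast
  qed
  have "base_density 1 < base_density 2"
    unfolding base_density_def Im_base_G_real by (intro divide_strict_right_mono) auto
  then show ?thesis
    by (intro that[OF a2]) (auto simp: monotone_on_def intro: up down)
qed

text \<open>
  Since \<open>base_K = - base_G'\<close>, the first-order effect of free Brownian motion on \<open>base_G\<close> is
  \<open>base_G * base_K\<close>.
\<close>

definition base_K :: "complex \<Rightarrow> complex" where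
  "base_K s = (121/126) / (s - Complex (-11) (-55))\<^sup>2 + (5/126) / (s - Complex 13 (-13))\<^sup>2"

lemma base_G_derivative:
  assumes "Im s > -13"
  shows "(base_G has_field_derivative - base_K s) (at s)"
proof -
  have d: "((\<lambda>s. c / (s - q)) has_field_derivative - c / (s - q)\<^sup>2) (at s)" if "s - q \<noteq> 0" for c q
    using DERIV_divide[of "\<lambda>s. c" 0 s UNIV "\<lambda>s. s - q" 1] that
    by (auto simp: power2_eq_square intro!: derivative_eq_intros)
  show ?thesis unfolding base_G_def[abs_def] base_K_def
    by (rule DERIV_cong[OF DERIV_add[OF d d]]) (use base_nonzero[OF assms] in auto)
qed

text \<open>This is f'(0) = 0 in complex form: the unperturbed term drops out of the slope of the
  perturbed density.\<close>

lemma Im_base_K_0: "Im (base_K 0) = 0"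
  by (simp add: base_K_def Im_divide power2_eq_square)

lemma inverse_square_derivative:
  fixes c q x :: complex
  assumes "x - q \<noteq> 0"
  shows "((\<lambda>s. c / (s - q)\<^sup>2) has_field_derivative - 2 * c / (x - q) ^ 3) (at x)"
proof -
  have "((\<lambda>s. c / (s - q)\<^sup>2) has_field_derivative
      (0 * (x - q)\<^sup>2 - c * (2 * (x - q))) / ((x - q)\<^sup>2 * (x - q)\<^sup>2)) (at x)"
    by (rule DERIV_divide) (use assms in \<open>auto intro!: derivative_eq_intros\<close>)
  also have "(0 * (x - q)\<^sup>2 - c * (2 * (x - q))) / ((x - q)\<^sup>2 * (x - q)\<^sup>2) = - 2 * c / (x - q) ^ 3"
    using assms by (simp add: divide_simps power2_eq_square power3_eq_cube)
  finally show ?thesis .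
qed

text \<open>The sign condition on which the example was chosen: d = -(G^2)''(0) / 2, and Im d > 0
  means that the perturbation has negative slope at 0. With a, b the negated poles, 1/a and 1/b are
  rational, so the claim is arithmetic.\<close>

lemma base_GK_derivative:
  obtains d where "((\<lambda>s. base_G s * base_K s) has_field_derivative d) (at 0)" "Im d > 0"
proof -
  define a where "a = - Complex (-11) (-55)"
  define b where "b = - Complex 13 (-13)"
  have nz: "a \<noteq> 0" "b \<noteq> 0" by (auto simp: a_def b_def complex_eq_iff)
  have K: "(base_K has_field_derivative - 2 * ((121/126) / a^3 + (5/126) / b^3)) (at 0)"
  proof -
    have a0: "0 - Complex (-11) (-55) = a" and b0: "0 - Complex 13 (-13) = b" by (simp_all add: a_def b_def)
    show ?thesis
      unfolding base_K_def[abs_def]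
      using DERIV_add[OF inverse_square_derivative[of 0 "Complex (-11) (-55)" "121/126", unfolded a0, OF nz(1)]
        inverse_square_derivative[of 0 "Complex 13 (-13)" "5/126", unfolded b0, OF nz(2)]]
      by (rule DERIV_cong) (simp add: algebra_simps)
  qed
  have inv: "1 / a = Complex (1/286) (-5/286)" "1 / b = Complex (-1/26) (-1/26)"
    by (simp_all add: a_def b_def complex_eq_iff Re_divide Im_divide)
  have G: "base_G 0 = (121/126) * (1/a) + (5/126) * (1/b)"
    by (simp add: base_G_def a_def b_def)
  have K0: "base_K 0 = (121/126) * (1/a)\<^sup>2 + (5/126) * (1/b)\<^sup>2"
    by (simp add: base_K_def a_def b_def power_divide)
  have K1: "(121/126) / a^3 + (5/126) / b^3 = (121/126) * (1/a)^3 + (5/126) * (1/b)^3"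
    by (simp add: power_divide)
  show ?thesis
  proof (rule that)
    show "((\<lambda>s. base_G s * base_K s) has_field_derivative
        - base_K 0 * base_K 0 + - 2 * ((121/126) / a^3 + (5/126) / b^3) * base_G 0) (at 0)"
      by (rule DERIV_mult[OF base_G_derivative K]) simp
    show "Im (- base_K 0 * base_K 0 + - 2 * ((121/126) / a^3 + (5/126) / b^3) * base_G 0) > 0"
      unfolding K1 G K0 inv by (simp add: power2_eq_square power3_eq_cube)
  qed
qed

subsection \<open>Subordination for a large scale\<close>

text \<open>Height pays for each step: Cauchy's estimate on discs of radius 2 r makes e a
  1/2-contraction above a + 2 r, and discs of radius r about points above a + 3 r still lie in that
  region, which yields the fixed point. Injectivity of w + e(w) makes the inverse
  holomorphic.\<close>

lemma near_identity_right_inverse: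
  assumes e: "e holomorphic_on {w. Im w > a}" and r: "r > 0"
    and small: "\<And>w. Im w > a \<Longrightarrow> norm (e w) \<le> r"
  obtains V where "V holomorphic_on {w. Im w > a + 3 * r}"
    "\<And>\<zeta>. Im \<zeta> > a + 3 * r \<Longrightarrow> Im (V \<zeta>) > a + 2 * r \<and> V \<zeta> + e (V \<zeta>) = \<zeta>"
proof -
  define S where "S = {w. Im w > a + 2 * r}"
  have S: "open S" "convex S" "S \<subseteq> {w. Im w > a}"
    using r by (auto simp: S_def open_halfspace_Im_gt convex_halfspace_Im_gt)
  have ball: "Im x \<ge> Im w - \<rho>" if "x \<in> cball w \<rho>" for x w \<rho>
    using that abs_Im_le_cmod[of "w - x"] by (simp add: dist_norm)
  have dE: "norm (deriv e w) \<le> 1/2" if w: "w \<in> S" for w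
  proof -
    have "norm (deriv e w) \<le> r / (2 * r)"
    proof (rule norm_deriv_le_on_cball[OF e open_halfspace_Im_gt])
      show "cball w (2 * r) \<subseteq> {w. Im w > a}" using ball w by (fastforce simp: S_def)
      show "norm (e x) \<le> r" if "x \<in> cball w (2 * r)" for x
        using ball[OF that] w by (intro small) (simp add: S_def)
    qed (use r in simp)
    thus ?thesis using r by simp
  qed
  have lip: "norm (e x - e y) \<le> 1/2 * norm (x - y)" if "x \<in> S" "y \<in> S" for x y
    using contraction_of_deriv_bound[OF S(2,1) holomorphic_on_subset[OF e S(3)] dE that] .
  let ?f = "\<lambda>w. w + e w"
  have inj: "inj_on ?f S" by (rule inj_on_id_plus_contraction[OF lip])
  have "?f holomorphic_on S" by (intro holomorphic_intros holomorphic_on_subset[OF e S(3)])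
  then obtain g where g: "g holomorphic_on ?f ` S" "\<And>z. z \<in> S \<Longrightarrow> g (?f z) = z"
    using holomorphic_has_inverse[OF _ S(1) inj] by metis
  have img: "\<exists>w\<in>S. ?f w = \<zeta>" if \<zeta>: "Im \<zeta> > a + 3 * r" for \<zeta>
  proof -
    have sub: "cball \<zeta> r \<subseteq> S" using ball \<zeta> by (fastforce simp: S_def)
    obtain w where "w \<in> cball \<zeta> r" "w + e w = \<zeta>"
    proof (rule id_plus_contraction_hits_center[of \<zeta> r e])
      show "norm (e x - e y) \<le> 1/2 * norm (x - y)" if "x \<in> cball \<zeta> r" "y \<in> cball \<zeta> r" for x y
        using that sub by (intro lip) auto
      show "norm (e x) \<le> r" if "x \<in> cball \<zeta> r" for x
        using that sub S by (intro small) auto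
    qed (use r in auto)
    thus ?thesis using sub by auto
  qed
  show ?thesis
  proof (rule that)
    show "g holomorphic_on {w. Im w > a + 3 * r}"
      by (rule holomorphic_on_subset[OF g(1)]) (use img in force)
    show "Im (g \<zeta>) > a + 2 * r \<and> g \<zeta> + e (g \<zeta>) = \<zeta>" if "Im \<zeta> > a + 3 * r" for \<zeta>
      using img[OF that] g(2) by (auto simp: S_def)
  qed
qed

text \<open>Uniform convergence as a single limit along a product filter, so that ordinary limit
  rules and \<open>tendsto_times_defect\<close> apply to functions of the pair (n, \<zeta>).\<close>

lemma uniform_limit_prod_filterI:
  fixes f :: "'a \<Rightarrow> 'b \<Rightarrow> 'c::real_normed_vector"
  assumes "((\<lambda>p. f (fst p) (snd p) - l (snd p)) \<longlongrightarrow> 0) (F \<times>\<^sub>F principal A)"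
  shows "uniform_limit A f l F"
  unfolding uniform_limit_iff
proof (intro allI impI)
  fix \<epsilon> :: real assume "\<epsilon> > 0"
  from tendstoD[OF assms this]
  have "\<forall>\<^sub>F p in F \<times>\<^sub>F principal A. dist (f (fst p) (snd p)) (l (snd p)) < \<epsilon>"
    by (simp add: dist_norm)
  then obtain P Q where "eventually P F" "eventually Q (principal A)"
    "\<And>x y. P x \<Longrightarrow> Q y \<Longrightarrow> dist (f x y) (l y) < \<epsilon>"
    by (auto simp: eventually_prod_filter)
  then show "\<forall>\<^sub>F n in F. \<forall>x\<in>A. dist (f n x) (l x) < \<epsilon>"
    by (auto simp: eventually_principal elim!: eventually_mono)
qed

context centered_finite_variance
begin

text \<open>L inverts 1/G = id - \<open>defect\<close>. Above height var + 1 the bound var / Im w is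
  at most 1, a perturbation of size r = 1, which costs three more units of height.\<close>

lemma reciprocal_cauchy_right_inverse:
  obtains L where "L holomorphic_on {y. Im y > var + 4}"
    "\<And>y. Im y > var + 4 \<Longrightarrow> Im (L y) > var + 3 \<and> L y - defect (L y) = y \<and> norm (L y - y) \<le> 1"
proof -
  have small: "norm (- defect w) \<le> 1" if "Im w > var + 1" for w
    using norm_defect_le[of w] that var_nonneg by (auto intro: order_trans simp: divide_le_eq)
  obtain L where L: "L holomorphic_on {w. Im w > (var + 1) + 3 * 1}"
    "\<And>\<zeta>. Im \<zeta> > (var + 1) + 3 * 1 \<Longrightarrow> Im (L \<zeta>) > (var + 1) + 2 * 1 \<and> L \<zeta> + - defect (L \<zeta>) = \<zeta>"
  proof (rule near_identity_right_inverse[of "\<lambda>w. - defect w" "var + 1" 1])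
    show "(\<lambda>w. - defect w) holomorphic_on {w. Im w > var + 1}"
      by (intro holomorphic_intros holomorphic_on_subset[OF defect_holomorphic]) (use var_nonneg in auto)
  qed (use small in auto)
  show ?thesis
  proof (rule that)
    show "L holomorphic_on {y. Im y > var + 4}" using L(1) by (simp add: add.assoc)
    fix y assume y: "Im y > var + 4"
    have 1: "Im (L y) > var + 3" "L y - defect (L y) = y" using L(2)[of y] y by auto
    have "norm (L y - y) = norm (- defect (L y))" 
    proof -
      have "L y - y = defect (L y)" using 1(2) by (simp add: algebra_simps)
      thus ?thesis by simp
    qed
    thus "Im (L y) > var + 3 \<and> L y - defect (L y) = y \<and> norm (L y - y) \<le> 1"
      using small[of "L y"] 1 by simp
  qed
qed

text \<open>Write F = 1/G. Subordination asks for \<omega>1, \<omega>2 with F_M(\<omega>1) =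
  F_\<nu>(\<omega>2) = \<omega>1 + \<omega>2 - z, where F_\<nu>(\<omega>) = n \<open>base_F\<close>
  (\<omega> / n) for the base measure dilated by n. Put \<omega>2 = n V and \<omega>1 = L(n
  \<open>base_F\<close> V). As F_M(\<omega>1) = \<omega>1 - \<open>defect\<close> \<omega>1, the
  system collapses to the one equation for V at \<zeta> = z / n. Its perturbation is at most var /
  n^2: one factor 1/n from \<open>defect\<close> at height n, one from the dilation.\<close>

lemma subordination_functions:
  obtains L V N where "\<And>y. Im y > var + 4 \<Longrightarrow> Im (L y) > var + 3 \<and> L y - defect (L y) = y \<and> norm (L y - y) \<le> 1"
    "\<And>n. n \<ge> N \<Longrightarrow> real n \<ge> 3 * var + 4"
    "\<And>n. n \<ge> N \<Longrightarrow> V n holomorphic_on {\<zeta>. Im \<zeta> > -1}"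
    "\<And>n \<zeta>. n \<ge> N \<Longrightarrow> Im \<zeta> > -1 \<Longrightarrow> Im (V n \<zeta>) > -2 \<and>
        V n \<zeta> + defect (L (of_nat n * base_F (V n \<zeta>))) / of_nat n = \<zeta> \<and>
        norm (V n \<zeta> - \<zeta>) \<le> var / (real n)\<^sup>2 \<and> norm (V n \<zeta> - \<zeta>) \<le> 1/3"
proof -
  obtain L where Lh: "L holomorphic_on {y. Im y > var + 4}"
    and L: "\<And>y. Im y > var + 4 \<Longrightarrow> Im (L y) > var + 3 \<and> L y - defect (L y) = y \<and> norm (L y - y) \<le> 1"
    by (rule reciprocal_cauchy_right_inverse) blast
  \<comment> \<open>The threshold gives var / n^2 <= 1/3, the size allowed by the passage from Im >
    -2 to Im > -1, and 40 n > var + 4, the height above which L is defined.\<close>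
  define N where "N = nat \<lceil>3 * var + 4\<rceil>"
  have N: "real n \<ge> 3 * var + 4" if "n \<ge> N" for n
    using that unfolding N_def by linarith
  have "\<exists>V. V holomorphic_on {\<zeta>. Im \<zeta> > -1} \<and> (\<forall>\<zeta>. Im \<zeta> > -1 \<longrightarrow> Im (V \<zeta>) > -2 \<and>
        V \<zeta> + defect (L (of_nat n * base_F (V \<zeta>))) / of_nat n = \<zeta> \<and>
        norm (V \<zeta> - \<zeta>) \<le> var / (real n)\<^sup>2 \<and> norm (V \<zeta> - \<zeta>) \<le> 1/3)" if "n \<ge> N" for n
  proof -
    have n: "real n \<ge> 3 * var + 4" "real n \<ge> 4" using N[OF that] var_nonneg by auto
    define e where "e = (\<lambda>s. defect (L (of_nat n * base_F s)) / of_nat n)"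
    have nF: "Im (of_nat n * base_F s) \<ge> 40 * real n" if "Im s > -2" for s
      using Im_base_F_ge[OF that] n by simp
    have nF': "Im (of_nat n * base_F s) > var + 4" if "Im s > -2" for s
      using nF[OF that] n var_nonneg by linarith
    have eb: "norm (e s) \<le> var / (real n)\<^sup>2" if "Im s > -2" for s
    proof -
      define y where "y = of_nat n * base_F s"
      have y: "Im y > var + 4" "Im y \<ge> 40 * real n" using nF nF' that by (auto simp: y_def)
      have "\<bar>Im (L y) - Im y\<bar> \<le> 1" using L[OF y(1)] abs_Im_le_cmod[of "L y - y"] by simp
      hence "Im (L y) \<ge> real n" using y n by linarith
      hence "norm (defect (L y)) \<le> var / real n"
        using norm_defect_le[of "L y"] n var_nonneg by (intro order_trans[OF norm_defect_le divide_left_mono]) auto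
      hence "norm (defect (L y)) / real n \<le> var / real n / real n" by (intro divide_right_mono) auto
      thus ?thesis by (simp add: e_def y_def norm_divide power2_eq_square)
    qed
    have vn: "var / (real n)\<^sup>2 \<le> 1/3"
    proof -
      have "3 * var \<le> real n * 1" using n by simp
      also have "\<dots> \<le> real n * real n" using n by (intro mult_left_mono) auto
      finally show ?thesis using n by (simp add: power2_eq_square field_simps)
    qed
    have eh: "e holomorphic_on {s. Im s > -2}"
    proof -
      have 1: "(\<lambda>s. of_nat n * base_F s) holomorphic_on {s. Im s > -2}"
        by (intro holomorphic_intros holomorphic_on_subset[OF base_F_holomorphic]) auto
      have "L \<circ> (\<lambda>s. of_nat n * base_F s) holomorphic_on {s. Im s > -2}"
        by (rule holomorphic_on_compose_gen[OF 1 Lh]) (use nF' in auto)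
      hence "defect \<circ> (L \<circ> (\<lambda>s. of_nat n * base_F s)) holomorphic_on {s. Im s > -2}"
        by (rule holomorphic_on_compose_gen[OF _ defect_holomorphic])
           (use L nF' var_nonneg in \<open>fastforce\<close>)
      thus ?thesis unfolding e_def o_def using n by (intro holomorphic_intros) auto
    qed
    obtain V where V: "V holomorphic_on {w. Im w > -2 + 3 * (1/3)}"
      "\<And>\<zeta>. Im \<zeta> > -2 + 3 * (1/3) \<Longrightarrow> Im (V \<zeta>) > -2 + 2 * (1/3) \<and> V \<zeta> + e (V \<zeta>) = \<zeta>"
      using near_identity_right_inverse[OF eh, of "1/3"] eb vn by (smt (verit) zero_less_divide_1_iff)
    have V': "Im (V \<zeta>) > -2" "V \<zeta> + e (V \<zeta>) = \<zeta>" if "Im \<zeta> > -1" for \<zeta>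
      using V(2)[of \<zeta>] that by auto
    have Ve: "norm (V \<zeta> - \<zeta>) = norm (e (V \<zeta>))" if "Im \<zeta> > -1" for \<zeta>
    proof -
      have "V \<zeta> - \<zeta> = - e (V \<zeta>)" using V'(2)[OF that] by (simp add: algebra_simps)
      thus ?thesis by simp
    qed
    show ?thesis
    proof (intro exI[of _ V] conjI allI impI)
      show "V holomorphic_on {\<zeta>. Im \<zeta> > -1}" using V(1) by simp
      fix \<zeta> assume \<zeta>: "Im \<zeta> > -1"
      show "Im (V \<zeta>) > -2" using V'[OF \<zeta>] by simp
      show "V \<zeta> + defect (L (of_nat n * base_F (V \<zeta>))) / of_nat n = \<zeta>"
        using V'(2)[OF \<zeta>] by (simp add: e_def)
      show "norm (V \<zeta> - \<zeta>) \<le> var / (real n)\<^sup>2" unfolding Ve[OF \<zeta>] using eb V'[OF \<zeta>] by simp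
      thus "norm (V \<zeta> - \<zeta>) \<le> 1/3" using vn by linarith
    qed
  qed
  then obtain V where V: "\<And>n. n \<ge> N \<Longrightarrow> V n holomorphic_on {\<zeta>. Im \<zeta> > -1} \<and> (\<forall>\<zeta>. Im \<zeta> > -1 \<longrightarrow> Im (V n \<zeta>) > -2 \<and>
        V n \<zeta> + defect (L (of_nat n * base_F (V n \<zeta>))) / of_nat n = \<zeta> \<and>
        norm (V n \<zeta> - \<zeta>) \<le> var / (real n)\<^sup>2 \<and> norm (V n \<zeta> - \<zeta>) \<le> 1/3)"
    by metis
  show ?thesis by (rule that[OF L N]) (use V in auto)
qed

text \<open>With \<omega> = L(n \<open>base_F\<close> V) the equation for V says \<zeta> - V =
  \<open>defect\<close> \<omega> / n. The rescaled difference is therefore the product of \<omega>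
  \<open>defect\<close> \<omega>, n / \<omega> and a difference quotient of - \<open>base_G\<close>,
  and the factors tend to var, \<open>base_G\<close> \<zeta> and \<open>base_K\<close>
  \<zeta>.\<close>

lemma uniform_limit_first_order:
  assumes L: "\<And>y. Im y > var + 4 \<Longrightarrow> Im (L y) > var + 3 \<and> L y - defect (L y) = y \<and> norm (L y - y) \<le> 1"
    and N: "\<And>n. n \<ge> N \<Longrightarrow> real n \<ge> 3 * var + 4"
    and V: "\<And>n \<zeta>. n \<ge> N \<Longrightarrow> Im \<zeta> > -1 \<Longrightarrow> Im (V n \<zeta>) > -2 \<and>
        V n \<zeta> + defect (L (of_nat n * base_F (V n \<zeta>))) / of_nat n = \<zeta> \<and>
        norm (V n \<zeta> - \<zeta>) \<le> var / (real n)\<^sup>2 \<and> norm (V n \<zeta> - \<zeta>) \<le> 1/3"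
  shows "uniform_limit (ball 0 (1/2)) (\<lambda>n \<zeta>. (of_nat n)\<^sup>2 * (base_G (V n \<zeta>) - base_G \<zeta>))
           (\<lambda>\<zeta>. complex_of_real var * (base_G \<zeta> * base_K \<zeta>)) sequentially"
proof (rule uniform_limit_prod_filterI)
  define A where "A = ball (0::complex) (1/2)"
  define P where "P = sequentially \<times>\<^sub>F principal A"
  define v where "v = (\<lambda>p. V (fst p) (snd p))"
  define y where "y = (\<lambda>p. of_nat (fst p) * base_F (v p))"
  define \<omega> where "\<omega> = (\<lambda>p. L (y p))"
  define x where "x = (\<lambda>p. of_nat (fst p) / \<omega> p)"
  define q1 where "q1 = Complex (-11) (-55)"
  define q2 where "q2 = Complex 13 (-13)"
  \<comment> \<open>The difference quotient of - \<open>base_G\<close>, equal to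
    \<open>base_K\<close> on the diagonal. Both poles are at distance at least 1 and the weights sum
    to 1, so S and \<open>base_G\<close> are bounded by 1.\<close>
  define S where "S = (\<lambda>a b. (121/126) / ((a - q1) * (b - q1)) + (5/126) / ((a - q2) * (b - q2)))"
  have q: "norm (s - q1) \<ge> 1" "norm (s - q2) \<ge> 1" "s - q1 \<noteq> 0" "s - q2 \<noteq> 0" if "Im s > -2" for s
    using abs_Im_le_cmod[of "s - q1"] abs_Im_le_cmod[of "s - q2"] that base_nonzero[of s]
    by (auto simp: q1_def q2_def)
  have frac: "norm (c / (a * b)) \<le> norm c" if "norm a \<ge> 1" "norm b \<ge> 1" for a b c :: complex
  proof -
    have "1 \<le> norm a * norm b" using mult_mono[OF that] by simp
    hence "norm c / (norm a * norm b) \<le> norm c / 1" by (intro divide_left_mono) auto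
    thus ?thesis by (simp add: norm_divide norm_mult)
  qed
  have S_bound: "norm (S a b) \<le> 1" if "Im a > -2" "Im b > -2" for a b
  proof -
    have "norm (S a b) \<le> norm (121/126 :: complex) + norm (5/126 :: complex)"
      unfolding S_def using q[OF that(1)] q[OF that(2)]
      by (intro order_trans[OF norm_triangle_ineq] add_mono frac) auto
    thus ?thesis by simp
  qed
  have diff: "base_G a - base_G b = (b - a) * S a b" if "Im a > -2" "Im b > -2" for a b
  proof -
    have "c / (a - q) - c / (b - q) = (b - a) * (c / ((a - q) * (b - q)))" if "a - q \<noteq> 0" "b - q \<noteq> 0" for c q
      using that by (simp add: diff_frac_eq algebra_simps)
    from this[of q1 "121/126"] this[of q2 "5/126"] show ?thesis
      using q[OF that(1)] q[OF that(2)]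
      by (simp add: base_G_def S_def q1_def[symmetric] q2_def[symmetric] algebra_simps)
  qed
  have SK: "norm (S a b - base_K b) \<le> norm (a - b)" if "Im a > -2" "Im b > -2" for a b
  proof -
    have e: "c / ((a - q) * (b - q)) - c / (b - q)\<^sup>2 = (b - a) * ((c / (b - q)) / ((a - q) * (b - q)))"
      if "a - q \<noteq> 0" "b - q \<noteq> 0" for c q
      using that by (simp add: divide_simps) (simp add: power2_eq_square algebra_simps)
    have d: "norm (c / (b - q)) \<le> norm c" if "norm (b - q) \<ge> 1" for c q
      using frac[of "b - q" 1 c] that by simp
    have "S a b - base_K b = (b - a) * ((121/126) / (b - q1) / ((a - q1) * (b - q1)) + (5/126) / (b - q2) / ((a - q2) * (b - q2)))"
      unfolding S_def base_K_def q1_def[symmetric] q2_def[symmetric] add_diff_add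
        e[OF q(3)[OF that(1)] q(3)[OF that(2)]] e[OF q(4)[OF that(1)] q(4)[OF that(2)]]
      by (rule distrib_left[symmetric])
    also have "norm \<dots> \<le> norm (b - a) * (norm (121/126 :: complex) + norm (5/126 :: complex))"
    proof -
      have g: "norm (c / (b - q) / ((a - q) * (b - q))) \<le> norm c" if "norm (a - q) \<ge> 1" "norm (b - q) \<ge> 1" for c q
        by (rule order_trans[OF frac[OF that] d[OF that(2)]])
      show ?thesis unfolding norm_mult[of "b - a"]
        by (intro mult_left_mono order_trans[OF norm_triangle_ineq] add_mono g q that norm_ge_zero)
    qed
    finally show ?thesis by (simp add: norm_minus_commute)
  qed
  have G_bound: "norm (base_G s) \<le> 1" if "Im s > -2" for s
  proof -
    have "norm (base_G s) \<le> norm (121/126 :: complex) + norm (5/126 :: complex)"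
      unfolding base_G_def q1_def[symmetric] q2_def[symmetric]
      using frac[of "s - q1" 1 "121/126"] frac[of "s - q2" 1 "5/126"] q[OF that]
      by (intro norm_triangle_le add_mono) auto
    thus ?thesis by simp
  qed
  have fst_lim: "filterlim (\<lambda>p. real (fst p)) at_top P"
    unfolding P_def by (rule filterlim_compose[OF filterlim_real_sequentially filterlim_fst])
  have ev: "\<forall>\<^sub>F p in P. fst p \<ge> N \<and> fst p \<ge> 1 \<and> snd p \<in> A"
  proof -
    have "\<forall>\<^sub>F p in P. fst p \<ge> N" "\<forall>\<^sub>F p in P. fst p \<ge> 1"
      using filterlim_fst eventually_ge_at_top unfolding P_def filterlim_iff by blast+
    moreover have "\<forall>\<^sub>F p in P. snd p \<in> A"
      using filterlim_snd[of "principal A" sequentially] unfolding P_def filterlim_principal .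
    ultimately show ?thesis by eventually_elim simp
  qed
  have facts: "Im (snd p) > -1" "norm (snd p) < 1/2" "Im (v p) > -2" "norm (v p - snd p) \<le> var / (real (fst p))\<^sup>2"
      "Im (\<omega> p) \<ge> real (fst p)" "\<bar>Re (\<omega> p)\<bar> \<le> 200 * Im (\<omega> p)"
      "\<omega> p - defect (\<omega> p) = y p" "norm (\<omega> p - y p) \<le> 1" "norm (base_F (v p)) \<ge> 1"
      "snd p - v p = defect (\<omega> p) / of_nat (fst p)" "real (fst p) \<ge> 1"
    if p: "fst p \<ge> N \<and> fst p \<ge> 1 \<and> snd p \<in> A" for p
  proof -
    let ?n = "real (fst p)"
    show z: "norm (snd p) < 1/2" using p by (simp add: A_def)
    show i: "Im (snd p) > -1" using z abs_Im_le_cmod[of "snd p"] by linarith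
    have Vp: "Im (v p) > -2" "v p + defect (\<omega> p) / of_nat (fst p) = snd p"
      "norm (v p - snd p) \<le> var / ?n\<^sup>2" "norm (v p - snd p) \<le> 1/3"
      using V[of "fst p" "snd p"] p i by (auto simp: v_def \<omega>_def y_def)
    show "Im (v p) > -2" "norm (v p - snd p) \<le> var / ?n\<^sup>2" by (fact Vp)+
    show "snd p - v p = defect (\<omega> p) / of_nat (fst p)" using Vp(2) by (simp add: algebra_simps)
    have n: "?n \<ge> 3 * var + 4" using N p by simp
    show "?n \<ge> 1" using p by simp
    have F: "Im (base_F (v p)) \<ge> 40" "norm (base_F (v p) - v p) \<le> 100"
      using Im_base_F_ge norm_base_F_minus_id_le Vp by auto
    show "norm (base_F (v p)) \<ge> 1" using F abs_Im_le_cmod[of "base_F (v p)"] by linarith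
    have yI: "Im (y p) \<ge> 40 * ?n" using F n var_nonneg by (simp add: y_def)
    hence "Im (y p) > var + 4" using n var_nonneg by linarith
    from L[OF this] show L1: "\<omega> p - defect (\<omega> p) = y p" "norm (\<omega> p - y p) \<le> 1"
      by (auto simp: \<omega>_def)
    have "\<bar>Im (\<omega> p) - Im (y p)\<bar> \<le> 1" "\<bar>Re (\<omega> p) - Re (y p)\<bar> \<le> 1"
      using abs_Im_le_cmod[of "\<omega> p - y p"] abs_Re_le_cmod[of "\<omega> p - y p"] L1 by auto
    thus I: "Im (\<omega> p) \<ge> ?n" using yI n var_nonneg by linarith
    \<comment> \<open>From 100 + 1/3 + 1/2, rounded up. So |y| <= 102 n, while Im \<omega> >= n,
      which puts \<omega> into a fixed cone.\<close>
    have "norm (base_F (v p)) \<le> 102"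
      using F(2) Vp(4) z norm_triangle_ineq2[of "base_F (v p)" "v p"] norm_triangle_ineq2[of "v p" "snd p"] by linarith
    hence "norm (y p) \<le> ?n * 102" unfolding y_def norm_mult by (simp add: mult_left_mono)
    thus "\<bar>Re (\<omega> p)\<bar> \<le> 200 * Im (\<omega> p)"
      using \<open>\<bar>Re (\<omega> p) - Re (y p)\<bar> \<le> 1\<close> abs_Re_le_cmod[of "y p"] I n var_nonneg by linarith
  qed
  have \<omega>_lim: "filterlim (\<lambda>p. Im (\<omega> p)) at_top P"
    by (rule filterlim_at_top_mono[OF fst_lim]) (use ev facts(5) in \<open>auto elim: eventually_mono\<close>)
  have \<omega>_def_lim: "((\<lambda>p. \<omega> p * defect (\<omega> p)) \<longlongrightarrow> complex_of_real var) P"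
    by (rule tendsto_times_defect[OF \<omega>_lim, of 200]) (use ev facts(6) in \<open>auto elim: eventually_mono\<close>)
  have inv_lim: "((\<lambda>p. 1 / real (fst p)) \<longlongrightarrow> 0) P"
    using tendsto_inverse_0_at_top[OF fst_lim] by (simp add: inverse_eq_divide)
  have v_lim: "((\<lambda>p. norm (v p - snd p)) \<longlongrightarrow> 0) P"
  proof (rule Lim_null_comparison)
    show "\<forall>\<^sub>F p in P. norm (norm (v p - snd p)) \<le> var * (1 / real (fst p) * (1 / real (fst p)))"
      using ev by (rule eventually_mono) (use facts(4) in \<open>auto simp: power2_eq_square\<close>)
    show "((\<lambda>p. var * (1 / real (fst p) * (1 / real (fst p)))) \<longlongrightarrow> 0) P"
      using inv_lim by (intro tendsto_mult_right_zero tendsto_mult_zero)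
  qed
  have x_bound: "norm (x p) \<le> 1" if p: "fst p \<ge> N \<and> fst p \<ge> 1 \<and> snd p \<in> A" for p
  proof -
    have "norm (\<omega> p) \<ge> real (fst p)" using facts(5)[OF p] abs_Im_le_cmod[of "\<omega> p"] by linarith
    thus ?thesis using facts(11)[OF p] by (simp add: x_def norm_divide divide_le_eq)
  qed
  have x_lim: "((\<lambda>p. x p - base_G (snd p)) \<longlongrightarrow> 0) P"
  proof (rule Lim_null_comparison)
    show "((\<lambda>p. 1 / real (fst p) + norm (v p - snd p)) \<longlongrightarrow> 0) P"
      using tendsto_add[OF inv_lim v_lim] by simp
    show "\<forall>\<^sub>F p in P. norm (x p - base_G (snd p)) \<le> 1 / real (fst p) + norm (v p - snd p)"
      using ev
    proof (rule eventually_mono)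
      fix p assume p: "fst p \<ge> N \<and> fst p \<ge> 1 \<and> snd p \<in> A"
      note f = facts[OF p]
      have n: "real (fst p) > 0" using f by linarith
      have om: "norm (\<omega> p) \<ge> real (fst p)" using f(5) abs_Im_le_cmod[of "\<omega> p"] by linarith
      have nz: "\<omega> p \<noteq> 0" "base_F (v p) \<noteq> 0" "of_nat (fst p) \<noteq> (0::complex)" using om n f(9) by auto
      have "base_G (v p) = 1 / base_F (v p)" using base_G_eq f(3) by simp
      hence "x p - base_G (v p) = (y p - \<omega> p) / (\<omega> p * base_F (v p))"
        unfolding x_def y_def using nz by (simp add: diff_frac_eq mult.commute)
      hence "norm (x p - base_G (v p)) = norm (\<omega> p - y p) / (norm (\<omega> p) * norm (base_F (v p)))"
        by (simp add: norm_divide norm_mult norm_minus_commute)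
      also have "\<dots> \<le> 1 / (real (fst p) * 1)"
        by (rule frac_le[OF _ f(8) _ mult_mono[OF om f(9)]]) (use n in auto)
      finally have "norm (x p - base_G (v p)) \<le> 1 / real (fst p)" by simp
      moreover have "norm (base_G (v p) - base_G (snd p)) \<le> norm (v p - snd p)"
        using diff[of "v p" "snd p"] S_bound[of "v p" "snd p"] f(1,3)
        by (simp add: norm_mult norm_minus_commute mult_left_le)
      ultimately show "norm (x p - base_G (snd p)) \<le> 1 / real (fst p) + norm (v p - snd p)"
        using norm_triangle_ineq[of "x p - base_G (v p)" "base_G (v p) - base_G (snd p)"] by simp
    qed
  qed
  have "((\<lambda>p. norm (\<omega> p * defect (\<omega> p) - complex_of_real var) + var * norm (x p - base_G (snd p))
            + var * norm (v p - snd p)) \<longlongrightarrow> 0 + var * 0 + var * 0) P"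
    by (intro tendsto_add tendsto_mult tendsto_const v_lim tendsto_norm_zero x_lim LIM_zero \<omega>_def_lim)
  hence lim: "((\<lambda>p. norm (\<omega> p * defect (\<omega> p) - complex_of_real var) + var * norm (x p - base_G (snd p))
            + var * norm (v p - snd p)) \<longlongrightarrow> 0) P" by simp
  show "((\<lambda>p. (of_nat (fst p))\<^sup>2 * (base_G (V (fst p) (snd p)) - base_G (snd p))
      - complex_of_real var * (base_G (snd p) * base_K (snd p))) \<longlongrightarrow> 0) (sequentially \<times>\<^sub>F principal (ball 0 (1/2)))"
    unfolding A_def[symmetric] P_def[symmetric]
  proof (rule Lim_null_comparison[OF _ lim], rule eventually_mono[OF ev])
    fix p assume p: "fst p \<ge> N \<and> fst p \<ge> 1 \<and> snd p \<in> A"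
    note f = facts[OF p]
    define \<zeta> where "\<zeta> = snd p"
    define X where "X = \<omega> p * defect (\<omega> p)"
    define s where "s = S (v p) \<zeta>"
    have n: "of_nat (fst p) \<noteq> (0::complex)" "\<omega> p \<noteq> 0" using f(5,11) by auto
    have s1: "norm s \<le> 1" "norm (s - base_K \<zeta>) \<le> norm (v p - \<zeta>)" "norm (base_G \<zeta>) \<le> 1"
      using S_bound[of "v p" \<zeta>] SK[of "v p" \<zeta>] G_bound[of \<zeta>] f(1,3) by (auto simp: s_def \<zeta>_def)
    have "(of_nat (fst p))\<^sup>2 * (base_G (v p) - base_G \<zeta>) = X * x p * s"
      using diff[of "v p" \<zeta>] f(1,3,10) n
      by (simp add: \<zeta>_def s_def X_def x_def power2_eq_square)
    hence "(of_nat (fst p))\<^sup>2 * (base_G (v p) - base_G \<zeta>) - complex_of_real var * (base_G \<zeta> * base_K \<zeta>)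
      = (X - complex_of_real var) * (x p * s) + complex_of_real var * ((x p - base_G \<zeta>) * s)
        + complex_of_real var * (base_G \<zeta> * (s - base_K \<zeta>))"
      by (simp add: algebra_simps)
    also have "norm \<dots> \<le> norm (X - complex_of_real var) * 1 + var * (norm (x p - base_G \<zeta>) * 1)
        + var * (1 * norm (v p - \<zeta>))"
    proof (intro norm_triangle_le add_mono)
      have "norm (x p * s) \<le> 1 * 1" unfolding norm_mult by (intro mult_mono x_bound p s1) auto
      thus "norm ((X - complex_of_real var) * (x p * s)) \<le> norm (X - complex_of_real var) * 1"
        unfolding norm_mult[of "X - _"] by (intro mult_left_mono) auto
      show "norm (complex_of_real var * ((x p - base_G \<zeta>) * s)) \<le> var * (norm (x p - base_G \<zeta>) * 1)"
        unfolding norm_mult using s1 var_nonneg by (simp add: mult_left_mono mult_left_le)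
      have "norm (base_G \<zeta>) * norm (s - base_K \<zeta>) \<le> 1 * norm (v p - \<zeta>)"
        using s1 by (intro mult_mono) auto
      thus "norm (complex_of_real var * (base_G \<zeta> * (s - base_K \<zeta>))) \<le> var * (1 * norm (v p - \<zeta>))"
        unfolding norm_mult using var_nonneg by (simp add: mult_left_mono)
    qed
    finally show "norm ((of_nat (fst p))\<^sup>2 * (base_G (V (fst p) (snd p)) - base_G (snd p))
        - complex_of_real var * (base_G (snd p) * base_K (snd p)))
       \<le> norm (\<omega> p * defect (\<omega> p) - complex_of_real var) + var * norm (x p - base_G (snd p))
            + var * norm (v p - snd p)"
      by (simp add: v_def \<zeta>_def X_def)
  qed
qed

end

subsection \<open>Failure of unimodality\<close>

text \<open>The f in the definition of unimodality is determined only up to null sets, so pointwise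
  bounds reach the continuous p through integrals: were p beyond c at t, it would be beyond an
  intermediate c' on a small interval, and the two integrals over it would differ.\<close>

lemma
  fixes p f :: "real \<Rightarrow> real"
  assumes cont: "continuous_on UNIV p" and c: "c \<ge> 0"
    and eq: "\<And>A. A \<in> sets borel \<Longrightarrow> (\<integral>\<^sup>+x. ennreal (p x) * indicator A x \<partial>lborel) = (\<integral>\<^sup>+x. ennreal (f x) * indicator A x \<partial>lborel)"
    and t: "t \<in> {l<..<r}"
  shows density_le_of_le: "(\<And>x. x \<in> {l<..<r} \<Longrightarrow> f x \<le> c) \<Longrightarrow> p t \<le> c"
    and density_ge_of_ge: "(\<And>x. x \<in> {l<..<r} \<Longrightarrow> c \<le> f x) \<Longrightarrow> (\<And>x. 0 \<le> p x) \<Longrightarrow> c \<le> p t"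
proof -
  have J: "(\<integral>\<^sup>+x. ennreal k * indicator {t-d<..<t+d} x \<partial>lborel) = ennreal (k * (2 * d))"
    if "d > 0" "k \<ge> 0" for d k
  proof -
    have "emeasure lborel {t-d<..<t+d} = ennreal (2 * d)" using that by simp
    thus ?thesis using that by (simp only: nn_integral_cmult_indicator sets_lborel borel_open[OF open_greaterThanLessThan] ennreal_mult)
  qed
  have ball: "ball t d = {t-d<..<t+d}" for d by (rule ball_eq_greaterThanLessThan)
  show "p t \<le> c" if f: "\<And>x. x \<in> {l<..<r} \<Longrightarrow> f x \<le> c"
  proof (rule ccontr)
    assume "\<not> p t \<le> c"
    define c' where "c' = (p t + c) / 2"
    have c': "c < c'" "c' < p t" using \<open>\<not> p t \<le> c\<close> by (auto simp: c'_def)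
    have "open ({x. c' < p x} \<inter> {l<..<r})" by (intro open_Int open_Collect_less continuous_on_const cont) auto
    moreover have "t \<in> {x. c' < p x} \<inter> {l<..<r}" using c' t by auto
    ultimately obtain d where "d > 0" "ball t d \<subseteq> {x. c' < p x} \<inter> {l<..<r}" by (rule openE)
    hence d: "d > 0" "{t-d<..<t+d} \<subseteq> {x. c' < p x} \<inter> {l<..<r}" by (simp_all add: ball)
    have "ennreal (c' * (2 * d)) = (\<integral>\<^sup>+x. ennreal c' * indicator {t-d<..<t+d} x \<partial>lborel)"
      using J[OF d(1), of "c'"] c c' by simp
    also have "\<dots> \<le> (\<integral>\<^sup>+x. ennreal (p x) * indicator {t-d<..<t+d} x \<partial>lborel)"
      using d(2) by (intro nn_integral_mono) (auto simp: indicator_def intro!: ennreal_leI intro: less_imp_le)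
    also have "\<dots> = (\<integral>\<^sup>+x. ennreal (f x) * indicator {t-d<..<t+d} x \<partial>lborel)" by (rule eq) simp
    also have "\<dots> \<le> (\<integral>\<^sup>+x. ennreal c * indicator {t-d<..<t+d} x \<partial>lborel)"
      using d(2) f by (intro nn_integral_mono) (auto simp: indicator_def intro!: ennreal_leI)
    also have "\<dots> = ennreal (c * (2 * d))"
      using J[OF d(1), of "c"] c c' by simp
    finally have "c' * (2 * d) \<le> c * (2 * d)" using c c' d by simp
    thus False using c' d by simp
  qed
  show "c \<le> p t" if f: "\<And>x. x \<in> {l<..<r} \<Longrightarrow> c \<le> f x" and p0: "\<And>x. 0 \<le> p x"
  proof (rule ccontr)
    assume "\<not> c \<le> p t"
    define c' where "c' = (p t + c) / 2"
    have c': "c' < c" "p t < c'" "c' \<ge> 0" using \<open>\<not> c \<le> p t\<close> p0[of t] c by (auto simp: c'_def)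
    have "open ({x. p x < c'} \<inter> {l<..<r})" by (intro open_Int open_Collect_less continuous_on_const cont) auto
    moreover have "t \<in> {x. p x < c'} \<inter> {l<..<r}" using c' t by auto
    ultimately obtain d where "d > 0" "ball t d \<subseteq> {x. p x < c'} \<inter> {l<..<r}" by (rule openE)
    hence d: "d > 0" "{t-d<..<t+d} \<subseteq> {x. p x < c'} \<inter> {l<..<r}" by (simp_all add: ball)
    have "ennreal (c * (2 * d)) = (\<integral>\<^sup>+x. ennreal c * indicator {t-d<..<t+d} x \<partial>lborel)"
      using J[OF d(1), of "c"] c c' by simp
    also have "\<dots> \<le> (\<integral>\<^sup>+x. ennreal (f x) * indicator {t-d<..<t+d} x \<partial>lborel)"
      using d(2) f by (intro nn_integral_mono) (auto simp: indicator_def intro!: ennreal_leI)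
    also have "\<dots> = (\<integral>\<^sup>+x. ennreal (p x) * indicator {t-d<..<t+d} x \<partial>lborel)" by (rule eq[symmetric]) simp
    also have "\<dots> \<le> (\<integral>\<^sup>+x. ennreal c' * indicator {t-d<..<t+d} x \<partial>lborel)"
      using d(2) by (intro nn_integral_mono) (auto simp: indicator_def intro!: ennreal_leI intro: less_imp_le)
    also have "\<dots> = ennreal (c' * (2 * d))"
      using J[OF d(1), of "c'"] c c' by simp
    finally have "c * (2 * d) \<le> c' * (2 * d)" using c c' d by simp
    thus False using c' d by simp
  qed
qed

text \<open>A measure with a density has no atom, so f is another density of it. For x < y on the
  increasing side the midpoint u is a bridge: f is at most f u to the left of u and at least f u to
  the right, hence p x <= f u <= p y. The other side is the mirror image.\<close>

lemma unimodal_continuous_density: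
  assumes uni: "unimodal (density lborel (\<lambda>x. ennreal (p x)))"
    and cont: "continuous_on UNIV p" and p0: "\<And>x. 0 \<le> p x"
  obtains a where "mono_on {..<a} p" "antimono_on {a<..} p"
proof -
  let ?\<mu> = "density lborel (\<lambda>x. ennreal (p x))"
  have [measurable]: "p \<in> borel_measurable borel" by (rule borel_measurable_continuous_onI[OF cont])
  obtain a f where f0: "\<And>x. 0 \<le> f x" and fm: "mono_on {..<a} f" "antimono_on {a<..} f"
    and A: "\<And>A. A \<in> sets borel \<Longrightarrow> emeasure ?\<mu> A =
          emeasure ?\<mu> {a} * emeasure (return borel a) A + (\<integral>\<^sup>+x\<in>A. ennreal (f x) \<partial>lborel)"
    using uni unfolding unimodal_def by blast
  have "emeasure ?\<mu> {a} = 0"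
    by (subst emeasure_density) (auto simp: nn_integral_indicator_singleton)
  hence eq: "(\<integral>\<^sup>+x. ennreal (p x) * indicator A x \<partial>lborel) = (\<integral>\<^sup>+x. ennreal (f x) * indicator A x \<partial>lborel)"
    if "A \<in> sets borel" for A
    using A[OF that] that by (simp add: emeasure_density)
  show ?thesis
  proof (rule that)
    show "mono_on {..<a} p"
    proof (rule mono_onI)
      fix x y assume xy: "x \<in> {..<a}" "y \<in> {..<a}" "x \<le> y"
      show "p x \<le> p y"
      proof (cases "x = y")
        case False
        define u where "u = (x + y) / 2"
        have u: "x < u" "u < y" using xy False by (auto simp: u_def)
        have "p x \<le> f u"
          by (rule density_le_of_le[OF cont f0 eq, of x "x - 1" u])
             (use u xy in \<open>auto intro!: mono_onD[OF fm(1)]\<close>)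
        also have "f u \<le> p y"
          by (rule density_ge_of_ge[OF cont f0 eq, of y u a])
             (use u xy p0 in \<open>auto intro!: mono_onD[OF fm(1)]\<close>)
        finally show ?thesis .
      qed simp
    qed
    show "antimono_on {a<..} p"
    proof (rule monotone_onI)
      fix x y assume xy: "x \<in> {a<..}" "y \<in> {a<..}" "x \<le> y"
      show "p x \<ge> p y"
      proof (cases "x = y")
        case False
        define u where "u = (x + y) / 2"
        have u: "x < u" "u < y" using xy False by (auto simp: u_def)
        have "p y \<le> f u"
          by (rule density_le_of_le[OF cont f0 eq, of y u "y + 1"])
             (use u xy in \<open>auto intro!: monotone_onD[OF fm(2)]\<close>)
        also have "f u \<le> p x"
          by (rule density_ge_of_ge[OF cont f0 eq, of x a u])
             (use u xy p0 in \<open>auto intro!: monotone_onD[OF fm(2)]\<close>)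
        finally show ?thesis .
      qed simp
    qed
  qed
qed

text \<open>A negative slope at x forces the mode to be at most x, for otherwise p would not
  decrease just to the right of x. Past the mode p is non-increasing.\<close>

lemma unimodal_density_negative_slope:
  assumes uni: "unimodal (density lborel (\<lambda>x. ennreal (p x)))"
    and cont: "continuous_on UNIV p" and p0: "\<And>x. 0 \<le> p x"
    and D: "(p has_real_derivative D) (at x)" "D < 0"
    and xy: "x < y" "y \<le> z"
  shows "p z \<le> p y"
proof -
  obtain a where a: "mono_on {..<a} p" "antimono_on {a<..} p"
    using unimodal_continuous_density[OF uni cont p0] by blast
  have "a \<le> x"
  proof (rule ccontr)
    assume "\<not> a \<le> x"
    obtain d where d: "d > 0" "\<And>h. h > 0 \<Longrightarrow> h < d \<Longrightarrow> p (x + h) < p x"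
      using DERIV_neg_dec_right[OF D] by auto
    define h where "h = min d (a - x) / 2"
    have h0: "h > 0" "h \<le> d / 2" "h \<le> (a - x) / 2" using d \<open>\<not> a \<le> x\<close> by (auto simp: h_def)
    have "h < d" using h0 d(1) by linarith
    have "a - x > 0" using \<open>\<not> a \<le> x\<close> by simp
    hence "(a - x) / 2 < a - x" by simp
    hence "x + h < a" using h0(3) by linarith
    hence "p x \<le> p (x + h)" using h0(1) by (intro mono_onD[OF a(1)]) auto
    thus False using d(2)[OF h0(1) \<open>h < d\<close>] by simp
  qed
  then show ?thesis using xy by (intro monotone_onD[OF a(2)]) auto
qed

text \<open>Serves twice: W = id, m = 0 gives the dilated base measure, and W = V n with m the mean
  of \<Lambda> gives its convolution with \<Lambda>.\<close>

lemma base_perturbation_distribution: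
  fixes W :: "complex \<Rightarrow> complex" and m :: real and n :: nat
  defines "H \<equiv> \<lambda>z. base_G (W ((z - of_real m) / of_nat n)) / of_nat n"
  defines "\<kappa> \<equiv> density lborel (\<lambda>x. ennreal (- Im (H (complex_of_real x)) / pi))"
  assumes n: "n \<ge> 1" and Wh: "W holomorphic_on {\<zeta>. Im \<zeta> > -1}"
    and W: "\<And>\<zeta>. Im \<zeta> > -1 \<Longrightarrow> Im (W \<zeta>) > -2 \<and> norm (W \<zeta> - \<zeta>) \<le> 1"
  shows "H holomorphic_on {z. Im z > -1}" and "Im z > -1 \<Longrightarrow> Im (H z) < 0"
    and "real_distribution \<kappa>" and "Im z > 0 \<Longrightarrow> cauchy_transform \<kappa> z = H z"
proof -
  have Imz: "Im ((z - of_real m) / of_nat n) > -1" if "Im z > -1" for z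
    using that n by (simp add: Im_divide_of_nat less_divide_eq)
  show Hh: "H holomorphic_on {z. Im z > -1}"
  proof -
    have "(\<lambda>z. (z - of_real m) / of_nat n) holomorphic_on {z. Im z > -1}"
      using n by (intro holomorphic_intros) auto
    hence "W \<circ> (\<lambda>z. (z - of_real m) / of_nat n) holomorphic_on {z. Im z > -1}"
      by (rule holomorphic_on_compose_gen[OF _ Wh]) (use Imz in auto)
    hence "base_G \<circ> (W \<circ> (\<lambda>z. (z - of_real m) / of_nat n)) holomorphic_on {z. Im z > -1}"
      by (rule holomorphic_on_compose_gen[OF _ base_G_holomorphic]) (use W Imz in fastforce)
    thus ?thesis using n unfolding H_def o_def by (intro holomorphic_intros) auto
  qed
  have neg: "Im (H z) < 0" if "Im z > -1" for z
    using Im_base_G_neg W[OF Imz[OF that]] n unfolding H_def by (simp add: Im_divide_of_nat divide_neg_pos)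
  then show "Im z > -1 \<Longrightarrow> Im (H z) < 0" .
  \<comment> \<open>Bounds the distance from w to n W((w - m) / n). For |w| >= 2 b + 400 n the
    argument of \<open>base_G\<close> then has norm at least 200, as its decay estimate
    requires.\<close>
  define b where "b = \<bar>m\<bar> + real n"
  have dec: "norm (H w - 1 / w) \<le> (800 * real n + 2 * b) / (norm w)\<^sup>2"
    if w: "Im w \<ge> 0" "norm w \<ge> 2 * b + 400 * real n" for w
  proof -
    define \<zeta> where "\<zeta> = (w - of_real m) / of_nat n"
    define v where "v = W \<zeta>"
    have n0: "real n \<ge> 1" "(of_nat n :: complex) \<noteq> 0" using n by auto
    have b: "b \<ge> 0" by (simp add: b_def)
    have v: "Im v > -2" "norm (v - \<zeta>) \<le> 1" using W[OF Imz[of w]] w by (auto simp: v_def \<zeta>_def)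
    have "of_nat n * v - w = of_nat n * (v - \<zeta>) - of_real m"
      using n0 by (simp add: \<zeta>_def field_simps)
    also have "norm \<dots> \<le> norm (of_nat n * (v - \<zeta>)) + norm (complex_of_real m)" by (rule norm_triangle_ineq4)
    also have "\<dots> \<le> real n * 1 + \<bar>m\<bar>"
      unfolding norm_mult using v by (intro add_mono mult_mono) auto
    finally have nv: "norm (of_nat n * v - w) \<le> b" by (simp add: b_def)
    have nv2: "norm w / 2 \<le> real n * norm v"
      using norm_triangle_ineq2[of w "w - of_nat n * v"] nv w n0 b by (simp add: norm_minus_commute norm_mult)
    have w0: "norm w > 0" using w n0 b by linarith
    have "400 * real n \<le> norm w" using w b by linarith
    hence "200 * real n \<le> real n * norm v" using nv2 by linarith
    hence v200: "norm v \<ge> 200" using n0 by (simp add: mult.commute)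
    have vz: "v \<noteq> 0" "w \<noteq> 0" using v200 w0 by auto
    have 1: "norm ((base_G v - 1 / v) / of_nat n) \<le> 800 * real n / (norm w)\<^sup>2"
    proof -
      have "norm ((base_G v - 1 / v) / of_nat n) = norm (base_G v - 1 / v) / real n"
        by (simp add: norm_divide)
      also have "\<dots> \<le> 200 / (norm v)\<^sup>2 / real n"
        by (intro divide_right_mono base_G_decay v v200) simp
      also have "\<dots> = 200 * real n / (real n * norm v)\<^sup>2"
        using n0 by (simp add: power2_eq_square)
      also have "\<dots> \<le> 200 * real n / (norm w / 2)\<^sup>2"
        using nv2 w0 n0 by (intro divide_left_mono power_mono mult_pos_pos) auto
      finally show ?thesis by (simp add: power_divide)
    qed
    have 2: "norm (1 / (of_nat n * v) - 1 / w) \<le> 2 * b / (norm w)\<^sup>2"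
    proof -
      have "1 / (of_nat n * v) - 1 / w = (w - of_nat n * v) / (of_nat n * v * w)"
        using vz n0 by (simp add: diff_frac_eq)
      also have "norm \<dots> \<le> b / (norm w / 2 * norm w)"
        unfolding norm_divide norm_mult using nv nv2 w0 b
        by (intro frac_le mult_right_mono mult_pos_pos) (auto simp: norm_minus_commute)
      finally show ?thesis by (simp add: power2_eq_square mult.commute)
    qed
    have "H w - 1 / w = (base_G v - 1 / v) / of_nat n + (1 / (of_nat n * v) - 1 / w)"
      using n0 vz by (simp add: H_def v_def \<zeta>_def diff_divide_distrib mult.commute)
    also have "norm \<dots> \<le> 800 * real n / (norm w)\<^sup>2 + 2 * b / (norm w)\<^sup>2"
      using norm_triangle_ineq 1 2 by (rule order_trans[OF _ add_mono])
    finally show ?thesis by (simp add: add_divide_distrib)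
  qed
  note B = cauchy_transform_of_boundary_density[of 1 H "2 * b + 400 * real n" "800 * real n + 2 * b"]
  show "real_distribution \<kappa>" unfolding \<kappa>_def
    by (rule B(1)) (use Hh dec neg in \<open>auto intro: less_imp_le\<close>)
  show "Im z > 0 \<Longrightarrow> cauchy_transform \<kappa> z = H z" unfolding \<kappa>_def
    by (rule B(2)) (use Hh dec neg in \<open>auto intro: less_imp_le\<close>)
qed

definition scaled_base :: "nat \<Rightarrow> real measure" where
  "scaled_base n = density lborel (\<lambda>x. ennreal (base_density (x / real n) / real n))"

lemma scaled_base:
  assumes n: "n \<ge> 1"
  shows "real_distribution (scaled_base n)" and "unimodal (scaled_base n)"
    and "Im z > 0 \<Longrightarrow> cauchy_transform (scaled_base n) z = base_G (z / of_nat n) / of_nat n"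
proof -
  have eq: "scaled_base n = density lborel (\<lambda>x. ennreal (- Im (base_G (id ((complex_of_real x - complex_of_real 0) / of_nat n)) / of_nat n) / pi))"
    using n by (simp add: scaled_base_def base_density_def mult.commute)
  show "real_distribution (scaled_base n)" unfolding eq
    by (rule base_perturbation_distribution(3)) (use n in \<open>auto simp: id_def\<close>)
  show "Im z > 0 \<Longrightarrow> cauchy_transform (scaled_base n) z = base_G (z / of_nat n) / of_nat n"
    unfolding eq using base_perturbation_distribution(4)[of n id z 0] n by (simp add: id_def)
  obtain a where a: "mono_on {..a} base_density" "antimono_on {a..} base_density"
    using base_density_modal by blast
  have pos: "base_density x \<ge> 0" for x
    unfolding base_density_def using Im_base_G_neg[of "complex_of_real x"] by (simp add: divide_le_0_iff)
  have "isCont base_density x" for x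
    using base_density_derivative[of x] DERIV_isCont by metis
  hence "continuous_on UNIV base_density" by (simp add: continuous_at_imp_continuous_on)
  hence [measurable]: "base_density \<in> borel_measurable borel" by (rule borel_measurable_continuous_onI)
  show "unimodal (scaled_base n)"
    unfolding unimodal_def
  proof (intro conjI exI[of _ "real n * a"] exI[of _ "\<lambda>x. base_density (x / real n) / real n"] allI ballI)
    show "sets (scaled_base n) = sets borel" by (simp add: scaled_base_def)
    show "0 \<le> base_density (x / real n) / real n" for x using pos by simp
    have 1: "x < real n * a \<Longrightarrow> x / real n \<le> a" "real n * a < x \<Longrightarrow> a \<le> x / real n" for x
      using n by (simp_all add: field_simps)
    show "mono_on {..<real n * a} (\<lambda>x. base_density (x / real n) / real n)"
      by (rule mono_onI) (use 1 in \<open>auto intro!: divide_right_mono mono_onD[OF a(1)]\<close>)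
    show "antimono_on {real n * a<..} (\<lambda>x. base_density (x / real n) / real n)"
      by (rule monotone_onI) (use 1 in \<open>auto intro!: divide_right_mono monotone_onD[OF a(2)]\<close>)
    fix A :: "real set" assume A: "A \<in> sets borel"
    have "emeasure (scaled_base n) {real n * a} = 0"
      unfolding scaled_base_def by (subst emeasure_density) (auto simp: nn_integral_indicator_singleton)
    thus "emeasure (scaled_base n) A = emeasure (scaled_base n) {real n * a} * emeasure (return borel (real n * a)) A
        + (\<integral>\<^sup>+x\<in>A. ennreal (base_density (x / real n) / real n) \<partial>lborel)"
      using A by (simp add: scaled_base_def emeasure_density)
  qed
qed

lemma zero_variance_imp_return:
  assumes \<Lambda>: "real_distribution \<Lambda>" and "integrable \<Lambda> (\<lambda>x. (x - m)\<^sup>2)" "(LINT x|\<Lambda>. (x - m)\<^sup>2) = 0"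
  shows "\<Lambda> = return borel m"
proof -
  interpret real_distribution \<Lambda> by fact
  have AE: "AE x in \<Lambda>. x = m"
    using integral_nonneg_eq_0_iff_AE[OF assms(2)] assms(3) by simp
  show ?thesis
  proof (rule measure_eqI)
    show "sets \<Lambda> = sets (return borel m)" by simp
    fix A assume "A \<in> sets \<Lambda>"
    hence A: "A \<in> sets borel" by simp
    show "emeasure \<Lambda> A = emeasure (return borel m) A"
    proof (cases "m \<in> A")
      case True
      have "emeasure \<Lambda> A = emeasure \<Lambda> UNIV"
        by (rule emeasure_eq_AE) (use AE True A in auto)
      thus ?thesis using True A emeasure_space_1 by simp
    next
      case False
      have "emeasure \<Lambda> A = emeasure \<Lambda> {}"
        by (rule emeasure_eq_AE) (use AE False A in auto)
      thus ?thesis using False A by simp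
    qed
  qed
qed

theorem theorem1p4:
  fixes \<Lambda> :: "real measure"
  assumes "real_distribution \<Lambda>"
    and "integrable \<Lambda> (\<lambda>x. x\<^sup>2)"
    and "\<forall>a. \<Lambda> \<noteq> return borel a"
  shows "\<not> freely_strongly_unimodal \<Lambda>"
proof
  assume fsu: "freely_strongly_unimodal \<Lambda>"
  interpret \<Lambda>: real_distribution \<Lambda> by fact
  have int1: "integrable \<Lambda> (\<lambda>x. x)"
    by (rule \<Lambda>.square_integrable_imp_integrable[OF _ assms(2)]) simp
  \<comment> \<open>Centering \<Lambda> at its mean turns into a translation of the variable: the
    convolution is described at \<zeta> = (z - m) / n, so \<zeta> = 0 is the real point m.\<close>
  define m where "m = (LINT x|\<Lambda>. x)"
  define M where "M = distr \<Lambda> borel (\<lambda>x. x - m)"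
  have sq: "(x - m)\<^sup>2 = x\<^sup>2 + (m\<^sup>2 - 2 * m * x)" for x
    by (simp add: power2_eq_square algebra_simps)
  have int2: "integrable \<Lambda> (\<lambda>x. (x - m)\<^sup>2)"
    unfolding sq using assms(2) int1 by simp
  interpret M: centered_finite_variance M
  proof (intro centered_finite_variance.intro centered_finite_variance_axioms.intro)
    show "real_distribution M" unfolding M_def by (rule \<Lambda>.real_distribution_distr) simp
    show "integrable M (\<lambda>x. x\<^sup>2)" unfolding M_def by (subst integrable_distr_eq) (use int2 in simp_all)
    have "(LINT x|M. x) = (LINT x|\<Lambda>. x - m)" unfolding M_def by (rule integral_distr) auto
    also have "\<dots> = (LINT x|\<Lambda>. x) - (LINT x|\<Lambda>. m)"
      by (rule Bochner_Integration.integral_diff) (use int1 in auto)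
    also have "\<dots> = 0" using \<Lambda>.prob_space unfolding m_def by simp
    finally show "(LINT x|M. x) = 0" .
  qed
  have "M.var \<noteq> 0"
  proof
    assume "M.var = 0"
    hence "(LINT x|\<Lambda>. (x - m)\<^sup>2) = 0"
      using integral_distr[of "\<lambda>x. x - m" \<Lambda> borel "\<lambda>x. x\<^sup>2", folded M_def] by (simp add: M.var_def)
    thus False using zero_variance_imp_return[OF assms(1) int2] assms(3) by blast
  qed
  hence var: "M.var > 0" using M.var_nonneg by simp
  have \<Lambda>M: "cauchy_transform \<Lambda> w = cauchy_transform M (w - of_real m)" for w
    unfolding cauchy_transform_def M_def
    using integral_distr[of "\<lambda>x. x - m" \<Lambda> borel "\<lambda>x. 1 / (w - of_real m - complex_of_real x)"] by simp
  obtain L V N where L: "\<And>y. Im y > M.var + 4 \<Longrightarrow> Im (L y) > M.var + 3 \<and> L y - M.defect (L y) = y \<and> norm (L y - y) \<le> 1"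
    and N: "\<And>n. n \<ge> N \<Longrightarrow> real n \<ge> 3 * M.var + 4"
    and Vh: "\<And>n. n \<ge> N \<Longrightarrow> V n holomorphic_on {\<zeta>. Im \<zeta> > -1}"
    and V: "\<And>n \<zeta>. n \<ge> N \<Longrightarrow> Im \<zeta> > -1 \<Longrightarrow> Im (V n \<zeta>) > -2 \<and>
        V n \<zeta> + M.defect (L (of_nat n * base_F (V n \<zeta>))) / of_nat n = \<zeta> \<and>
        norm (V n \<zeta> - \<zeta>) \<le> M.var / (real n)\<^sup>2 \<and> norm (V n \<zeta> - \<zeta>) \<le> 1/3"
    by (rule M.subordination_functions) blast
  define H where "H = (\<lambda>n z. base_G (V n ((z - of_real m) / of_nat n)) / of_nat n)"
  define p where "p = (\<lambda>n x. - Im (H n (complex_of_real x)) / pi)"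
  define \<kappa> where "\<kappa> = (\<lambda>n. density lborel (\<lambda>x. ennreal (p n x)))"
  have n1: "n \<ge> 1" if "n \<ge> N" for n using N[OF that] M.var_nonneg by linarith
  have V1: "Im (V n \<zeta>) > -2 \<and> norm (V n \<zeta> - \<zeta>) \<le> 1" if "n \<ge> N" "Im \<zeta> > -1" for n \<zeta>
    using V[OF that] by linarith
  have B: "H n holomorphic_on {z. Im z > -1}" "\<And>z. Im z > -1 \<Longrightarrow> Im (H n z) < 0"
    and \<kappa>: "real_distribution (\<kappa> n)" "\<And>z. Im z > 0 \<Longrightarrow> cauchy_transform (\<kappa> n) z = H n z" if n: "n \<ge> N" for n
    using base_perturbation_distribution[where m=m, OF n1[OF n] Vh[OF n] V1[OF n]]
    by (simp_all add: H_def \<kappa>_def p_def)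
  \<comment> \<open>The subordination functions are \<omega>1 = m + L(n \<open>base_F\<close> v) and
    \<omega>2 = n v. Their distance from iy is bounded for fixed n, since \<open>base_F\<close> v -
    v and v - \<zeta> are bounded.\<close>
  have conv: "\<Lambda> \<boxplus> scaled_base n = \<kappa> n" if n: "n \<ge> N" for n
  proof (rule free_convolution_eqI[OF assms(1) scaled_base(1)[OF n1[OF n]] \<kappa>(1)[OF n]])
    let ?z = "\<lambda>y. \<i> * complex_of_real y"
    define v where "v = (\<lambda>y. V n ((?z y - of_real m) / of_nat n))"
    show "\<forall>\<^sub>F y in at_top.
      cauchy_transform \<Lambda> (of_real m + L (of_nat n * base_F (v y))) = cauchy_transform (\<kappa> n) (?z y) \<and>
      cauchy_transform (scaled_base n) (of_nat n * v y) = cauchy_transform (\<kappa> n) (?z y) \<and>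
      (of_real m + L (of_nat n * base_F (v y))) + of_nat n * v y = ?z y + 1 / cauchy_transform (\<kappa> n) (?z y) \<and>
      norm ((of_real m + L (of_nat n * base_F (v y))) - ?z y) \<le> \<bar>m\<bar> + 101 * real n \<and>
      norm (of_nat n * v y - ?z y) \<le> \<bar>m\<bar> + 101 * real n"
      using eventually_gt_at_top[of "real n"]
    proof eventually_elim
      case (elim y)
      have n0: "real n \<ge> 1" "(of_nat n :: complex) \<noteq> 0" "real n \<ge> 3 * M.var + 4" using n1[OF n] N[OF n] by auto
      define \<zeta> where "\<zeta> = (?z y - of_real m) / of_nat n"
      define w where "w = of_nat n * base_F (v y)"
      have n\<zeta>: "of_nat n * \<zeta> = ?z y - of_real m" using n0 by (simp add: \<zeta>_def)
      have "Im \<zeta> > -1" using elim n0 by (simp add: \<zeta>_def less_divide_eq)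
      from V[OF n this] have v: "Im (v y) > -2" "v y + M.defect (L w) / of_nat n = \<zeta>" "norm (v y - \<zeta>) \<le> 1/3"
        by (auto simp: v_def \<zeta>_def w_def)
      have F: "Im (base_F (v y)) \<ge> 40" "norm (base_F (v y) - v y) \<le> 100"
        using Im_base_F_ge norm_base_F_minus_id_le v by auto
      have "Im w \<ge> 40 * real n" using F n0 by (simp add: w_def)
      hence Imw: "Im w > M.var + 4" using n0 M.var_nonneg by linarith
      have Lw: "Im (L w) > 0" "L w - M.defect (L w) = w" using L[OF Imw] M.var_nonneg by auto
      have w0: "w \<noteq> 0" using Imw M.var_nonneg by auto
      have G\<kappa>: "cauchy_transform (\<kappa> n) (?z y) = base_G (v y) / of_nat n"
        using \<kappa>(2)[OF n, of "?z y"] elim n0 by (simp add: H_def v_def)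
      have Gw: "base_G (v y) / of_nat n = 1 / w"
        using base_G_eq[of "v y"] v by (simp add: w_def mult.commute)
      have GM: "cauchy_transform M (L w) = 1 / w"
        using Lw M.cauchy_transform_nonzero[OF Lw(1)] by (simp add: M.defect_def) (metis divide_inverse inverse_inverse_eq mult_1)
      have diff: "of_nat n * v y - ?z y = of_nat n * (v y - \<zeta>) - of_real m"
        using n\<zeta> by (simp add: right_diff_distrib)
      have vn: "norm (of_nat n * (v y - \<zeta>)) \<le> real n * (1/3)"
        unfolding norm_mult norm_of_nat by (intro mult_left_mono v) simp
      have nv: "norm (of_nat n * v y - ?z y) \<le> real n * (1/3) + \<bar>m\<bar>"
        unfolding diff by (intro order_trans[OF norm_triangle_ineq4 add_mono] vn) simp
      have sum: "of_real m + L w + of_nat n * v y = ?z y + w"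
      proof -
        have e: "of_nat n * v y + M.defect (L w) = of_nat n * \<zeta>"
          unfolding v(2)[symmetric] using n0 by (simp add: distrib_left)
        have "of_real m + L w + of_nat n * v y
            = of_real m + (L w - M.defect (L w)) + (of_nat n * v y + M.defect (L w))" by simp
        also have "\<dots> = ?z y + w" unfolding e n\<zeta> Lw(2) by simp
        finally show ?thesis .
      qed
      have "of_real m + L w - ?z y = of_nat n * (base_F (v y) - v y)"
        using sum by (simp add: w_def algebra_simps)
      hence nL: "norm (of_real m + L w - ?z y) \<le> real n * 100"
        unfolding norm_mult norm_of_nat using F(2) by (metis mult_left_mono norm_mult norm_of_nat of_nat_0_le_iff)
      have Imnv: "Im (of_nat n * v y) > 0"
      proof -
        have "\<bar>Im (of_nat n * v y - (?z y - of_real m))\<bar> \<le> real n * (1/3)"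
          unfolding n\<zeta>[symmetric] right_diff_distrib[symmetric]
          by (rule order_trans[OF abs_Im_le_cmod vn])
        hence "\<bar>Im (of_nat n * v y) - y\<bar> \<le> real n * (1/3)" by simp
        thus ?thesis using elim n0(1) by linarith
      qed
      have "cauchy_transform \<Lambda> (of_real m + L w) = cauchy_transform (\<kappa> n) (?z y)"
        unfolding \<Lambda>M G\<kappa> Gw using GM by simp
      moreover have "cauchy_transform (scaled_base n) (of_nat n * v y) = cauchy_transform (\<kappa> n) (?z y)"
        unfolding G\<kappa> scaled_base(3)[OF n1[OF n] Imnv] using n0 by simp
      moreover have "of_real m + L w + of_nat n * v y = ?z y + 1 / cauchy_transform (\<kappa> n) (?z y)"
        unfolding G\<kappa> Gw sum by simp
      ultimately show ?case using nL nv n0 unfolding w_def by simp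
    qed
  qed
  have uni: "unimodal (\<kappa> n)" if "n \<ge> N" for n
    using fsu scaled_base(1,2)[OF n1[OF that]] conv[OF that]
    unfolding freely_strongly_unimodal_def by metis
  define D where "D = (\<lambda>n \<zeta>. (of_nat n)\<^sup>2 * (base_G (V n \<zeta>) - base_G \<zeta>))"
  define l where "l = (\<lambda>\<zeta>. complex_of_real M.var * (base_G \<zeta> * base_K \<zeta>))"
  have ul: "uniform_limit (ball 0 (1/2)) D l sequentially"
    unfolding D_def l_def by (rule M.uniform_limit_first_order[OF L N V])
  have ball: "Im \<zeta> > -1" if "\<zeta> \<in> ball 0 (1/2)" for \<zeta>
    using that abs_Im_le_cmod[of \<zeta>] by (auto simp: dist_norm)
  have GVh: "(\<lambda>\<zeta>. base_G (V n \<zeta>)) holomorphic_on ball 0 (1/2)" if n: "n \<ge> N" for n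
  proof -
    have "V n holomorphic_on ball 0 (1/2)" by (rule holomorphic_on_subset[OF Vh[OF n]]) (use ball in auto)
    hence "base_G \<circ> V n holomorphic_on ball 0 (1/2)"
      by (rule holomorphic_on_compose_gen[OF _ base_G_holomorphic]) (use V1[OF n] ball in fastforce)
    thus ?thesis by (simp add: o_def)
  qed
  have Gh: "base_G holomorphic_on ball 0 (1/2)"
    by (rule holomorphic_on_subset[OF base_G_holomorphic]) (use ball in fastforce)
  \<comment> \<open>Uniform convergence of holomorphic functions on a complex disc passes to
    derivatives at its centre; this is why the expansion was proved off the real line as
    well.\<close>
  have "(\<lambda>n. (deriv ^^ 1) (D n) 0) \<longlonglongrightarrow> (deriv ^^ 1) l 0"
  proof (rule higher_deriv_complex_uniform_limit[OF ul])
    show "\<forall>\<^sub>F n in sequentially. D n holomorphic_on ball 0 (1/2)"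
      using eventually_ge_at_top[of N]
      by eventually_elim (auto simp: D_def intro!: holomorphic_intros GVh Gh)
  qed auto
  hence "(\<lambda>n. Im (deriv (D n) 0)) \<longlonglongrightarrow> Im (deriv l 0)" by (intro tendsto_Im) simp
  moreover have "Im (deriv l 0) > 0"
  proof -
    obtain d where d: "((\<lambda>s. base_G s * base_K s) has_field_derivative d) (at 0)" "Im d > 0"
      by (rule base_GK_derivative)
    have "deriv l 0 = complex_of_real M.var * d"
      unfolding l_def by (rule DERIV_imp_deriv[OF DERIV_cmult[OF d(1)]])
    thus ?thesis using var d(2) by simp
  qed
  ultimately have ev1: "\<forall>\<^sub>F n in sequentially. Im (deriv (D n) 0) > 0"
    by (rule order_tendstoD(1))
  \<comment> \<open>The derivative of D n at 0 is n^2 (d + \<open>base_K\<close> 0) with d that of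
    the perturbed transform. As \<open>base_K\<close> 0 is real, Im d inherits the positive sign
    however small the perturbation is, so the density has negative slope at m. Unimodality then
    compares the points m + n and m + 2n to its right.\<close>
  have slope: "p n (m + real n * 2) \<le> p n (m + real n * 1)" if n: "n \<ge> N" and pos: "Im (deriv (D n) 0) > 0" for n
  proof -
    have n0: "real n > 0" "(of_nat n :: complex) \<noteq> 0" using n1[OF n] by auto
    define d where "d = deriv (\<lambda>\<zeta>. base_G (V n \<zeta>)) 0"
    have d: "((\<lambda>\<zeta>. base_G (V n \<zeta>)) has_field_derivative d) (at 0)"
      unfolding d_def by (rule holomorphic_derivI[OF GVh[OF n]]) auto
    have "(D n has_field_derivative (of_nat n)\<^sup>2 * (d - - base_K 0)) (at 0)"
      unfolding D_def by (intro DERIV_cmult DERIV_diff d base_G_derivative) simp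
    hence "deriv (D n) 0 = (of_nat n)\<^sup>2 * (d + base_K 0)" by (simp add: DERIV_imp_deriv)
    also have "\<dots> = complex_of_real ((real n)\<^sup>2) * (d + base_K 0)" by simp
    finally have "Im (deriv (D n) 0) = (real n)\<^sup>2 * Im d"
      by (simp only: Im_complex_of_real Re_complex_of_real times_complex.sel plus_complex.sel Im_base_K_0) simp
    hence dpos: "Im d > 0" using pos n0 by (simp add: zero_less_mult_iff)
    have "((\<lambda>z. (z - of_real m) / of_nat n) has_field_derivative 1 / of_nat n) (at (complex_of_real m))"
      by (intro DERIV_cdivide) (auto intro!: derivative_eq_intros)
    from DERIV_chain2[OF _ this, of "\<lambda>\<zeta>. base_G (V n \<zeta>)" d]
    have "((\<lambda>z. base_G (V n ((z - of_real m) / of_nat n))) has_field_derivative d * (1 / of_nat n)) (at (complex_of_real m))"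
      using d by simp
    hence Hd: "(H n has_field_derivative d * (1 / of_nat n) / of_nat n) (at (complex_of_real m))"
      unfolding H_def by (rule DERIV_cdivide)
    have "((\<lambda>x. H n (complex_of_real x)) has_vector_derivative d * (1 / of_nat n) / of_nat n) (at m)"
      using Hd by (rule has_vector_derivative_real_field)
    hence "((\<lambda>x. Im (H n (complex_of_real x))) has_vector_derivative Im (d * (1 / of_nat n) / of_nat n)) (at m)"
      by (rule bounded_linear.has_vector_derivative[OF bounded_linear_Im])
    hence "((\<lambda>x. Im (H n (complex_of_real x))) has_real_derivative Im (d * (1 / of_nat n) / of_nat n)) (at m)"
      by (simp add: has_real_derivative_iff_has_vector_derivative)
    hence pd: "(p n has_real_derivative - Im (d * (1 / of_nat n) / of_nat n) / pi) (at m)"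
      unfolding p_def by (intro DERIV_cdivide DERIV_minus)
    have neg: "- Im (d * (1 / of_nat n) / of_nat n) / pi < 0"
      using dpos n0 by (simp add: divide_neg_pos)
    have cont: "continuous_on UNIV (p n)"
      unfolding p_def by (intro continuous_intros continuous_on_real_line[OF B(1)[OF n]]) auto
    have p0: "0 \<le> p n x" for x
      using B(2)[OF n, of "complex_of_real x"] by (simp add: p_def divide_le_0_iff)
    show ?thesis
      by (rule unimodal_density_negative_slope[OF uni[OF n, unfolded \<kappa>_def] cont p0 pd neg])
         (use n0 in auto)
  qed
  have pval: "p n (m + real n * t) = - Im (base_G (V n (complex_of_real t))) / pi / real n" if "n \<ge> N" for n t
    using n1[OF that] by (simp add: p_def H_def)
  have lim: "(\<lambda>n. - Im (base_G (V n (complex_of_real t))) / pi) \<longlonglongrightarrow> base_density t" for t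
  proof -
    have "(\<lambda>n. V n (complex_of_real t)) \<longlonglongrightarrow> complex_of_real t"
    proof (rule LIM_zero_cancel, rule Lim_null_comparison)
      show "\<forall>\<^sub>F n in sequentially. norm (V n (complex_of_real t) - complex_of_real t) \<le> M.var / (real n)\<^sup>2"
        using eventually_ge_at_top[of N] by eventually_elim (use V[of _ "complex_of_real t"] in auto)
      show "(\<lambda>n. M.var / (real n)\<^sup>2) \<longlonglongrightarrow> 0" by real_asymp
    qed
    moreover have "isCont base_G (complex_of_real t)"
      by (rule DERIV_isCont[OF base_G_derivative]) simp
    ultimately have "(\<lambda>n. base_G (V n (complex_of_real t))) \<longlonglongrightarrow> base_G (complex_of_real t)"
      by (rule isCont_tendsto_compose[rotated])
    thus ?thesis unfolding base_density_def by (intro tendsto_intros) auto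
  qed
  \<comment> \<open>The common factor 1 / n cancels and the weak inequality passes to the limit,
    against the strict one for the unperturbed density.\<close>
  have "base_density 2 \<le> base_density 1"
  proof (rule tendsto_le[OF _ lim[of 1] lim[of 2]])
    show "\<forall>\<^sub>F n in sequentially. - Im (base_G (V n (complex_of_real 2))) / pi \<le> - Im (base_G (V n (complex_of_real 1))) / pi"
      using eventually_ge_at_top[of N] ev1
    proof eventually_elim
      case (elim n)
      have "real n > 0" using n1[OF elim(1)] by simp
      thus ?case using slope[OF elim] unfolding pval[OF elim(1)] by (simp only: divide_le_cancel) auto
    qed
  qed simp
  moreover have "base_density 1 < base_density 2" using base_density_modal by blast
  ultimately show False by simp
qed

end
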